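(* For every $n\ge 4$, the four binary matrices $\mathcal{S}^{\{(n,n)\}}(\mathbf{M}_n)$, $\mathcal{S}^{G_{n-1}}(\mathbf{H}_{n-1})$, $\mathcal{S}^{Q_n}(\mathbf{D}_n)$ and $\mathcal{S}^{Q_{n+1}}(\mathbf{T}_{n+1})$ are minimally non-firm. Moreover, $\mathcal{S}^{Q_n}(\mathbf{D}_n)$ and $\mathcal{S}^{Q_{n+1}}(\mathbf{T}_{n+1})$ are totally balanced.
   Context: For a binary matrix $\mathbf{X}$, $\mathrm{supp}(\mathbf{X})=\{(i,j):x_{i,j}=1\}$; a submatrix is obtained by deleting rows and columns, and is proper if it omits at least one row or column; a rectangle is a set $I\times J\subseteq\mathrm{supp}(\mathbf{X})$; an isolated set is a subset of $\mathrm{supp}(\mathbf{X})$ no two distinct elements of which lie in a common rectangle; $i(\mathbf{X})$ is the maximum size of an isolated set; $br(\mathbf{X})$ is the minimum number of rectangles whose union is $\mathrm{supp}(\mathbf{X})$. $\mathbf{X}$ is minimally non-firm if $i(\mathbf{X})<br(\mathbf{X})$ and $i(\mathbf{X}')=br(\mathbf{X}')$ for every proper submatrix $\mathbf{X}'$. A binary matrix is totally balanced if it has no submatrix which, after permuting rows and columns, equals $\mathbf{C}_t$ for some $t\ge3$. Stretching: for $\mathbf{X}\in\{0,1\}^{m\times n}$ and nonempty $Q=\{(\ell_1,k_1),\dots,(\ell_q,k_q)\}\subseteq\mathrm{supp}(\mathbf{X})$ in lexicographic order, $\mathcal{S}^Q(\mathbf{X})$ is the $(m+q)\times(n+q)$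 binary matrix with top-left block $\mathbf{X}$, entries at $(\ell_t,n+t)$, $(m+t,k_t)$, $(m+t,n+t)$ equal to $1$ for $t\in[q]$, all other entries $0$. Matrices: for $t\ge3$, $\mathbf{C}_t\in\{0,1\}^{t\times t}$ has $1$s exactly at $(i,i),(i,i+1)$ for $i\in[t-1]$ and at $(t,1),(t,t)$. For $n\ge4$, $\mathbf{M}_n:=\mathcal{S}^{\{(n-1,n-1)\}}(\mathbf{C}_{n-1})\in\{0,1\}^{n\times n}$. For $t\ge3$, $\mathbf{H}_t:=[\mathbf{1},\mathbf{C}_t]\in\{0,1\}^{t\times(t+1)}$ (first column all ones, followed by $\mathbf{C}_t$) and $G_t:=\{(t,2),(t,t+1)\}$. For $n\ge4$, $\mathbf{D}_n\in\{0,1\}^{n\times n}$ has $1$s exactly at $(1,2),(1,3),(2,1),(2,2),(2,3)$, at $(3,j)$ for all $j\in[n]$, and at $(i,i-1),(i,i)$ for $4\le i\le n$ (equivalently $\mathbf{D}_4=\begin{bmatrix}0&1&1&0\\1&1&1&0\\1&1&1&1\\0&0&1&1\end{bmatrix}$ and $\mathbf{D}_n=\mathcal{S}^{\{(3,n-1)\}}(\mathbf{D}_{n-1})$). For $n\ge5$, $\mathbf{T}_n\in\{0,1\}^{n\times n}$ has $1$s exactly at $(1,2),(1,4),(2,1),(2,3),(3,2),(3,3),(3,4),(4,1),(4,3)$, at $(4,j)$ for $4\le j\le n$, and at $(i,i-1),(i,i)$ for $5\le i\le n$ (equivalently $\mathbf{T}_n=\mathcal{S}^{\{(4,n-1)\}}(\mathbf{T}_{n-1})$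 for $n\ge6$). $Q_n:=\{(1,2),(2,1),(n,n)\}$. *)

theory Defs
  imports Main "HOL-Library.Product_Lexorder"
begin

text \<open>A binary m x n matrix is represented as a triple (m, n, S) where S is the set of
  positions (i,j), 1-based, carrying entry 1.  Only positions in [m] x [n] count.\<close>

type_synonym bmat = "nat \<times> nat \<times> (nat \<times> nat) set"

definition nrows :: "bmat \<Rightarrow> nat" where "nrows X = fst X"
definition ncols :: "bmat \<Rightarrow> nat" where "ncols X = fst (snd X)"

definition supp :: "bmat \<Rightarrow> (nat \<times> nat) set" where
  "supp X = snd (snd X) \<inter> ({1..nrows X} \<times> {1..ncols X})"

definition is_rectangle :: "(nat \<times> nat) set \<Rightarrow> (nat \<times> nat) set \<Rightarrow> bool" where
  "is_rectangle S r \<longleftrightarrow> (\<exists>I J. r = I \<times> J \<and> I \<times> J \<subseteq> S)"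

definition isolated :: "(nat \<times> nat) set \<Rightarrow> (nat \<times> nat) set \<Rightarrow> bool" where
  "isolated S E \<longleftrightarrow> E \<subseteq> S \<and>
     (\<forall>x\<in>E. \<forall>y\<in>E. x \<noteq> y \<longrightarrow> \<not> (\<exists>r. is_rectangle S r \<and> x \<in> r \<and> y \<in> r))"

definition inum :: "(nat \<times> nat) set \<Rightarrow> nat" where
  "inum S = Max (card ` {E. isolated S E})"

definition brnum :: "(nat \<times> nat) set \<Rightarrow> nat" where
  "brnum S = Min (card ` {F. finite F \<and> (\<forall>r\<in>F. is_rectangle S r) \<and> \<Union>F = S})"

text \<open>Submatrices: keep rows R \<subseteq> [m] and columns C \<subseteq> [n] (the support of the submatrix is
  S restricted to R x C, up to the order-preserving reindexing of rows and columns, which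
  does not affect rectangles, i or br).  Proper: R or C is a strict subset.\<close>

definition minimally_non_firm :: "bmat \<Rightarrow> bool" where
  "minimally_non_firm X \<longleftrightarrow>
     inum (supp X) < brnum (supp X) \<and>
     (\<forall>R C. R \<subseteq> {1..nrows X} \<and> C \<subseteq> {1..ncols X} \<and>
        (R \<noteq> {1..nrows X} \<or> C \<noteq> {1..ncols X}) \<longrightarrow>
        inum (supp X \<inter> (R \<times> C)) = brnum (supp X \<inter> (R \<times> C)))"

definition Cmat :: "nat \<Rightarrow> bmat" where
  "Cmat t = (t, t, {(i, i) | i. 1 \<le> i \<and> i \<le> t - 1} \<union> {(i, i + 1) | i. 1 \<le> i \<and> i \<le> t - 1}
               \<union> {(t, 1), (t, t)})"

text \<open>Totally balanced: no choice of t \<ge> 3 distinct rows and t distinct columns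
  (in some order, i.e. a submatrix up to row/column permutation) giving exactly C_t.\<close>

definition totally_balanced :: "bmat \<Rightarrow> bool" where
  "totally_balanced X \<longleftrightarrow>
     \<not> (\<exists>t \<ge> 3. \<exists>r c. inj_on r {1..t} \<and> r ` {1..t} \<subseteq> {1..nrows X} \<and>
           inj_on c {1..t} \<and> c ` {1..t} \<subseteq> {1..ncols X} \<and>
           (\<forall>i\<in>{1..t}. \<forall>j\<in>{1..t}. ((r i, c j) \<in> supp X) = ((i, j) \<in> supp (Cmat t))))"

text \<open>Stretching. Q is listed in lexicographic order (Product_Lexorder).\<close>

definition stretch :: "(nat \<times> nat) set \<Rightarrow> bmat \<Rightarrow> bmat" where
  "stretch Q X =
     (let m = nrows X; n = ncols X; L = sorted_list_of_set Q; q = card Q in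
      (m + q, n + q,
       supp X \<union> (\<Union>t\<in>{1..q}. {(fst (L ! (t - 1)), n + t), (m + t, snd (L ! (t - 1))), (m + t, n + t)})))"

definition Mmat :: "nat \<Rightarrow> bmat" where
  "Mmat n = stretch {(n - 1, n - 1)} (Cmat (n - 1))"

definition Hmat :: "nat \<Rightarrow> bmat" where
  "Hmat t = (t, t + 1, {(i, 1) | i. 1 \<le> i \<and> i \<le> t} \<union> {(i, j + 1) | i j. (i, j) \<in> supp (Cmat t)})"

definition Gset :: "nat \<Rightarrow> (nat \<times> nat) set" where
  "Gset t = {(t, 2), (t, t + 1)}"

definition Dmat :: "nat \<Rightarrow> bmat" where
  "Dmat n = (n, n, {(1, 2), (1, 3), (2, 1), (2, 2), (2, 3)} \<union> {(3, j) | j. 1 \<le> j \<and> j \<le> n}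
      \<union> {(i, i - 1) | i. 4 \<le> i \<and> i \<le> n} \<union> {(i, i) | i. 4 \<le> i \<and> i \<le> n})"

definition Tmat :: "nat \<Rightarrow> bmat" where
  "Tmat n = (n, n, {(1, 2), (1, 4), (2, 1), (2, 3), (3, 2), (3, 3), (3, 4), (4, 1), (4, 3)}
      \<union> {(4, j) | j. 4 \<le> j \<and> j \<le> n}
      \<union> {(i, i - 1) | i. 5 \<le> i \<and> i \<le> n} \<union> {(i, i) | i. 5 \<le> i \<and> i \<le> n})"

definition Qset :: "nat \<Rightarrow> (nat \<times> nat) set" where
  "Qset n = {(1, 2), (2, 1), (n, n)}"

end

theory Submission
  imports Defs
begin

text \<open>
  Join two entries of the support if they lie in a common rectangle. Rectangle covers are clique covers of
  this graph and isolated sets are its independent sets, so a matrix is firm iff independence number and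
  clique cover number agree. A vertex whose closed neighbourhood is a clique may be removed together with
  its neighbourhood, which lowers both numbers by one. In a stretched matrix every added row or column yields
  such a vertex; removing them all leaves the original matrix, possibly without some lines and some entries
  of \<open>Q\<close>. Without lines missing and with all of \<open>Q\<close> removed, what remains is an odd hole together with
  vertices that dominate one of its vertices, hence it is not firm. If anything else is missing, the hole is
  broken, and one can remove simplicial vertices from the break onwards, up to a few cases with an even hole
  where an explicit independent set and clique cover are given.

  For total balancedness, stretching never creates a cycle submatrix, and the unstretched matrices admit an
  order of rows and columns without a \<open>2 \<times> 2\<close> block whose only zero is in the lower right corner.
\<close>

section \<open>The rectangle graph\<close>

text \<open>\<open>firm S U\<close> keeps edges and vertices apart: adjacency is read off the whole
  support \<open>S\<close>, and only the vertices are restricted to \<open>U\<close>. A deleted line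
  loses its entries both as vertices and as corners of rectangles. An added row and column that are
  both kept remove their entry of \<open>Q\<close> as a vertex only; it still serves as a corner.
  This explains the sets \<open>Q\<close>: in each family, every entry of \<open>Q\<close> is a
  corner behind an edge of the odd hole.

  The two kinds of removal work in different directions. Removing a simplicial entry with its
  neighbourhood is an equivalence, so the stretched matrix can be traded for the original one both
  for firmness and for its failure. Removing a dominating entry is used only to pass from a firm set
  to a smaller one, which is what refutations need.

  The obstacle on the positive side is that the sets met while peeling are no longer submatrices.
  Each induction therefore runs over a class of sets closed under peeling and described by where the
  hole is interrupted: a missing value of \<open>i + j\<close> for \<open>M\<close>,
  \<open>H_cut\<close> for \<open>H\<close>, and \<open>cut\<close> for both \<open>D\<close> and
  \<open>T\<close>.\<close>

text \<open>Since cliques of this graph are exactly the subsets of rectangles, \<open>i\<close> and \<open>br\<close> are its independence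
  and clique cover numbers; \<open>firm S U\<close> says that they agree on the subgraph induced by \<open>U\<close>, by means of an
  independent set and a partition into cliques indexed by it.\<close>

definition adj :: "(nat \<times> nat) set \<Rightarrow> nat \<times> nat \<Rightarrow> nat \<times> nat \<Rightarrow> bool" where
  "adj S x y \<longleftrightarrow> (fst x, snd y) \<in> S \<and> (fst y, snd x) \<in> S"

definition indep :: "(nat \<times> nat) set \<Rightarrow> (nat \<times> nat) set \<Rightarrow> bool" where
  "indep S E \<longleftrightarrow> (\<forall>x\<in>E. \<forall>y\<in>E. adj S x y \<longrightarrow> x = y)"

definition firm :: "(nat \<times> nat) set \<Rightarrow> (nat \<times> nat) set \<Rightarrow> bool" where
  "firm S U \<longleftrightarrow> (\<exists>E f. finite E \<and> E \<subseteq> U \<and> indep S E \<and> f ` U \<subseteq> E \<and>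
     (\<forall>x\<in>U. \<forall>y\<in>U. f x = f y \<longrightarrow> adj S x y))"

lemma adj_Pair [simp]: "adj S (i, j) (k, l) \<longleftrightarrow> (i, l) \<in> S \<and> (k, j) \<in> S"
  by (simp add: adj_def)

lemma adj_sym: "adj S x y \<Longrightarrow> adj S y x"
  by (simp add: adj_def)

lemma adj_refl: "adj S x x \<longleftrightarrow> x \<in> S"
  by (simp add: adj_def)

lemma firmI:
  assumes "finite E" "E \<subseteq> U" "indep S E" "f ` U \<subseteq> E"
    and "\<And>x y. x \<in> U \<Longrightarrow> y \<in> U \<Longrightarrow> f x = f y \<Longrightarrow> adj S x y"
  shows "firm S U"
  unfolding firm_def by (rule exI[of _ E], rule exI[of _ f]) (simp add: assms)

lemma firmE:
  assumes "firm S U"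
  obtains E f where "finite E" "E \<subseteq> U" "indep S E" "f ` U \<subseteq> E"
    "\<forall>x\<in>U. \<forall>y\<in>U. f x = f y \<longrightarrow> adj S x y"
  using assms unfolding firm_def by (elim exE conjE)

lemma firm_transfer:
  assumes "firm A U" and eq: "\<And>x y. x \<in> U \<Longrightarrow> y \<in> U \<Longrightarrow> adj A x y = adj B x y"
  shows "firm B U"
proof -
  obtain E f where E: "finite E" "E \<subseteq> U" "indep A E" "f ` U \<subseteq> E"
    and f': "\<forall>x\<in>U. \<forall>y\<in>U. f x = f y \<longrightarrow> adj A x y"
    by (rule firmE[OF assms(1)])
  have f: "adj A x y" if "x \<in> U" "y \<in> U" "f x = f y" for x y
    using f' that by simp
  have "indep B E"
    unfolding indep_def
  proof (intro ballI impI)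
    fix x y assume xy: "x \<in> E" "y \<in> E" "adj B x y"
    then have "adj A x y" using eq[of x y] E(2) by blast
    then show "x = y" using xy E(3) by (simp add: indep_def)
  qed
  moreover have "adj B x y" if "x \<in> U" "y \<in> U" "f x = f y" for x y
    using f[OF that] eq[OF that(1,2)] by simp
  ultimately show ?thesis using E by (intro firmI[of E _ _ f])
qed

text \<open>The corners tested by \<open>adj\<close> lie in rows and columns of entries of
  \<open>U\<close>, so they survive the restriction. A submatrix can thus be studied inside its
  ambient matrix, and \<open>D\<close> and \<open>T\<close> inside infinite matrices.\<close>

lemma firm_restrict:
  assumes "U \<subseteq> S \<inter> R \<times> C"
  shows "firm (S \<inter> R \<times> C) U \<longleftrightarrow> firm S U"
proof -
  have "adj (S \<inter> R \<times> C) x y = adj S x y" if "x \<in> U" "y \<in> U" for x y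
    using that assms by (auto simp: adj_def)
  then show ?thesis using firm_transfer[of _ U] by metis
qed

section \<open>Rectangles as cliques, and what firmness says about i and br\<close>

lemma isolated_iff: "isolated S E \<longleftrightarrow> E \<subseteq> S \<and> indep S E"
proof -
  have *: "(\<exists>r. is_rectangle S r \<and> x \<in> r \<and> y \<in> r) \<longleftrightarrow> adj S x y" if "x \<in> S" "y \<in> S" for x y
  proof
    assume "\<exists>r. is_rectangle S r \<and> x \<in> r \<and> y \<in> r"
    then show "adj S x y" by (auto simp: is_rectangle_def adj_def)
  next
    assume "adj S x y"
    \<comment> \<open>Two adjacent entries together with their two corners form a rectangle.\<close>
    then have "is_rectangle S ({fst x, fst y} \<times> {snd x, snd y})"
      using that unfolding is_rectangle_def adj_def
      by (intro exI[of _ "{fst x, fst y}"] exI[of _ "{snd x, snd y}"]) auto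
    then show "\<exists>r. is_rectangle S r \<and> x \<in> r \<and> y \<in> r"
      by (intro exI[of _ "{fst x, fst y} \<times> {snd x, snd y}"]) (auto simp: mem_Times_iff)
  qed
  have "isolated S E \<longleftrightarrow> E \<subseteq> S \<and>
      (\<forall>x\<in>E. \<forall>y\<in>E. x \<noteq> y \<longrightarrow> \<not> adj S x y)"
    unfolding isolated_def
  proof (rule conj_cong[OF refl])
    assume "E \<subseteq> S"
    then show "(\<forall>x\<in>E. \<forall>y\<in>E. x \<noteq> y \<longrightarrow> \<not> (\<exists>r. is_rectangle S r \<and> x \<in> r \<and> y \<in> r)) \<longleftrightarrow>
        (\<forall>x\<in>E. \<forall>y\<in>E. x \<noteq> y \<longrightarrow> \<not> adj S x y)"
      by (intro ball_cong refl) (simp only: * subset_eq)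
  qed
  then show ?thesis unfolding indep_def by blast
qed

lemma rectangle_clique:
  "is_rectangle S r \<Longrightarrow> x \<in> r \<Longrightarrow> y \<in> r \<Longrightarrow> adj S x y"
  by (auto simp: is_rectangle_def adj_def)

lemma clique_rectangle:
  assumes "\<And>x y. x \<in> A \<Longrightarrow> y \<in> A \<Longrightarrow> adj S x y"
  shows "is_rectangle S (fst ` A \<times> snd ` A)"
proof -
  have "(fst x, snd y) \<in> S" if "x \<in> A" "y \<in> A" for x y
    using assms[OF that] by (simp add: adj_def)
  then show ?thesis unfolding is_rectangle_def by blast
qed

definition rect_covers :: "(nat \<times> nat) set \<Rightarrow> (nat \<times> nat) set set set" where
  "rect_covers S = {F. finite F \<and> (\<forall>r\<in>F. is_rectangle S r) \<and> \<Union>F = S}"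

context
  fixes S :: "(nat \<times> nat) set"
  assumes fin: "finite S"
begin

lemma inum_attained: "\<exists>E. isolated S E \<and> card E = inum S"
  and inum_ge: "isolated S E \<Longrightarrow> card E \<le> inum S"
proof -
  have f: "finite (card ` {E. isolated S E})"
    using fin by (intro finite_imageI finite_subset[of "{E. isolated S E}" "Pow S"])
      (auto simp: isolated_def)
  \<comment> \<open>The empty set makes the range of \<open>Max\<close> nonempty; the cover by
    singletons will do the same for \<open>Min\<close>.\<close>
  have "isolated S {}" by (simp add: isolated_def)
  then have "inum S \<in> card ` {E. isolated S E}"
    unfolding inum_def using f by (intro Max_in) auto
  then show "\<exists>E. isolated S E \<and> card E = inum S" by auto
  show "card E \<le> inum S" if "isolated S E"
    unfolding inum_def using f that by (intro Max_ge) auto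
qed

lemma brnum_attained: "\<exists>F \<in> rect_covers S. card F = brnum S"
  and brnum_le: "F \<in> rect_covers S \<Longrightarrow> brnum S \<le> card F"
proof -
  have f: "finite (card ` rect_covers S)"
    using fin by (intro finite_imageI finite_subset[of "rect_covers S" "Pow (Pow S)"])
      (auto simp: rect_covers_def)
  have "is_rectangle S {x}" if "x \<in> S" for x
    unfolding is_rectangle_def using that
    by (intro exI[of _ "{fst x}"] exI[of _ "{snd x}"]) auto
  then have "(\<lambda>x. {x}) ` S \<in> rect_covers S"
    using fin by (auto simp: rect_covers_def)
  then have "brnum S \<in> card ` rect_covers S"
    unfolding brnum_def rect_covers_def[symmetric] using f by (intro Min_in) auto
  then show "\<exists>F \<in> rect_covers S. card F = brnum S" by auto
  show "brnum S \<le> card F" if "F \<in> rect_covers S"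
    unfolding brnum_def rect_covers_def[symmetric] using f that by (intro Min_le) auto
qed

text \<open>Every entry picks one rectangle of the cover around it. Two isolated entries cannot pick
  the same one, since sharing a rectangle makes them adjacent.\<close>

lemma cover_choice:
  assumes "isolated S E" "F \<in> rect_covers S"
  obtains r where "\<forall>x\<in>S. r x \<in> F \<and> x \<in> r x" "inj_on r E"
proof -
  have "\<forall>x\<in>S. \<exists>A. A \<in> F \<and> x \<in> A" using assms(2) by (auto simp: rect_covers_def)
  then obtain r where r: "\<And>x. x \<in> S \<Longrightarrow> r x \<in> F \<and> x \<in> r x" by metis
  have "inj_on r E"
  proof (rule inj_onI)
    fix x y assume "x \<in> E" "y \<in> E" "r x = r y"
    then have "x \<in> S" "y \<in> S" using assms(1) by (auto simp: isolated_iff)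
    then have "is_rectangle S (r x)" "x \<in> r x" "y \<in> r x"
      using r[of x] r[of y] assms(2) \<open>r x = r y\<close> by (simp_all add: rect_covers_def)
    then have "adj S x y" by (rule rectangle_clique)
    then show "x = y" using assms(1) \<open>x \<in> E\<close> \<open>y \<in> E\<close> by (auto simp: isolated_iff indep_def)
  qed
  then show thesis using r that[of r] by simp
qed

text \<open>One inequality holds for every \<open>S\<close> by \<open>cover_choice\<close>. Firmness
  gives the other: each fibre of \<open>f\<close> is a clique, so it spans a rectangle inside
  \<open>S\<close>, and there are at most \<open>card E\<close> fibres.\<close>

lemma firm_imp_inum_eq_brnum:
  assumes "firm S S"
  shows "inum S = brnum S"
proof (rule antisym)
  obtain E F where E: "isolated S E" "card E = inum S"
    and F: "F \<in> rect_covers S" "card F = brnum S"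
    using inum_attained brnum_attained by blast
  obtain r where r': "\<forall>x\<in>S. r x \<in> F \<and> x \<in> r x" "inj_on r E"
    by (rule cover_choice[OF E(1) F(1)])
  have r: "r x \<in> F \<and> x \<in> r x" if "x \<in> S" for x
    using r'(1) that by simp
  have "r ` E \<subseteq> F" using r E(1) unfolding isolated_iff by blast
  then have "card E \<le> card F"
    using r'(2) F(1) by (intro card_inj_on_le[of r]) (simp_all add: rect_covers_def)
  then show "inum S \<le> brnum S" using E F by simp
next
  obtain E f where E: "finite E" "E \<subseteq> S" "indep S E" "f ` S \<subseteq> E"
    and f': "\<forall>x\<in>S. \<forall>y\<in>S. f x = f y \<longrightarrow> adj S x y"
    by (rule firmE[OF assms])
  have f: "adj S x y" if "x \<in> S" "y \<in> S" "f x = f y" for x y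
    using f' that by simp
  define A where "A e = {x \<in> S. f x = e}" for e
  define F where "F = (\<lambda>e. fst ` A e \<times> snd ` A e) ` E"
  have rect: "is_rectangle S (fst ` A e \<times> snd ` A e)" for e
    using f by (intro clique_rectangle) (auto simp: A_def)
  have "F \<in> rect_covers S"
    unfolding rect_covers_def
  proof (intro CollectI conjI)
    show "finite F" using E(1) by (simp add: F_def)
    show "\<forall>r\<in>F. is_rectangle S r" using rect by (auto simp: F_def)
    have "\<Union> F \<subseteq> S" using rect unfolding F_def is_rectangle_def by blast
    moreover have "x \<in> \<Union> F" if "x \<in> S" for x
    proof -
      have "x \<in> A (f x)" "f x \<in> E" using that E(4) by (auto simp: A_def)
      then show ?thesis unfolding F_def by (auto simp: mem_Times_iff)
    qed
    ultimately show "\<Union> F = S" by blast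
  qed
  then have "brnum S \<le> card F" by (rule brnum_le)
  also have "\<dots> \<le> card E" unfolding F_def using E(1) by (rule card_image_le)
  also have "\<dots> \<le> inum S" using E by (intro inum_ge) (auto simp: isolated_iff)
  finally show "brnum S \<le> inum S" .
qed

text \<open>If the numbers agreed, the choice would map a maximum isolated set bijectively onto a
  minimum cover. Sending each entry to the isolated entry that chose the same rectangle would then
  witness firmness.\<close>

lemma not_firm_imp_inum_less_brnum:
  assumes "\<not> firm S S"
  shows "inum S < brnum S"
proof (rule ccontr)
  assume neg: "\<not> inum S < brnum S"
  obtain E F where E: "isolated S E" "card E = inum S"
    and F: "F \<in> rect_covers S" "card F = brnum S"
    using inum_attained brnum_attained by blast
  obtain r where r': "\<forall>x\<in>S. r x \<in> F \<and> x \<in> r x" "inj_on r E"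
    by (rule cover_choice[OF E(1) F(1)])
  have r: "r x \<in> F \<and> x \<in> r x" if "x \<in> S" for x
    using r'(1) that by simp
  have ES: "E \<subseteq> S" and ind: "indep S E" using E by (auto simp: isolated_iff)
  have fE: "finite E" using ES fin finite_subset by blast
  have "r ` E = F"
  proof (rule card_seteq)
    show "finite F" using F by (auto simp: rect_covers_def)
    show "r ` E \<subseteq> F" using r ES by blast
    show "card F \<le> card (r ` E)" using E F r'(2) neg by (simp add: card_image)
  qed
  have "\<forall>x\<in>S. \<exists>e\<in>E. r e = r x"
    using r \<open>r ` E = F\<close> by (metis imageE)
  then obtain f where f: "\<And>x. x \<in> S \<Longrightarrow> f x \<in> E \<and> r (f x) = r x" by metis
  have "firm S S"
  proof (rule firmI[of E _ _ f])
    fix x y assume "x \<in> S" "y \<in> S" "f x = f y"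
    then have "r x = r y" using f by metis
    then have "is_rectangle S (r x)" "x \<in> r x" "y \<in> r x"
      using r[OF \<open>x \<in> S\<close>] r[OF \<open>y \<in> S\<close>] F(1) by (simp_all add: rect_covers_def)
    then show "adj S x y" by (rule rectangle_clique)
  next
    show "f ` S \<subseteq> E" using f by blast
  qed (fact fE ES ind)+
  then show False using assms by contradiction
qed

end

section \<open>Removal of simplicial and of dominating entries; odd holes\<close>

definition simplicial :: "(nat \<times> nat) set \<Rightarrow> (nat \<times> nat) set \<Rightarrow> nat \<times> nat \<Rightarrow> bool" where
  "simplicial S U z \<longleftrightarrow> z \<in> U \<and> (\<forall>x\<in>U. \<forall>y\<in>U. adj S z x \<longrightarrow> adj S z y \<longrightarrow> adj S x y)"

lemma firm_empty [simp]: "firm S {}"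
  unfolding firm_def indep_def by auto

text \<open>Only the representatives in \<open>E\<close> must be far from \<open>U2\<close>; other
  entries of \<open>U1\<close> may have neighbours there, because the two clique partitions are just
  put side by side. A simplicial entry with its neighbourhood is the case of one
  representative.\<close>

lemma firm_join:
  assumes "firm S U2" and fin: "finite E" and E: "E \<subseteq> U1" "indep S E" "f ` U1 \<subseteq> E"
    and f: "\<And>x y. x \<in> U1 \<Longrightarrow> y \<in> U1 \<Longrightarrow> f x = f y \<Longrightarrow> adj S x y"
    and sep: "\<And>e x. e \<in> E \<Longrightarrow> x \<in> U2 \<Longrightarrow> \<not> adj S e x"
  shows "firm S (U1 \<union> U2)"
proof -
  obtain E2 g where E2: "finite E2" "E2 \<subseteq> U2" "indep S E2" "g ` U2 \<subseteq> E2"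
    and g': "\<forall>x\<in>U2. \<forall>y\<in>U2. g x = g y \<longrightarrow> adj S x y"
    by (rule firmE[OF assms(1)])
  have g: "adj S x y" if "x \<in> U2" "y \<in> U2" "g x = g y" for x y
    using g' that by simp
  have "e \<in> S" if "e \<in> E" for e
    using f[of e e] that E adj_refl by blast
  \<comment> \<open>A common element would be adjacent to itself, so the representatives of the two
    parts stay distinct.\<close>
  then have disj: "E \<inter> U2 = {}" using sep adj_refl by blast
  define h where "h x = (if x \<in> U1 then f x else g x)" for x
  show ?thesis
  proof (rule firmI[of "E \<union> E2" _ _ h])
    have sep': "\<not> adj S x e" if "e \<in> E" "x \<in> U2" for e x
      using sep[OF that] adj_sym[of S x e] by blast
    show "indep S (E \<union> E2)"
      unfolding indep_def
    proof (intro ballI impI)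
      fix x y assume "x \<in> E \<union> E2" "y \<in> E \<union> E2" "adj S x y"
      then have "x \<in> E \<and> y \<in> E \<or> x \<in> E2 \<and> y \<in> E2"
        using sep[of x y] sep'[of y x] E2(2) by blast
      then show "x = y" using \<open>adj S x y\<close> E(2) E2(3) unfolding indep_def by blast
    qed
    show "h ` (U1 \<union> U2) \<subseteq> E \<union> E2" using E E2 by (auto simp: h_def)
    fix x y assume x: "x \<in> U1 \<union> U2" and y: "y \<in> U1 \<union> U2" and "h x = h y"
    consider "x \<in> U1" "y \<in> U1" | "x \<in> U1" "y \<notin> U1" | "x \<notin> U1" "y \<in> U1" | "x \<notin> U1" "y \<notin> U1"
      by blast
    then show "adj S x y"
    proof cases
      case 1 then show ?thesis using f \<open>h x = h y\<close> by (simp add: h_def)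
    next
      case 2
      then have "h x \<in> E" "h y \<in> E2" using y E E2 by (auto simp: h_def)
      then show ?thesis using \<open>h x = h y\<close> E2(2) disj by auto
    next
      case 3
      then have "h y \<in> E" "h x \<in> E2" using x E E2 by (auto simp: h_def)
      then show ?thesis using \<open>h x = h y\<close> E2(2) disj by auto
    next
      case 4 then show ?thesis using g \<open>h x = h y\<close> x y by (auto simp: h_def)
    qed
  qed (use E(1) E2(1,2) fin in auto)
qed

text \<open>From right to left this is \<open>firm_join\<close>. Conversely, the neighbourhood of
  \<open>z\<close> is a clique and therefore contains at most one element of \<open>E\<close>;
  giving up that one representative is enough.\<close>

lemma firm_simplicial_iff:
  assumes z: "simplicial S U z" and "U \<subseteq> S"
  shows "firm S U \<longleftrightarrow> firm S {x \<in> U. \<not> adj S z x}"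
proof
  assume "firm S {x \<in> U. \<not> adj S z x}"
  then have "firm S ({x \<in> U. adj S z x} \<union> {x \<in> U. \<not> adj S z x})"
    by (rule firm_join[where E = "{z}" and f = "\<lambda>_. z"])
      (use z \<open>U \<subseteq> S\<close> in \<open>auto simp: simplicial_def indep_def adj_refl\<close>)
  moreover have "{x \<in> U. adj S z x} \<union> {x \<in> U. \<not> adj S z x} = U" by blast
  ultimately show "firm S U" by simp
next
  assume "firm S U"
  then obtain E f where E: "finite E" "E \<subseteq> U" "indep S E" "f ` U \<subseteq> E"
    and f': "\<forall>x\<in>U. \<forall>y\<in>U. f x = f y \<longrightarrow> adj S x y"
    by (rule firmE)
  have f: "adj S x y" if "x \<in> U" "y \<in> U" "f x = f y" for x y
    using f' that by simp
  have zU: "z \<in> U" and zc: "\<And>x y. x \<in> U \<Longrightarrow> y \<in> U \<Longrightarrow> adj S z x \<Longrightarrow> adj S z y \<Longrightarrow> adj S x y"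
    using z by (auto simp: simplicial_def)
  \<comment> \<open>\<open>f\<close> need not fix \<open>E\<close>; it only permutes it. So the
    class of \<open>z\<close> is also the class of some \<open>e\<close> in \<open>E\<close>, and
    relabelling classes by the inverse permutation avoids \<open>e\<close> on all entries not
    adjacent to \<open>z\<close>.\<close>
  have inj: "inj_on f E"
    using E f unfolding inj_on_def indep_def by blast
  have "f ` E = E"
    using E by (intro endo_inj_surj inj) auto
  then obtain e where e: "e \<in> E" "f e = f z" using E zU by (metis imageE image_subset_iff)
  let ?V = "{x \<in> U. \<not> adj S z x}"
  have ez: "adj S z e" using f[of z e] e E zU by auto
  have only: "x = e" if "x \<in> E" "adj S z x" for x
    using that zc[of x e] ez e E unfolding indep_def by blast
  show "firm S ?V"
  proof (rule firmI[of "E - {e}" _ _ "\<lambda>x. inv_into E f (f x)"])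
    have inv: "inv_into E f (f x) \<in> E" "f (inv_into E f (f x)) = f x" if "x \<in> U" for x
      using that E \<open>f ` E = E\<close> by (auto intro!: inv_into_into f_inv_into_f)
    show "E - {e} \<subseteq> ?V" using E only by blast
    show "(\<lambda>x. inv_into E f (f x)) ` ?V \<subseteq> E - {e}"
    proof (rule image_subsetI)
      fix x assume "x \<in> ?V"
      then have x: "x \<in> U" "\<not> adj S z x" by auto
      have "f x \<noteq> f z" using f[of z x] x zU by auto
      then show "inv_into E f (f x) \<in> E - {e}" using inv[OF x(1)] e by auto
    qed
    show "adj S x y" if "x \<in> ?V" "y \<in> ?V" "inv_into E f (f x) = inv_into E f (f y)" for x y
    proof -
      have U: "x \<in> U" "y \<in> U" using that(1,2) by auto
      have "f x = f (inv_into E f (f y))"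
        using inv(2)[OF U(1)] that(3) by simp
      then show ?thesis using f[OF U] inv(2)[OF U(2)] by simp
    qed
    show "indep S (E - {e})" using E(3) by (simp add: indep_def)
  qed (use E(1) in simp)
qed

text \<open>Adjacent simplicial entries have the same closed neighbourhood. Removing the
  neighbourhood of one element of \<open>Z\<close> therefore settles all elements adjacent to it,
  and leaves the others simplicial. Since one step may settle several elements, the induction runs
  over proper subsets.\<close>

lemma firm_simplicial_set_iff:
  assumes "finite Z" "\<And>z. z \<in> Z \<Longrightarrow> simplicial S U z" "U \<subseteq> S"
  shows "firm S U \<longleftrightarrow> firm S {x \<in> U. \<forall>z\<in>Z. \<not> adj S z x}"
  using assms
proof (induction Z arbitrary: U rule: finite_psubset_induct)
  case (psubset Z)
  show ?case
  proof (cases "Z = {}")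
    case True
    then show ?thesis by simp
  next
    case False
    then obtain z where zZ: "z \<in> Z" by blast
    let ?V = "{x \<in> U. \<not> adj S z x}"
    have z: "simplicial S U z" using psubset.prems zZ by blast
    have eq: "adj S z x \<longleftrightarrow> adj S w x" if "w \<in> Z" "adj S z w" "x \<in> U" for w x
    proof -
      have w: "simplicial S U w" using psubset.prems that by blast
      have "z \<in> U" "w \<in> U" using z w by (simp_all add: simplicial_def)
      moreover have "adj S z z" "adj S w w" "adj S w z"
        using \<open>z \<in> U\<close> \<open>w \<in> U\<close> psubset.prems(2) that(2) adj_sym by (auto simp: adj_refl)
      ultimately show ?thesis
        using z w that(2,3) unfolding simplicial_def by blast
    qed
    have "z \<in> U" using z by (simp add: simplicial_def)
    then have "z \<notin> ?V" using psubset.prems(2) by (auto simp: adj_refl)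
    have "firm S U \<longleftrightarrow> firm S ?V"
      using z psubset.prems by (intro firm_simplicial_iff) auto
    also have "\<dots> \<longleftrightarrow> firm S {x \<in> ?V. \<forall>w\<in>Z \<inter> ?V. \<not> adj S w x}"
    proof (rule psubset.IH)
      show "Z \<inter> ?V \<subset> Z" using zZ \<open>z \<notin> ?V\<close> by blast
      show "simplicial S ?V w" if "w \<in> Z \<inter> ?V" for w
        using psubset.prems(1)[of w] that by (auto simp: simplicial_def)
    qed (use psubset.prems in auto)
    also have "{x \<in> ?V. \<forall>w\<in>Z \<inter> ?V. \<not> adj S w x} = {x \<in> U. \<forall>w\<in>Z. \<not> adj S w x}"
      using eq zZ psubset.prems(1) unfolding simplicial_def by blast
    finally show ?thesis .
  qed
qed

text \<open>All neighbours of \<open>h v\<close> are neighbours of \<open>v\<close>, so a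
  representative \<open>v\<close> can be replaced by \<open>h v\<close> without losing independence,
  and the clique partition is restricted to \<open>U - V\<close>.\<close>

lemma firm_remove_dominated:
  assumes "firm S U" "V \<subseteq> U" "U \<subseteq> S"
    and h: "\<And>v. v \<in> V \<Longrightarrow> h v \<in> U - V"
    and dom: "\<And>v x. v \<in> V \<Longrightarrow> x \<in> U \<Longrightarrow> adj S (h v) x \<Longrightarrow> adj S v x"
  shows "firm S (U - V)"
proof -
  obtain E f where E: "finite E" "E \<subseteq> U" "indep S E" "f ` U \<subseteq> E"
    and f': "\<forall>x\<in>U. \<forall>y\<in>U. f x = f y \<longrightarrow> adj S x y"
    by (rule firmE[OF assms(1)])
  have f: "adj S x y" if "x \<in> U" "y \<in> U" "f x = f y" for x y
    using f' that by simp
  define g where "g x = (if x \<in> V then h x else x)" for x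
  have gU: "g x \<in> U - V" if "x \<in> U" for x
    using h that by (auto simp: g_def)
  \<comment> \<open>An edge between the images lifts to the original entries by using
    \<open>dom\<close> at one endpoint and then at the other.\<close>
  have pull: "adj S x y" if "x \<in> U" "y \<in> U" "adj S (g x) (g y)" for x y
  proof -
    have "adj S x (g y)" using that dom gU[OF that(2)] by (auto simp: g_def split: if_splits)
    then have "adj S (g y) x" by (rule adj_sym)
    then have "adj S y x" using that dom by (auto simp: g_def split: if_splits)
    then show ?thesis by (rule adj_sym)
  qed
  have inj: "x = y" if "x \<in> E" "y \<in> E" "adj S (g x) (g y)" for x y
    using pull[of x y] that E unfolding indep_def by blast
  show ?thesis
  proof (rule firmI[of "g ` E" _ _ "\<lambda>x. g (f x)"])
    show "g ` E \<subseteq> U - V" using E gU by blast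
    show "indep S (g ` E)" using inj unfolding indep_def by blast
    show "(\<lambda>x. g (f x)) ` (U - V) \<subseteq> g ` E" using E by blast
    show "adj S x y" if "x \<in> U - V" "y \<in> U - V" "g (f x) = g (f y)" for x y
    proof -
      have fE: "f x \<in> E" "f y \<in> E" using that E by auto
      then have "adj S (g (f x)) (g (f y))"
        using that(3) gU[of "f x"] E(2) \<open>U \<subseteq> S\<close> by (auto simp: adj_refl)
      then have "f x = f y" using inj fE by blast
      then show ?thesis using f that by blast
    qed
  qed (use E in auto)
qed

text \<open>A double count. Without triangles the cliques have at most two elements, so
  \<open>card U\<close> is at most \<open>2 * card E\<close>. The injection \<open>g\<close> moves
  along edges and hence maps \<open>E\<close> off itself, so \<open>2 * card E\<close> is at most
  \<open>card U\<close>. Equality contradicts parity.\<close>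

lemma not_firm_odd_triangle_free:
  assumes "odd (card U)" "U \<subseteq> S"
    and g: "inj_on g U" "\<And>x. x \<in> U \<Longrightarrow> g x \<in> U \<and> g x \<noteq> x \<and> adj S x (g x)"
    and tri: "\<And>x y z. x \<in> U \<Longrightarrow> y \<in> U \<Longrightarrow> z \<in> U \<Longrightarrow> adj S x y \<Longrightarrow> adj S y z \<Longrightarrow> adj S x z \<Longrightarrow>
      x = y \<or> y = z \<or> x = z"
  shows "\<not> firm S U"
proof
  assume "firm S U"
  then obtain E f where E: "finite E" "E \<subseteq> U" "indep S E" "f ` U \<subseteq> E"
    and f': "\<forall>x\<in>U. \<forall>y\<in>U. f x = f y \<longrightarrow> adj S x y"
    by (rule firmE)
  have f: "adj S x y" if "x \<in> U" "y \<in> U" "f x = f y" for x y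
    using f' that by simp
  have fin: "finite U" using assms(1) card.infinite by fastforce
  have "g x \<notin> E" if "x \<in> E" for x
  proof
    assume "g x \<in> E"
    then have "x = g x"
      using g(2)[of x] that E(2,3) unfolding indep_def by blast
    then show False using g(2)[of x] that E(2) by auto
  qed
  then have "E \<inter> g ` E = {}" by blast
  then have "card E + card (g ` E) = card (E \<union> g ` E)"
    using E(1) by (simp add: card_Un_disjoint)
  also have "\<dots> \<le> card U" using E(2) g(2) fin by (intro card_mono) auto
  finally have 1: "2 * card E \<le> card U"
    using inj_on_subset[OF g(1) E(2)] by (simp add: card_image)
  have "card {x \<in> U. f x = e} \<le> 2" for e
  proof (rule ccontr)
    assume "\<not> card {x \<in> U. f x = e} \<le> 2"
    then have "3 \<le> card {x \<in> U. f x = e}" by simp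
    then obtain T where T: "T \<subseteq> {x \<in> U. f x = e}" "card T = 3"
      by (rule obtain_subset_with_card_n)
    from T(2) obtain x y z where xyz: "T = {x, y, z}" "x \<noteq> y" "y \<noteq> z" "x \<noteq> z"
      unfolding card_3_iff by blast
    have "x \<in> U" "y \<in> U" "z \<in> U" "f x = e" "f y = e" "f z = e" using T(1) xyz(1) by auto
    then show False using tri[of x y z] f[of x y] f[of y z] f[of x z] xyz(2-4) by simp
  qed
  then have "(\<Sum>e\<in>E. card {x \<in> U. f x = e}) \<le> (\<Sum>e\<in>E. 2)"
    by (intro sum_mono)
  moreover have "card U = (\<Sum>e\<in>E. card {x \<in> U. f x = e})"
    using sum.group[OF fin E(1,4), of "\<lambda>_. 1::nat"] by simp
  ultimately have "card U \<le> 2 * card E" by simp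
  with 1 have "card U = 2 * card E" by simp
  then show False using assms(1) by simp
qed

section \<open>Stretching\<close>

lemma supp_subset: "supp X \<subseteq> {1..nrows X} \<times> {1..ncols X}"
  by (auto simp: supp_def)

lemma finite_supp: "finite (supp X)"
  using supp_subset by (rule finite_subset) simp

context
  fixes m n q :: nat and S Q :: "(nat \<times> nat) set" and p :: "nat \<Rightarrow> nat \<times> nat"
    and S' :: "(nat \<times> nat) set"
  assumes S: "S \<subseteq> {1..m} \<times> {1..n}" and p: "bij_betw p {1..q} Q" and Q: "Q \<subseteq> S"
    and S': "S' = S \<union> (\<Union>t\<in>{1..q}. {(fst (p t), n + t), (m + t, snd (p t)), (m + t, n + t)})"
begin

lemma p_range: "t \<in> {1..q} \<Longrightarrow> p t \<in> S \<and> 1 \<le> fst (p t) \<and> fst (p t) \<le> m \<and> 1 \<le> snd (p t) \<and> snd (p t) \<le> n"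
proof -
  assume "t \<in> {1..q}"
  then have "p t \<in> S" using p Q by (auto simp: bij_betw_def)
  then show ?thesis using S by (cases "p t") auto
qed

lemma stretched_old: "i \<le> m \<Longrightarrow> j \<le> n \<Longrightarrow> (i, j) \<in> S' \<longleftrightarrow> (i, j) \<in> S"
  unfolding S' by auto

lemma stretched_col: "i \<le> m \<Longrightarrow> t \<in> {1..q} \<Longrightarrow> (i, n + t) \<in> S' \<longleftrightarrow> i = fst (p t)"
  unfolding S' using S p_range by fastforce

lemma stretched_row: "j \<le> n \<Longrightarrow> t \<in> {1..q} \<Longrightarrow> (m + t, j) \<in> S' \<longleftrightarrow> j = snd (p t)"
  unfolding S' using S p_range by fastforce

lemma stretched_cases:
  assumes "x \<in> S'"
  obtains "x \<in> S" "fst x \<le> m" "snd x \<le> n"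
  | t where "t \<in> {1..q}" "x = (fst (p t), n + t)"
  | t where "t \<in> {1..q}" "x = (m + t, snd (p t))"
  | t where "t \<in> {1..q}" "x = (m + t, n + t)"
proof -
  have "x \<in> S \<and> fst x \<le> m \<and> snd x \<le> n \<or> (\<exists>t\<in>{1..q}. x = (fst (p t), n + t) \<or>
      x = (m + t, snd (p t)) \<or> x = (m + t, n + t))"
    using assms S unfolding S' by auto
  then show thesis using that by blast
qed

lemma stretched_row_entry:
  assumes "(m + t, j) \<in> S'" "t \<in> {1..q}"
  shows "j = snd (p t) \<or> j = n + t"
  using assms(1)
proof (cases rule: stretched_cases)
  case (2 s)
  then show ?thesis using p_range[of s] assms(2) by auto
qed (use assms in auto)

lemma stretched_col_entry:
  assumes "(i, n + t) \<in> S'" "t \<in> {1..q}"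
  shows "i = fst (p t) \<or> i = m + t"
  using assms(1)
proof (cases rule: stretched_cases)
  case (3 s)
  then show ?thesis using p_range[of s] assms(2) by auto
qed (use assms in auto)

lemma stretched_adj: "x \<in> S \<Longrightarrow> y \<in> S \<Longrightarrow> adj S' x y = adj S x y"
proof -
  assume "x \<in> S" "y \<in> S"
  then have "fst x \<le> m" "snd x \<le> n" "fst y \<le> m" "snd y \<le> n" using S by auto
  then show ?thesis by (simp add: adj_def stretched_old)
qed

text \<open>For every \<open>t\<close> it matters which of the added lines \<open>m + t\<close> and
  \<open>n + t\<close> are kept. If both are, their common entry is simplicial and its removal costs
  the old entry \<open>p t\<close>. If only the row is kept, its single entry is simplicial and
  takes the whole column of \<open>p t\<close> with it; if only the column is kept, the row of
  \<open>p t\<close> is lost. These three effects are \<open>Q'\<close>, \<open>C'\<close> and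
  \<open>R'\<close>.\<close>

lemma firm_stretched_submatrix_iff:
  fixes R C
  defines "Q' \<equiv> {p t | t. t \<in> {1..q} \<and> m + t \<in> R \<and> n + t \<in> C}"
    and "R' \<equiv> {i \<in> R. i \<in> {1..m} \<and> (\<forall>t\<in>{1..q}. m + t \<notin> R \<and> n + t \<in> C \<longrightarrow> i \<noteq> fst (p t))}"
    and "C' \<equiv> {j \<in> C. j \<in> {1..n} \<and> (\<forall>t\<in>{1..q}. m + t \<in> R \<and> n + t \<notin> C \<longrightarrow> j \<noteq> snd (p t))}"
  shows "firm S' (S' \<inter> R \<times> C) \<longleftrightarrow> firm S (S \<inter> R' \<times> C' - Q')"
proof -
  let ?U = "S' \<inter> R \<times> C"
  define Z1 where "Z1 = {(m + t, n + t) | t. t \<in> {1..q} \<and> m + t \<in> R \<and> n + t \<in> C}"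
  define Z2 where "Z2 = {(m + t, snd (p t)) | t. t \<in> {1..q} \<and> m + t \<in> R \<and> n + t \<notin> C \<and> snd (p t) \<in> C}"
  define Z3 where "Z3 = {(fst (p t), n + t) | t. t \<in> {1..q} \<and> m + t \<notin> R \<and> n + t \<in> C \<and> fst (p t) \<in> R}"
  have new: "(m + t, n + t) \<in> S'" "(fst (p t), n + t) \<in> S'" "(m + t, snd (p t)) \<in> S'"
    "(fst (p t), snd (p t)) \<in> S'" if "t \<in> {1..q}" for t
    using that p_range[OF that] unfolding S' by auto
  have "finite S" using S by (rule finite_subset) simp
  then have finS': "finite S'" unfolding S' by simp
  have Z: "Z1 \<union> Z2 \<union> Z3 \<subseteq> ?U"
    using new unfolding Z1_def Z2_def Z3_def by auto
  \<comment> \<open>The neighbours of the new corner lie in the block of rows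
    \<open>fst (p t)\<close>, \<open>m + t\<close> and columns \<open>snd (p t)\<close>,
    \<open>n + t\<close>, which is a rectangle.\<close>
  have s1: "simplicial S' ?U z" if z: "z \<in> Z1" for z
  proof -
    obtain t where t: "t \<in> {1..q}" "z = (m + t, n + t)" using z by (auto simp: Z1_def)
    have "fst x \<in> {fst (p t), m + t} \<and> snd x \<in> {snd (p t), n + t}" if "adj S' z x" for x
      using that t stretched_row_entry[of t "snd x"] stretched_col_entry[of "fst x" t]
      by (auto simp: adj_def)
    moreover have "(i, j) \<in> S'" if "i \<in> {fst (p t), m + t}" "j \<in> {snd (p t), n + t}" for i j
      using that new[OF t(1)] by auto
    ultimately have "adj S' x y" if "adj S' z x" "adj S' z y" for x y
      unfolding adj_def[of S' x y] using that by blast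
    then show ?thesis using Z z unfolding simplicial_def by blast
  qed
  \<comment> \<open>With column \<open>n + t\<close> gone, the added row has just one entry, and all
    its neighbours share its column.\<close>
  have s2: "simplicial S' ?U z" if z: "z \<in> Z2" for z
  proof -
    obtain t where t: "t \<in> {1..q}" "z = (m + t, snd (p t))" "n + t \<notin> C" using z by (auto simp: Z2_def)
    have "snd x = snd (p t)" if "x \<in> ?U" "adj S' z x" for x
      using that t stretched_row_entry[of t "snd x"] by (auto simp: adj_def)
    then have "adj S' x y" if "x \<in> ?U" "y \<in> ?U" "adj S' z x" "adj S' z y" for x y
      unfolding adj_def[of S' x y] using that by (metis IntD1 prod.collapse)
    then show ?thesis using Z z unfolding simplicial_def by blast
  qed
  have s3: "simplicial S' ?U z" if z: "z \<in> Z3" for z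
  proof -
    obtain t where t: "t \<in> {1..q}" "z = (fst (p t), n + t)" "m + t \<notin> R" using z by (auto simp: Z3_def)
    have "fst x = fst (p t)" if "x \<in> ?U" "adj S' z x" for x
      using that t stretched_col_entry[of "fst x" t] by (auto simp: adj_def)
    then have "adj S' x y" if "x \<in> ?U" "y \<in> ?U" "adj S' z x" "adj S' z y" for x y
      unfolding adj_def[of S' x y] using that by (metis IntD1 prod.collapse)
    then show ?thesis using Z z unfolding simplicial_def by blast
  qed
  have "firm S' ?U \<longleftrightarrow> firm S' {x \<in> ?U. \<forall>z\<in>Z1 \<union> Z2 \<union> Z3. \<not> adj S' z x}"
  proof (rule firm_simplicial_set_iff)
    show "finite (Z1 \<union> Z2 \<union> Z3)" using Z finS' by (meson finite_Int finite_subset)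
  qed (use s1 s2 s3 in blast)+
  also have "{x \<in> ?U. \<forall>z\<in>Z1 \<union> Z2 \<union> Z3. \<not> adj S' z x} = S \<inter> R' \<times> C' - Q'" (is "?A = ?B")
  proof
    show "?A \<subseteq> ?B"
    proof
      fix x assume x: "x \<in> ?A"
      then have xU: "x \<in> S'" "fst x \<in> R" "snd x \<in> C"
        and far: "\<And>z. z \<in> Z1 \<Longrightarrow> \<not> adj S' z x" "\<And>z. z \<in> Z2 \<Longrightarrow> \<not> adj S' z x"
          "\<And>z. z \<in> Z3 \<Longrightarrow> \<not> adj S' z x" by auto
      from xU(1) show "x \<in> ?B"
      proof (cases rule: stretched_cases)
        case 1
        have "1 \<le> fst x" "1 \<le> snd x" using 1 S by auto
        have "snd x \<noteq> snd (p t)" if t: "t \<in> {1..q}" "m + t \<in> R" "n + t \<notin> C" for t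
        proof
          assume a: "snd x = snd (p t)"
          then have "(m + t, snd (p t)) \<in> Z2" using t xU unfolding Z2_def by auto
          moreover have "adj S' (m + t, snd (p t)) x"
            using a new(3)[OF t(1)] xU(1) by (cases x) auto
          ultimately show False using far(2) by blast
        qed
        moreover have "fst x \<noteq> fst (p t)" if t: "t \<in> {1..q}" "m + t \<notin> R" "n + t \<in> C" for t
        proof
          assume a: "fst x = fst (p t)"
          then have "(fst (p t), n + t) \<in> Z3" using t xU unfolding Z3_def by auto
          moreover have "adj S' (fst (p t), n + t) x"
            using a new(2)[OF t(1)] xU(1) by (cases x) auto
          ultimately show False using far(3) by blast
        qed
        moreover have "x \<notin> Q'"
        proof
          assume "x \<in> Q'"
          then obtain t where t: "t \<in> {1..q}" "x = p t" "m + t \<in> R" "n + t \<in> C"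
            unfolding Q'_def by blast
          then have "(m + t, n + t) \<in> Z1" unfolding Z1_def by auto
          moreover have "adj S' (m + t, n + t) x" using new[OF t(1)] t(2) by (simp add: adj_def)
          ultimately show False using far(1) by blast
        qed
        ultimately show ?thesis
          using 1 xU \<open>1 \<le> fst x\<close> \<open>1 \<le> snd x\<close> unfolding R'_def C'_def
          by (auto simp: mem_Times_iff)
      next
        case (2 t)
        then have "(m + t, n + t) \<in> Z1 \<or> x \<in> Z3" using xU unfolding Z1_def Z3_def by auto
        moreover have "adj S' (m + t, n + t) x" "adj S' x x" using new[OF 2(1)] 2 by auto
        ultimately show ?thesis using far by blast
      next
        case (3 t)
        then have "(m + t, n + t) \<in> Z1 \<or> x \<in> Z2" using xU unfolding Z1_def Z2_def by auto
        moreover have "adj S' (m + t, n + t) x" "adj S' x x" using new[OF 3(1)] 3 by auto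
        ultimately show ?thesis using far by blast
      next
        case (4 t)
        then have "x \<in> Z1" using xU unfolding Z1_def by auto
        moreover have "adj S' x x" using new[OF 4(1)] 4 by auto
        ultimately show ?thesis using far by blast
      qed
    qed
    show "?B \<subseteq> ?A"
    proof
      fix x assume x: "x \<in> ?B"
      then have xS: "x \<in> S" "fst x \<in> R'" "snd x \<in> C'" "x \<notin> Q'" by auto
      then have le: "fst x \<le> m" "snd x \<le> n" using S by auto
      have "x \<in> ?U" using xS unfolding R'_def C'_def S' by (auto simp: mem_Times_iff)
      moreover have "\<not> adj S' z x" if z: "z \<in> Z1" for z
      proof
        assume a: "adj S' z x"
        obtain t where t: "t \<in> {1..q}" "z = (m + t, n + t)" "m + t \<in> R" "n + t \<in> C"
          using z unfolding Z1_def by blast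
        have "x = p t"
          using a t le stretched_row[of "snd x" t] stretched_col[of "fst x" t]
          by (simp add: adj_def prod_eq_iff)
        then show False using t xS(4) unfolding Q'_def by blast
      qed
      moreover have "\<not> adj S' z x" if z: "z \<in> Z2" for z
      proof
        assume a: "adj S' z x"
        obtain t where t: "t \<in> {1..q}" "z = (m + t, snd (p t))" "m + t \<in> R" "n + t \<notin> C"
          using z unfolding Z2_def by blast
        have "snd x = snd (p t)"
          using a t le stretched_row[of "snd x" t] by (simp add: adj_def)
        then show False using t xS(3) unfolding C'_def by blast
      qed
      moreover have "\<not> adj S' z x" if z: "z \<in> Z3" for z
      proof
        assume a: "adj S' z x"
        obtain t where t: "t \<in> {1..q}" "z = (fst (p t), n + t)" "m + t \<notin> R" "n + t \<in> C"
          using z unfolding Z3_def by blast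
        have "fst x = fst (p t)"
          using a t le stretched_col[of "fst x" t] by (simp add: adj_def)
        then show False using t xS(2) unfolding R'_def by blast
      qed
      ultimately show "x \<in> ?A" by blast
    qed
  qed
  \<comment> \<open>Between old entries \<open>adj\<close> looks only at old corners, so the added
    lines can now be forgotten.\<close>
  also have "firm S' (S \<inter> R' \<times> C' - Q') \<longleftrightarrow> firm S (S \<inter> R' \<times> C' - Q')"
    using firm_transfer[of S' _ S] firm_transfer[of S _ S'] stretched_adj by (metis DiffD1 IntD1)
  finally show ?thesis .
qed

end

lemma stretch_enumeration:
  assumes "Q \<subseteq> supp X"
  obtains p where "bij_betw p {1..card Q} Q"
    "supp (stretch Q X) = supp X \<union> (\<Union>t\<in>{1..card Q}.
       {(fst (p t), ncols X + t), (nrows X + t, snd (p t)), (nrows X + t, ncols X + t)})"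
proof -
  define p where "p t = sorted_list_of_set Q ! (t - 1)" for t
  have fin: "finite Q" using assms finite_supp finite_subset by blast
  have b: "bij_betw (\<lambda>i. sorted_list_of_set Q ! i) {..<card Q} Q"
    using fin by (intro bij_betw_nth) auto
  have "bij_betw (\<lambda>t. t - 1) {1..card Q} {..<card Q}"
    by (rule bij_betw_byWitness[where f' = Suc]) auto
  from bij_betw_trans[OF this b] have p: "bij_betw p {1..card Q} Q"
    by (simp add: p_def[abs_def] comp_def)
  have "p t \<in> {1..nrows X} \<times> {1..ncols X}" if "t \<in> {1..card Q}" for t
    using that p assms supp_subset[of X] unfolding bij_betw_def by blast
  then have pr: "1 \<le> fst (p t)" "fst (p t) \<le> nrows X" "1 \<le> snd (p t)" "snd (p t) \<le> ncols X"
    if "t \<in> {1..card Q}" for t using that by (force simp: mem_Times_iff)+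
  have "supp (stretch Q X) = supp X \<union> (\<Union>t\<in>{1..card Q}.
       {(fst (p t), ncols X + t), (nrows X + t, snd (p t)), (nrows X + t, ncols X + t)})"
    (is "_ = _ \<union> ?N")
  proof -
    have "supp (stretch Q X) = (supp X \<union> ?N) \<inter>
        ({1..nrows X + card Q} \<times> {1..ncols X + card Q})"
      unfolding stretch_def Let_def supp_def[of "(_, _, _)"] p_def
      by (simp add: nrows_def ncols_def)
    moreover have "supp X \<union> ?N \<subseteq> {1..nrows X + card Q} \<times> {1..ncols X + card Q}"
      using supp_subset[of X] pr by fastforce
    ultimately show ?thesis by blast
  qed
  with p show thesis using that by blast
qed

lemma nrows_stretch: "nrows (stretch Q X) = nrows X + card Q"
  and ncols_stretch: "ncols (stretch Q X) = ncols X + card Q"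
  by (simp_all add: stretch_def Let_def nrows_def ncols_def)

text \<open>This moves the whole question to the original matrix: the full stretched matrix reduces
  to \<open>supp X - Q\<close>, and every proper submatrix reduces to a set from which a line is
  missing or in which some entry of \<open>Q\<close> is still present.\<close>

lemma minimally_non_firm_stretchI:
  assumes Q: "Q \<subseteq> supp X"
    and nf: "\<not> firm (supp X) (supp X - Q)"
    and f: "\<And>R C Q'. R \<subseteq> {1..nrows X} \<Longrightarrow> C \<subseteq> {1..ncols X} \<Longrightarrow> Q' \<subseteq> Q \<Longrightarrow>
      R \<noteq> {1..nrows X} \<or> C \<noteq> {1..ncols X} \<or> Q' \<noteq> Q \<Longrightarrow> firm (supp X) (supp X \<inter> R \<times> C - Q')"
  shows "minimally_non_firm (stretch Q X)"
proof -
  let ?m = "nrows X" and ?n = "ncols X" and ?q = "card Q" and ?S = "supp X"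
  obtain p where p: "bij_betw p {1..?q} Q" and S': "supp (stretch Q X) = ?S \<union> (\<Union>t\<in>{1..?q}.
       {(fst (p t), ?n + t), (?m + t, snd (p t)), (?m + t, ?n + t)})"
    using stretch_enumeration[OF Q] by blast
  let ?S' = "supp (stretch Q X)"
  note iff = firm_stretched_submatrix_iff[OF supp_subset p Q S']
  have "inum ?S' < brnum ?S'"
  proof (rule not_firm_imp_inum_less_brnum[OF finite_supp])
    let ?R = "{1..?m + ?q}" and ?C = "{1..?n + ?q}"
    have 1: "?S' \<inter> ?R \<times> ?C = ?S'"
      using supp_subset[of "stretch Q X"] by (auto simp: nrows_stretch ncols_stretch)
    have 2: "{p t | t. t \<in> {1..?q} \<and> ?m + t \<in> ?R \<and> ?n + t \<in> ?C} = Q"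
    proof -
      have "{p t | t. t \<in> {1..?q} \<and> ?m + t \<in> ?R \<and> ?n + t \<in> ?C} = p ` {1..?q}" by auto
      then show ?thesis using p by (simp add: bij_betw_def)
    qed
    have 3: "{i \<in> ?R. i \<in> {1..?m} \<and> (\<forall>t\<in>{1..?q}. ?m + t \<notin> ?R \<and> ?n + t \<in> ?C \<longrightarrow> i \<noteq> fst (p t))} = {1..?m}"
      by auto
    have 4: "{i \<in> ?C. i \<in> {1..?n} \<and> (\<forall>t\<in>{1..?q}. ?m + t \<in> ?R \<and> ?n + t \<notin> ?C \<longrightarrow> i \<noteq> snd (p t))} = {1..?n}"
      by auto
    have 5: "?S \<inter> {1..?m} \<times> {1..?n} = ?S" using supp_subset[of X] by blast
    show "\<not> firm ?S' ?S'"
      using iff[of ?R ?C] nf unfolding 1 2 3 4 5 by blast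
  qed
  moreover have "inum (?S' \<inter> R \<times> C) = brnum (?S' \<inter> R \<times> C)"
    if RC: "R \<subseteq> {1..?m + ?q}" "C \<subseteq> {1..?n + ?q}" "R \<noteq> {1..?m + ?q} \<or> C \<noteq> {1..?n + ?q}" for R C
  proof (rule firm_imp_inum_eq_brnum)
    define Q' where "Q' = {p t | t. t \<in> {1..?q} \<and> ?m + t \<in> R \<and> ?n + t \<in> C}"
    define R' where "R' = {i \<in> R. i \<in> {1..?m} \<and> (\<forall>t\<in>{1..?q}. ?m + t \<notin> R \<and> ?n + t \<in> C \<longrightarrow> i \<noteq> fst (p t))}"
    define C' where "C' = {j \<in> C. j \<in> {1..?n} \<and> (\<forall>t\<in>{1..?q}. ?m + t \<in> R \<and> ?n + t \<notin> C \<longrightarrow> j \<noteq> snd (p t))}"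
    \<comment> \<open>If all of \<open>Q\<close> is removed, injectivity of \<open>p\<close> shows
      that every added row and column is kept; then a missing line is an old one and shows up in
      \<open>R'\<close> or \<open>C'\<close>.\<close>
    have "R' \<noteq> {1..?m} \<or> C' \<noteq> {1..?n} \<or> Q' \<noteq> Q"
    proof (rule ccontr)
      assume "\<not> ?thesis"
      then have eq: "R' = {1..?m}" "C' = {1..?n}" "Q' = Q" by auto
      have t: "?m + t \<in> R \<and> ?n + t \<in> C" if "t \<in> {1..?q}" for t
      proof -
        have "p t \<in> Q'" using eq(3) p that unfolding bij_betw_def by blast
        then obtain s where "p t = p s" "s \<in> {1..?q}" "?m + s \<in> R" "?n + s \<in> C"
          unfolding Q'_def by blast
        then show ?thesis using p that unfolding bij_betw_def inj_on_def by metis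
      qed
      have "R = {1..?m + ?q}"
      proof (rule antisym[OF RC(1)], rule)
        fix i assume i: "i \<in> {1..?m + ?q}"
        show "i \<in> R"
        proof (cases "i \<le> ?m")
          case True then show ?thesis using eq(1) i unfolding R'_def by auto
        next
          case False
          then have "i - ?m \<in> {1..?q}" "?m + (i - ?m) = i" using i by auto
          then show ?thesis using t[of "i - ?m"] by simp
        qed
      qed
      moreover have "C = {1..?n + ?q}"
      proof (rule antisym[OF RC(2)], rule)
        fix i assume i: "i \<in> {1..?n + ?q}"
        show "i \<in> C"
        proof (cases "i \<le> ?n")
          case True then show ?thesis using eq(2) i unfolding C'_def by auto
        next
          case False
          then have "i - ?n \<in> {1..?q}" "?n + (i - ?n) = i" using i by auto
          then show ?thesis using t[of "i - ?n"] by simp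
        qed
      qed
      ultimately show False using RC(3) by blast
    qed
    moreover have "R' \<subseteq> {1..?m}" "C' \<subseteq> {1..?n}" by (auto simp: R'_def C'_def)
    moreover have "Q' \<subseteq> Q" using p unfolding Q'_def bij_betw_def by blast
    ultimately have "firm ?S (?S \<inter> R' \<times> C' - Q')" by (intro f)
    then have "firm ?S' (?S' \<inter> R \<times> C)"
      using iff[of R C] unfolding Q'_def R'_def C'_def by blast
    then show "firm (?S' \<inter> R \<times> C) (?S' \<inter> R \<times> C)" using firm_restrict[OF order.refl] by blast
  qed (simp add: finite_supp)
  ultimately show ?thesis
    unfolding minimally_non_firm_def nrows_stretch ncols_stretch by blast
qed

section \<open>Totally balanced matrices\<close>

lemma supp_Cmat_iff:
  assumes "3 \<le> t"
  shows "(i, j) \<in> supp (Cmat t) \<longleftrightarrow> 1 \<le> i \<and> i < t \<and> (j = i \<or> j = Suc i) \<or> i = t \<and> (j = 1 \<or> j = t)"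
  using assms by (auto simp: supp_def Cmat_def nrows_def ncols_def)

lemma Cmat_row:
  assumes "3 \<le> t" "i \<in> {1..t}"
  shows "\<exists>A\<in>{1..t}. \<exists>B\<in>{1..t}. A \<noteq> B \<and> (i, A) \<in> supp (Cmat t) \<and> (i, B) \<in> supp (Cmat t)"
proof (cases "i = t")
  case True
  then show ?thesis using assms by (intro bexI[of _ 1] bexI[of _ t]) (auto simp: supp_Cmat_iff)
next
  case False
  then show ?thesis using assms by (intro bexI[of _ i] bexI[of _ "Suc i"]) (auto simp: supp_Cmat_iff)
qed

lemma Cmat_col:
  assumes "3 \<le> t" "i \<in> {1..t}" "(i, A) \<in> supp (Cmat t)"
  shows "\<exists>k\<in>{1..t}. k \<noteq> i \<and> (k, A) \<in> supp (Cmat t)"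
proof -
  have A: "1 \<le> A" "A \<le> t" using assms by (auto simp: supp_Cmat_iff)
  consider "i = A" "A = 1" | "i = A" "2 \<le> A" | "i \<noteq> A" using A by linarith
  then show ?thesis
  proof cases
    case 1
    then show ?thesis using assms by (intro bexI[of _ t]) (auto simp: supp_Cmat_iff)
  next
    case 2
    then show ?thesis using assms A by (intro bexI[of _ "A - 1"]) (auto simp: supp_Cmat_iff)
  next
    case 3
    then show ?thesis using assms(1) A by (intro bexI[of _ A]) (auto simp: supp_Cmat_iff)
  qed
qed

text \<open>This is where \<open>3 \<le> t\<close> matters, since the same formula for
  \<open>t = 2\<close> gives the full two by two block. The smaller of the two rows is not the last
  one, so its columns are consecutive, and no later row meets both of them.\<close>

lemma Cmat_no_square:
  assumes "3 \<le> t" "A \<noteq> B" "i \<noteq> k" "(i, A) \<in> supp (Cmat t)" "(i, B) \<in> supp (Cmat t)"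
    "(k, A) \<in> supp (Cmat t)" "(k, B) \<in> supp (Cmat t)"
  shows False
proof -
  have less: False if "i < k" "(i, A) \<in> supp (Cmat t)" "(i, B) \<in> supp (Cmat t)"
    "(k, A) \<in> supp (Cmat t)" "(k, B) \<in> supp (Cmat t)" for i k
  proof -
    have kt: "k < t \<or> k = t" using that(4) unfolding supp_Cmat_iff[OF assms(1)] by blast
    then have it: "i < t" using that(1) by linarith
    then have "A = i \<or> A = Suc i" "B = i \<or> B = Suc i"
      using that(2,3) unfolding supp_Cmat_iff[OF assms(1)] by auto
    then have i: "(k, i) \<in> supp (Cmat t)" "(k, Suc i) \<in> supp (Cmat t)"
      using that(4,5) assms(2) by metis+
    from kt show False
    proof
      assume "k < t"
      then show False using i(1) that(1) unfolding supp_Cmat_iff[OF assms(1)] by linarith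
    next
      assume "k = t"
      then show False using i it assms(1) unfolding supp_Cmat_iff[OF assms(1)] by linarith
    qed
  qed
  show False
    using less[of i k] less[of k i] assms(3-) by (cases "i < k") auto
qed

text \<open>In a cycle submatrix the row that comes first in the order meets its earlier column in another
  row of the cycle, which by the exchange condition then meets both columns of the first row.\<close>

lemma totally_balanced_exchangeI:
  fixes \<rho> \<kappa> :: "nat \<Rightarrow> nat"
  assumes inj: "inj \<rho>" "inj \<kappa>"
    and ex: "\<And>i k j l. \<rho> i < \<rho> k \<Longrightarrow> \<kappa> j < \<kappa> l \<Longrightarrow> (i, j) \<in> supp X \<Longrightarrow> (i, l) \<in> supp X \<Longrightarrow>
      (k, j) \<in> supp X \<Longrightarrow> (k, l) \<in> supp X"
  shows "totally_balanced X"
  unfolding totally_balanced_def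
proof (intro notI, elim exE conjE)
  fix t r c
  assume t: "3 \<le> t" and r: "inj_on r {1..t}" and c: "inj_on c {1..t}"
    and eq: "\<forall>i\<in>{1..t}. \<forall>j\<in>{1..t}. ((r i, c j) \<in> supp X) = ((i, j) \<in> supp (Cmat t))"
  define i where "i = arg_min_on (\<lambda>i. \<rho> (r i)) {1..t}"
  have ne: "finite {1..t}" "{1..t} \<noteq> {}" using t by auto
  have i: "i \<in> {1..t}" unfolding i_def using ne by (rule arg_min_if_finite(1))
  have mn: "\<rho> (r i) \<le> \<rho> (r k)" if "k \<in> {1..t}" for k
    unfolding i_def using arg_min_least[OF ne that, of "\<lambda>i. \<rho> (r i)"] .
  obtain A' B' where AB': "A' \<in> {1..t}" "B' \<in> {1..t}" "A' \<noteq> B'"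
    "(i, A') \<in> supp (Cmat t)" "(i, B') \<in> supp (Cmat t)" using Cmat_row[OF t i] by blast
  have "\<kappa> (c A') \<noteq> \<kappa> (c B')" using inj(2) inj_onD[OF c] AB' by (metis injD)
  then obtain A B where AB: "A \<in> {1..t}" "B \<in> {1..t}" "A \<noteq> B" "\<kappa> (c A) < \<kappa> (c B)"
    "(i, A) \<in> supp (Cmat t)" "(i, B) \<in> supp (Cmat t)"
    using AB' by (metis linorder_neqE_nat)
  obtain k where k: "k \<in> {1..t}" "k \<noteq> i" "(k, A) \<in> supp (Cmat t)" using Cmat_col[OF t i AB(5)] by blast
  have "\<rho> (r i) \<noteq> \<rho> (r k)" using inj(1) inj_onD[OF r] i k by (metis injD)
  then have "\<rho> (r i) < \<rho> (r k)" using mn[OF k(1)] by linarith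
  then have "(r k, c B) \<in> supp X" using ex[of "r i" "r k" "c A" "c B"] eq i k AB by blast
  then have "(k, B) \<in> supp (Cmat t)" using eq k AB by blast
  then show False using Cmat_no_square[OF t AB(3), of i k] k AB by blast
qed

text \<open>A cycle submatrix using an added row must use both of its entries, hence the added
  column as well, and then the second row meeting that column. Both rows also meet column
  \<open>snd (p s)\<close>, which gives a full two by two block. Once added rows are excluded, an
  added column has only one entry left, whereas cycle columns have two.\<close>

lemma totally_balanced_stretch:
  assumes Q: "Q \<subseteq> supp X" and X: "totally_balanced X"
  shows "totally_balanced (stretch Q X)"
  unfolding totally_balanced_def
proof (intro notI, elim exE conjE)
  let ?m = "nrows X" and ?n = "ncols X" and ?q = "card Q" and ?S = "supp X"
  obtain p where p: "bij_betw p {1..?q} Q" and S': "supp (stretch Q X) = ?S \<union> (\<Union>t\<in>{1..?q}.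
       {(fst (p t), ?n + t), (?m + t, snd (p t)), (?m + t, ?n + t)})"
    using stretch_enumeration[OF Q] by blast
  let ?S' = "supp (stretch Q X)"
  note row_entry = stretched_row_entry[OF supp_subset p Q S']
    and col_entry = stretched_col_entry[OF supp_subset p Q S']
    and old = stretched_old[OF supp_subset p Q S']
    and pr = p_range[OF supp_subset p Q S']
  fix t r c
  assume t: "3 \<le> t" and r: "inj_on r {1..t}" and c: "inj_on c {1..t}"
    and rS: "r ` {1..t} \<subseteq> {1..nrows (stretch Q X)}" and cS: "c ` {1..t} \<subseteq> {1..ncols (stretch Q X)}"
    and eq: "\<forall>i\<in>{1..t}. \<forall>j\<in>{1..t}. ((r i, c j) \<in> ?S') = ((i, j) \<in> supp (Cmat t))"
  have rows: "r i \<le> ?m" if i: "i \<in> {1..t}" for i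
  proof (rule ccontr)
    assume "\<not> r i \<le> ?m"
    moreover have "r i \<le> ?m + ?q" using rS imageI[OF i, of r] by (auto simp: nrows_stretch)
    ultimately obtain s where s: "s \<in> {1..?q}" "r i = ?m + s"
      using that[of "r i - ?m"] by force
    obtain A' B' where AB': "A' \<in> {1..t}" "B' \<in> {1..t}" "A' \<noteq> B'"
      "(i, A') \<in> supp (Cmat t)" "(i, B') \<in> supp (Cmat t)" using Cmat_row[OF t i] by blast
    have "c A' \<noteq> c B'" using c AB' by (auto dest: inj_onD)
    moreover have "c A' = snd (p s) \<or> c A' = ?n + s" "c B' = snd (p s) \<or> c B' = ?n + s"
      using row_entry[of s] eq i AB' s by metis+
    ultimately obtain A B where AB: "A \<in> {1..t}" "B \<in> {1..t}" "A \<noteq> B" "c A = ?n + s" "c B = snd (p s)"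
      "(i, A) \<in> supp (Cmat t)" "(i, B) \<in> supp (Cmat t)" using AB' by metis
    obtain k where k: "k \<in> {1..t}" "k \<noteq> i" "(k, A) \<in> supp (Cmat t)" using Cmat_col[OF t i AB(6)] by blast
    have "(r k, ?n + s) \<in> ?S'" using eq k AB by metis
    then have "r k = fst (p s) \<or> r k = ?m + s" using col_entry s by blast
    moreover have "r k \<noteq> r i" using r k i by (auto dest: inj_onD)
    ultimately have "r k = fst (p s)" using s by simp
    then have "(r k, c B) \<in> ?S'" using pr[OF s(1)] AB(5) unfolding S' by simp
    then have "(k, B) \<in> supp (Cmat t)" using eq k AB by blast
    then show False using Cmat_no_square[OF t AB(3), of i k] k AB by blast
  qed
  have cols: "c A \<le> ?n" if A: "A \<in> {1..t}" for A
  proof (rule ccontr)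
    assume "\<not> c A \<le> ?n"
    moreover have "c A \<le> ?n + ?q" using cS imageI[OF A, of c] by (auto simp: ncols_stretch)
    ultimately obtain s where s: "s \<in> {1..?q}" "c A = ?n + s"
      using that[of "c A - ?n"] by force
    have "\<exists>i\<in>{1..t}. (i, A) \<in> supp (Cmat t)"
      using A t by (intro bexI[of _ A]) (auto simp: supp_Cmat_iff)
    then obtain i where i: "i \<in> {1..t}" "(i, A) \<in> supp (Cmat t)" by blast
    obtain k where k: "k \<in> {1..t}" "k \<noteq> i" "(k, A) \<in> supp (Cmat t)" using Cmat_col[OF t i] by blast
    have "r j = fst (p s)" if "j \<in> {1..t}" "(j, A) \<in> supp (Cmat t)" for j
    proof -
      have "(r j, ?n + s) \<in> ?S'" using eq that A s by metis
      then show ?thesis using col_entry[of "r j" s] rows[OF that(1)] s by auto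
    qed
    then have "r i = r k" using i k by metis
    then show False using r i k by (auto dest: inj_onD)
  qed
  have "\<exists>t\<ge>3. \<exists>r c. inj_on r {1..t} \<and> r ` {1..t} \<subseteq> {1..?m} \<and> inj_on c {1..t} \<and> c ` {1..t} \<subseteq> {1..?n} \<and>
      (\<forall>i\<in>{1..t}. \<forall>j\<in>{1..t}. ((r i, c j) \<in> ?S) = ((i, j) \<in> supp (Cmat t)))"
  proof (rule exI[of _ t], rule conjI[OF t], rule exI[of _ r], rule exI[of _ c], intro conjI ballI)
    show "r ` {1..t} \<subseteq> {1..?m}"
    proof (rule image_subsetI)
      fix i assume i: "i \<in> {1..t}"
      show "r i \<in> {1..?m}" using rS imageI[OF i, of r] rows[OF i] by auto
    qed
    show "c ` {1..t} \<subseteq> {1..?n}"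
    proof (rule image_subsetI)
      fix i assume i: "i \<in> {1..t}"
      show "c i \<in> {1..?n}" using cS imageI[OF i, of c] cols[OF i] by auto
    qed
    show "((r i, c j) \<in> ?S) = ((i, j) \<in> supp (Cmat t))" if "i \<in> {1..t}" "j \<in> {1..t}" for i j
      using eq old[OF rows[OF that(1)] cols[OF that(2)]] that by blast
  qed (fact r c)+
  then show False using X unfolding totally_balanced_def by blast
qed

section \<open>Matrices with a spine and a chain\<close>

lemma firm_peel_subset:
  assumes "simplicial S U z" "U \<subseteq> S" "U' = {x \<in> U. \<not> adj S z x}" "firm S U'"
  shows "firm S U"
  using assms firm_simplicial_iff by blast

lemma simplicial_rectangle:
  assumes "z \<in> U" "\<And>x. x \<in> U \<Longrightarrow> adj S z x \<Longrightarrow> x \<in> I \<times> J" "I \<times> J \<subseteq> S"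
  shows "simplicial S U z"
proof -
  have "adj S x y" if "x \<in> U" "y \<in> U" "adj S z x" "adj S z y" for x y
    using assms(2)[of x] assms(2)[of y] that assms(3) by (auto simp: adj_def)
  then show ?thesis using assms(1) by (simp add: simplicial_def)
qed

lemma adj_rectangle: "x \<in> I \<times> J \<Longrightarrow> y \<in> I \<times> J \<Longrightarrow> I \<times> J \<subseteq> S \<Longrightarrow> adj S x y"
  by (auto simp: adj_def)

lemma firm_peel_rectangle:
  assumes e: "e \<in> V" and V: "V \<subseteq> S"
    and N: "\<And>k l. (k, l) \<in> V \<Longrightarrow> adj S e (k, l) \<Longrightarrow> (k, l) \<in> I \<times> J"
    and IJ: "I \<times> J \<subseteq> S" and f: "firm S {x \<in> V. \<not> adj S e x}"
  shows "firm S V"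
proof -
  have N': "x \<in> I \<times> J" if "x \<in> V" "adj S e x" for x using N that by (cases x) blast
  show ?thesis by (rule firm_peel_subset[OF simplicial_rectangle[OF e N' IJ] V refl f])
qed

text \<open>Support entries of one column are pairwise adjacent, so no rectangle has to be exhibited
  and the rows involved need not be known.\<close>

lemma simplicial_column:
  assumes "z \<in> U" "U \<subseteq> S" "\<And>x. x \<in> U \<Longrightarrow> adj S z x \<Longrightarrow> snd x = j"
  shows "simplicial S U z"
proof -
  have "adj S x y" if "x \<in> U" "y \<in> U" "adj S z x" "adj S z y" for x y
  proof -
    have "x \<in> S" "y \<in> S" "snd x = snd y" using assms that by auto
    then show ?thesis by (cases x; cases y) auto
  qed
  then show ?thesis using assms(1) by (simp add: simplicial_def)
qed

lemma firm_peel_column: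
  assumes "e \<in> V" "V \<subseteq> S" "\<And>k l. (k, l) \<in> V \<Longrightarrow> adj S e (k, l) \<Longrightarrow> l = j"
    and "firm S {x \<in> V. \<not> adj S e x}"
  shows "firm S V"
  using assms(3) by (intro firm_peel_subset[OF simplicial_column[OF assms(1,2), of j] assms(2) refl assms(4)]) auto

lemma firm_clique:
  assumes "\<And>x y. x \<in> U \<Longrightarrow> y \<in> U \<Longrightarrow> adj S x y"
  shows "firm S U"
proof (cases "U = {}")
  case False
  then obtain e where "e \<in> U" by blast
  then show ?thesis
    using assms by (intro firmI[of "{e}" _ _ "\<lambda>_. e"]) (auto simp: indep_def)
qed simp

lemma firm_row:
  assumes "U \<subseteq> S" "\<And>x. x \<in> U \<Longrightarrow> fst x = i"
  shows "firm S U"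
proof (rule firm_clique)
  fix x y assume "x \<in> U" "y \<in> U"
  then have "x \<in> S" "y \<in> S" "fst x = fst y" using assms by auto
  then show "adj S x y" by (cases x; cases y) auto
qed

text \<open>An odd hole is presented by its successor map \<open>g\<close>. Since \<open>g\<close>
  is injective, a triangle would have to be oriented cyclically, that is, be an orbit of length
  three, which \<open>hole\<close> rules out.\<close>

lemma not_firm_odd_hole:
  assumes "odd (card U)" "U \<subseteq> S" and g: "inj_on g U"
    and hole: "\<And>x. x \<in> U \<Longrightarrow> g x \<in> U \<and> g x \<noteq> x \<and> adj S x (g x) \<and> g (g (g x)) \<noteq> x"
    and nbr: "\<And>x y. x \<in> U \<Longrightarrow> y \<in> U \<Longrightarrow> adj S x y \<Longrightarrow> x = y \<or> y = g x \<or> x = g y"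
  shows "\<not> firm S U"
proof (rule not_firm_odd_triangle_free[OF assms(1,2) g])
  fix x y z assume xyz: "x \<in> U" "y \<in> U" "z \<in> U" and adj: "adj S x y" "adj S y z" "adj S x z"
  show "x = y \<or> y = z \<or> x = z"
    using nbr[OF xyz(1,2) adj(1)] nbr[OF xyz(2,3) adj(2)] nbr[OF xyz(1,3) adj(3)]
      hole[OF xyz(1)] hole[OF xyz(2)] hole[OF xyz(3)] inj_onD[OF g] xyz by metis
qed (use hole in blast)

text \<open>Common to \<open>Dinf\<close> with \<open>r = 3\<close> and \<open>Tinf\<close> with
  \<open>r = 4\<close>; the two differ only above the spine and in its first columns. Head rows end
  at column \<open>r\<close>, so the only chain entry with neighbours in the head is
  \<open>(Suc r, r)\<close>, and these neighbours all lie in column \<open>r\<close>.\<close>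

locale fan =
  fixes S :: "(nat \<times> nat) set" and r :: nat
  assumes chain: "r < i \<Longrightarrow> (i, j) \<in> S \<longleftrightarrow> j = i \<or> Suc j = i"
    and spine: "r \<le> j \<Longrightarrow> (r, j) \<in> S"
    and head: "i < r \<Longrightarrow> (i, j) \<in> S \<Longrightarrow> j \<le> r"
begin

lemma chain_adj:
  "r \<le> i \<Longrightarrow> r \<le> j \<Longrightarrow> adj S (Suc i, i) (Suc j, j) \<longleftrightarrow> j = i"
  "r \<le> i \<Longrightarrow> r < j \<Longrightarrow> adj S (Suc i, i) (j, j) \<longleftrightarrow> j = i \<or> j = Suc i"
  "r \<le> i \<Longrightarrow> r < j \<Longrightarrow> adj S (j, j) (Suc i, i) \<longleftrightarrow> j = i \<or> j = Suc i"
  "r < i \<Longrightarrow> r < j \<Longrightarrow> adj S (i, i) (j, j) \<longleftrightarrow> j = i"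
  using chain[of "Suc i" j] chain[of "Suc j" i] chain[of j i] chain[of i j]
  by (auto simp: less_Suc_eq_le)

lemma spine_adj:
  "r \<le> j \<Longrightarrow> adj S (r, l) (Suc j, j) \<longleftrightarrow> l = j \<or> l = Suc j"
  "r \<le> j \<Longrightarrow> adj S (Suc j, j) (r, l) \<longleftrightarrow> l = j \<or> l = Suc j"
  "r < j \<Longrightarrow> adj S (r, l) (j, j) \<longleftrightarrow> l = j \<or> Suc l = j"
  "r < j \<Longrightarrow> adj S (j, j) (r, l) \<longleftrightarrow> l = j \<or> Suc l = j"
  using chain[of "Suc j" l] chain[of j l] spine[of j] by (auto simp: less_Suc_eq_le)

lemma head_adj:
  assumes "h < r" "(h, c) \<in> S"
  shows "r \<le> j \<Longrightarrow> adj S (h, c) (Suc j, j) \<longleftrightarrow> j = r \<and> c = r"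
    "r \<le> j \<Longrightarrow> adj S (Suc j, j) (h, c) \<longleftrightarrow> j = r \<and> c = r"
    "r < j \<Longrightarrow> \<not> adj S (h, c) (j, j)" "r < j \<Longrightarrow> \<not> adj S (j, j) (h, c)"
  using head[of h j] head[of h c] chain[of "Suc j" c] assms by (auto simp: less_Suc_eq_le)

text \<open>The conclusion has the form that \<open>firm_cut\<close> expects of one step in the
  head: strictly fewer entries, none lost below row \<open>r\<close>, and firmness carried
  back.\<close>

lemma reduction_simplicial:
  assumes "simplicial S U e" "U \<subseteq> S" "\<And>x. x \<in> U \<Longrightarrow> adj S e x \<Longrightarrow> fst x \<le> r"
  shows "\<exists>V\<subset>U. (\<forall>x\<in>U - V. fst x \<le> r) \<and> (firm S V \<longrightarrow> firm S U)"
proof (intro exI[of _ "{x \<in> U. \<not> adj S e x}"] conjI)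
  have "e \<in> U" using assms(1) by (simp add: simplicial_def)
  then have "e \<notin> {x \<in> U. \<not> adj S e x}" using assms(2) by (auto simp: adj_refl)
  then show "{x \<in> U. \<not> adj S e x} \<subset> U" using \<open>e \<in> U\<close> by blast
  show "\<forall>x\<in>U - {x \<in> U. \<not> adj S e x}. fst x \<le> r" using assms(3) by auto
  show "firm S {x \<in> U. \<not> adj S e x} \<longrightarrow> firm S U"
    using firm_peel_subset[OF assms(1,2) refl] by blast
qed

lemma reduction_rectangle:
  assumes e: "e \<in> U" and U: "U \<subseteq> S"
    and N: "\<And>k l. (k, l) \<in> U \<Longrightarrow> adj S e (k, l) \<Longrightarrow> (k, l) \<in> I \<times> J"
    and IJ: "I \<times> J \<subseteq> S" "I \<subseteq> {..r}"
  shows "\<exists>V\<subset>U. (\<forall>x\<in>U - V. fst x \<le> r) \<and> (firm S V \<longrightarrow> firm S U)"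
proof -
  have N': "x \<in> I \<times> J" if "x \<in> U" "adj S e x" for x using N that by (cases x) blast
  show ?thesis
  proof (rule reduction_simplicial[OF simplicial_rectangle[OF e N' IJ(1)] U])
    show "fst x \<le> r" if "x \<in> U" "adj S e x" for x using N'[OF that] IJ(2) by auto
  qed
qed

text \<open>A head step that splits off several cliques together, for configurations of
  \<open>T\<close> that are not treated by a single simplicial entry.\<close>

lemma reduction_join:
  assumes "U1 \<subseteq> U" "E \<noteq> {}" "\<And>x. x \<in> U1 \<Longrightarrow> fst x \<le> r"
    and E: "finite E" "E \<subseteq> U1" "indep S E" "f ` U1 \<subseteq> E"
    and f: "\<And>x y. x \<in> U1 \<Longrightarrow> y \<in> U1 \<Longrightarrow> f x = f y \<Longrightarrow> adj S x y"
    and sep: "\<And>e x. e \<in> E \<Longrightarrow> x \<in> U - U1 \<Longrightarrow> \<not> adj S e x"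
  shows "\<exists>V\<subset>U. (\<forall>x\<in>U - V. fst x \<le> r) \<and> (firm S V \<longrightarrow> firm S U)"
proof (intro exI[of _ "U - U1"] conjI impI)
  show "U - U1 \<subset> U" using assms(1,2) E(2) by blast
  show "\<forall>x\<in>U - (U - U1). fst x \<le> r" using assms(3) by blast
  have "U1 \<union> (U - U1) = U" using assms(1) by blast
  moreover assume "firm S (U - U1)"
  then have "firm S (U1 \<union> (U - U1))" by (rule firm_join[OF _ E f sep])
  ultimately show "firm S U" by simp
qed

text \<open>The chain of entries \<open>(i + 1, i)\<close>, \<open>(i + 1, i + 1)\<close> below the spine row \<open>r\<close> is interrupted
  after row \<open>b\<close>. The last two conditions allow simplicial entries to be removed from row \<open>b\<close> upwards until
  the head is detached, and, once the head is gone, from row \<open>b + 1\<close> downwards.\<close>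

definition cut :: "nat \<Rightarrow> (nat \<times> nat) set \<Rightarrow> bool" where
  "cut b U \<longleftrightarrow> U \<subseteq> S \<and> r \<le> b \<and>
     ((Suc b, b) \<notin> U \<or> b = r \<and> (\<forall>i<r. (i, r) \<notin> U)) \<and>
     (\<forall>i\<ge>b. (Suc i, Suc i) \<in> U \<longrightarrow> (r, i) \<in> U \<longrightarrow> (Suc i, i) \<in> U) \<and>
     (\<forall>i. r \<le> i \<longrightarrow> i < b \<longrightarrow> (Suc i, i) \<in> U \<longrightarrow> (r, Suc i) \<in> U \<longrightarrow> (Suc i, Suc i) \<in> U)"

text \<open>In the conditions of \<open>cut\<close>, entries of rows up to \<open>r\<close> occur
  only as premises or as forbidden entries, so deleting some of them does no harm.\<close>

lemma cut_remove_low: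
  assumes "cut b U" "V \<subseteq> U" "\<And>x. x \<in> U - V \<Longrightarrow> fst x \<le> r"
  shows "cut b V"
proof -
  have "(k, l) \<in> V" if "(k, l) \<in> U" "r < k" for k l using assms(3)[of "(k, l)"] that by auto
  then show ?thesis using assms(1,2) unfolding cut_def
    by (smt (verit, ccfv_threshold) le_imp_less_Suc less_or_eq_imp_le order.trans subset_iff)
qed

text \<open>One induction over \<open>U\<close> serves all phases, because the rows that still carry
  entries tell which phase is current. The head is left abstract: \<open>red\<close> supplies its
  steps, and they preserve \<open>cut\<close> by \<open>cut_remove_low\<close>.\<close>

lemma firm_cut:
  assumes "finite U" "cut b U"
    and red: "\<And>U. finite U \<Longrightarrow> U \<subseteq> S \<Longrightarrow> \<exists>x\<in>U. fst x < r \<Longrightarrow>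
        (Suc r, r) \<notin> U \<or> (\<forall>i<r. (i, r) \<notin> U) \<Longrightarrow>
        \<exists>V\<subset>U. (\<forall>x\<in>U - V. fst x \<le> r) \<and> (firm S V \<longrightarrow> firm S U)"
  shows "firm S U"
  using assms(1,2)
proof (induction U rule: finite_psubset_induct)
  case (psubset U)
  note US = psubset.prems[unfolded cut_def, THEN conjunct1]
    and rb = psubset.prems[unfolded cut_def, THEN conjunct2, THEN conjunct1]
    and gap = psubset.prems[unfolded cut_def, THEN conjunct2, THEN conjunct2, THEN conjunct1]
    and up = psubset.prems[unfolded cut_def, THEN conjunct2, THEN conjunct2, THEN conjunct2, THEN conjunct1, rule_format]
    and down = psubset.prems[unfolded cut_def, THEN conjunct2, THEN conjunct2, THEN conjunct2, THEN conjunct2, rule_format]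
  have peel: "firm S U" if e: "simplicial S U e" and c: "cut b {x \<in> U. \<not> adj S e x}" for e
  proof (rule firm_peel_subset[OF e US refl])
    have "e \<in> U" using e by (simp add: simplicial_def)
    moreover have "e \<notin> {x \<in> U. \<not> adj S e x}" using \<open>e \<in> U\<close> US by (auto simp: adj_refl)
    ultimately have "{x \<in> U. \<not> adj S e x} \<subset> U" by blast
    then show "firm S {x \<in> U. \<not> adj S e x}" using psubset.IH c by blast
  qed
  have row: "l = k \<or> Suc l = k" if "(k, l) \<in> U" "r < k" for k l using chain that US by blast
  show ?case
  proof (cases "\<exists>x\<in>U. r < fst x \<and> fst x \<le> b")
    case True
    define A where "A = {i. r \<le> i \<and> i < b \<and> (\<exists>j. (Suc i, j) \<in> U)}"
    have "finite A" by (rule finite_subset[of _ "{..b}"]) (auto simp: A_def)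
    moreover have "A \<noteq> {}"
    proof -
      from True obtain k l where "(k, l) \<in> U" "r < k" "k \<le> b" by auto
      then have "k - 1 \<in> A" by (auto simp: A_def intro!: exI[of _ l])
      then show ?thesis by blast
    qed
    ultimately have "Max A \<in> A" and mx: "\<And>k. k \<in> A \<Longrightarrow> k \<le> Max A" by auto
    define i where "i = Max A"
    have i: "r \<le> i" "i < b" "\<exists>j. (Suc i, j) \<in> U"
      using \<open>Max A \<in> A\<close> by (simp_all add: A_def i_def)
    note mx = mx[folded i_def]
    \<comment> \<open>Column \<open>Suc i\<close> does not continue downwards: either the break is
      exactly there, or row \<open>Suc (Suc i)\<close> would contradict the choice of
      \<open>i\<close>.\<close>
    have nxt: "(Suc (Suc i), Suc i) \<notin> U"
    proof (cases "Suc i = b")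
      case True
      then show ?thesis using gap i by auto
    next
      case False
      then show ?thesis using mx[of "Suc i"] i by (auto simp: A_def)
    qed
    show ?thesis
    proof (cases "(Suc i, Suc i) \<in> U")
      case e: True
      have N: "x \<in> {r, Suc i} \<times> {i, Suc i}" if "x \<in> U" "adj S (Suc i, Suc i) x" for x
      proof -
        obtain k l where x: "x = (k, l)" by force
        have l: "l = i \<or> l = Suc i" using that i chain[of "Suc i" l] by (auto simp: x)
        have "r \<le> k" using that head[of k "Suc i"] i by (force simp: x)
        moreover have "k = Suc i \<or> k = Suc (Suc i)" if "r < k"
          using chain[of k "Suc i"] that \<open>adj S _ x\<close> by (auto simp: x)
        moreover have "k \<noteq> Suc (Suc i)"
          using nxt row[of k l] l that i by (auto simp: x)
        ultimately show ?thesis using l x by (cases "r < k") auto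
      qed
      have "{r, Suc i} \<times> {i, Suc i} \<subseteq> S" using i spine chain[of "Suc i"] by auto
      with e N have "simplicial S U (Suc i, Suc i)" by (rule simplicial_rectangle)
      moreover have "cut b {x \<in> U. \<not> adj S (Suc i, Suc i) x}"
        unfolding cut_def
      proof (intro conjI allI impI)
        fix k assume "b \<le> k" "(Suc k, Suc k) \<in> {x \<in> U. \<not> adj S (Suc i, Suc i) x}"
          "(r, k) \<in> {x \<in> U. \<not> adj S (Suc i, Suc i) x}"
        then show "(Suc k, k) \<in> {x \<in> U. \<not> adj S (Suc i, Suc i) x}"
          using up[of k] N[of "(Suc k, k)"] i by auto
      next
        fix k assume k: "r \<le> k" "k < b" "(Suc k, k) \<in> {x \<in> U. \<not> adj S (Suc i, Suc i) x}"
          "(r, Suc k) \<in> {x \<in> U. \<not> adj S (Suc i, Suc i) x}"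
        then have "k \<noteq> i" using i by (auto simp: chain)
        then show "(Suc k, Suc k) \<in> {x \<in> U. \<not> adj S (Suc i, Suc i) x}"
          using k down[of k] N[of "(Suc k, Suc k)"] by auto
      qed (use US rb gap in auto)
      ultimately show ?thesis by (rule peel)
    next
      case n: False
      then have e: "(Suc i, i) \<in> U" using i row by force
      \<comment> \<open>By contraposition of \<open>down\<close>: since
        \<open>(Suc i, Suc i)\<close> is gone, so is the spine entry above it, and only column
        \<open>i\<close> can contain neighbours.\<close>
      have sp: "(r, Suc i) \<notin> U" using down[of i] i n e by blast
      have N: "snd x = i" if "x \<in> U" "adj S (Suc i, i) x" for x
      proof -
        obtain k l where x: "x = (k, l)" by force
        have l: "l = i \<or> l = Suc i" using that i chain[of "Suc i" l] by (auto simp: x)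
        have "l \<noteq> Suc i"
        proof
          assume a: "l = Suc i"
          have "k \<noteq> r" using sp that a by (auto simp: x)
          moreover have "r \<le> k" using that US head[of k l] a i by (force simp: x)
          ultimately have "k = Suc i \<or> k = Suc (Suc i)" using row[of k l] that a by (auto simp: x)
          then show False using n nxt that a by (auto simp: x)
        qed
        then show ?thesis using l x by simp
      qed
      have "simplicial S U (Suc i, i)" using e US N by (rule simplicial_column)
      moreover have "cut b {x \<in> U. \<not> adj S (Suc i, i) x}"
        unfolding cut_def
      proof (intro conjI allI impI)
        fix k assume "b \<le> k" "(Suc k, Suc k) \<in> {x \<in> U. \<not> adj S (Suc i, i) x}"
          "(r, k) \<in> {x \<in> U. \<not> adj S (Suc i, i) x}"
        then show "(Suc k, k) \<in> {x \<in> U. \<not> adj S (Suc i, i) x}"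
          using up[of k] N[of "(Suc k, k)"] i by auto
      next
        fix k assume k: "r \<le> k" "k < b" "(Suc k, k) \<in> {x \<in> U. \<not> adj S (Suc i, i) x}"
          "(r, Suc k) \<in> {x \<in> U. \<not> adj S (Suc i, i) x}"
        then have "Suc k \<noteq> i" using i US by (auto simp: chain spine)
        then show "(Suc k, Suc k) \<in> {x \<in> U. \<not> adj S (Suc i, i) x}"
          using k down[of k] N[of "(Suc k, Suc k)"] by auto
      qed (use US rb gap in auto)
      ultimately show ?thesis by (rule peel)
    qed
  next
    case left: False
    show ?thesis
    proof (cases "\<exists>x\<in>U. fst x < r")
      case True
      \<comment> \<open>For \<open>r < b\<close> all chain rows up to \<open>b\<close> are empty by
        now, in particular row \<open>Suc r\<close>; for \<open>b = r\<close> this is the break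
        itself.\<close>
      have "(Suc r, r) \<notin> U \<or> (\<forall>i<r. (i, r) \<notin> U)"
        using gap left rb by (cases "b = r") force+
      from red[OF psubset.hyps US True this]
      obtain V where V: "V \<subset> U" "\<forall>x\<in>U - V. fst x \<le> r" "firm S V \<longrightarrow> firm S U" by blast
      have "cut b V" using cut_remove_low[OF psubset.prems] V by blast
      then show ?thesis using psubset.IH V by blast
    next
      case hd: False
      show ?thesis
      proof (cases "\<exists>x\<in>U. r < fst x")
        case True
        define i where "i = (LEAST i. r \<le> i \<and> (\<exists>j. (Suc i, j) \<in> U))"
        have "\<exists>i. r \<le> i \<and> (\<exists>j. (Suc i, j) \<in> U)"
        proof -
          from True obtain k l where "(k, l) \<in> U" "r < k" by auto
          then have "r \<le> k - 1 \<and> (Suc (k - 1), l) \<in> U" by auto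
          then show ?thesis by blast
        qed
        then have "r \<le> i \<and> (\<exists>j. (Suc i, j) \<in> U)"
          unfolding i_def by (rule LeastI_ex)
        then have i: "r \<le> i" "\<exists>j. (Suc i, j) \<in> U" by blast+
        have least: "i \<le> k" if "r \<le> k" "(Suc k, j) \<in> U" for k j
          unfolding i_def by (rule Least_le) (use that in blast)
        have bi: "b \<le> i" using left i by force
        \<comment> \<open>With the head gone and earlier chain rows empty, column \<open>i\<close>
          can only be met in the spine and in row \<open>Suc i\<close>.\<close>
        have rows: "k = r \<or> Suc i \<le> k" if "(k, l) \<in> U" for k l
        proof -
          have "r \<le> k" using hd that by force
          then show ?thesis using least[of "k - 1" l] that by (cases k; cases "k = r") auto
        qed
        show ?thesis
        proof (cases "(Suc i, i) \<in> U")
          case e: True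
          have N: "x \<in> {r, Suc i} \<times> {i, Suc i}" if "x \<in> U" "adj S (Suc i, i) x" for x
          proof -
            obtain k l where x: "x = (k, l)" by force
            have l: "l = i \<or> l = Suc i" using that i chain[of "Suc i" l] by (auto simp: x)
            have "k = r \<or> k = Suc i"
              using rows[of k l] that chain[of k i] i by (auto simp: x)
            then show ?thesis using l x by auto
          qed
          have "{r, Suc i} \<times> {i, Suc i} \<subseteq> S" using i spine chain[of "Suc i"] by auto
          with e N have "simplicial S U (Suc i, i)" by (rule simplicial_rectangle)
          moreover have "cut b {x \<in> U. \<not> adj S (Suc i, i) x}"
            unfolding cut_def
          proof (intro conjI allI impI)
            fix k assume k: "b \<le> k" "(Suc k, Suc k) \<in> {x \<in> U. \<not> adj S (Suc i, i) x}"
              "(r, k) \<in> {x \<in> U. \<not> adj S (Suc i, i) x}"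
            then have "k \<noteq> i" using i by (auto simp: chain)
            then show "(Suc k, k) \<in> {x \<in> U. \<not> adj S (Suc i, i) x}"
              using k up[of k] N[of "(Suc k, k)"] rb by auto
          next
            fix k assume k: "r \<le> k" "k < b" "(Suc k, k) \<in> {x \<in> U. \<not> adj S (Suc i, i) x}"
            then show "(Suc k, Suc k) \<in> {x \<in> U. \<not> adj S (Suc i, i) x}"
              using left by force
          qed (use US rb gap in auto)
          ultimately show ?thesis by (rule peel)
        next
          case n: False
          then have e: "(Suc i, Suc i) \<in> U" using i row by force
          have sp: "(r, i) \<notin> U" using up[of i] bi n e by blast
          have N: "snd x = Suc i" if "x \<in> U" "adj S (Suc i, Suc i) x" for x
          proof -
            obtain k l where x: "x = (k, l)" by force
            have l: "l = i \<or> l = Suc i" using that i chain[of "Suc i" l] by (auto simp: x)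
            have "l \<noteq> i"
            proof
              assume a: "l = i"
              have "k \<noteq> r" using sp that a by (auto simp: x)
              then have "Suc i \<le> k" using rows[of k l] that by (auto simp: x)
              then have "k = Suc i" using row[of k l] that a i by (auto simp: x)
              then show False using n that a by (auto simp: x)
            qed
            then show ?thesis using l x by simp
          qed
          have "simplicial S U (Suc i, Suc i)" using e US N by (rule simplicial_column)
          moreover have "cut b {x \<in> U. \<not> adj S (Suc i, Suc i) x}"
            unfolding cut_def
          proof (intro conjI allI impI)
            fix k assume k: "b \<le> k" "(Suc k, Suc k) \<in> {x \<in> U. \<not> adj S (Suc i, Suc i) x}"
              "(r, k) \<in> {x \<in> U. \<not> adj S (Suc i, Suc i) x}"
            then have "k \<noteq> Suc i" using i by (auto simp: chain spine)
            then show "(Suc k, k) \<in> {x \<in> U. \<not> adj S (Suc i, Suc i) x}"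
              using k up[of k] N[of "(Suc k, k)"] by auto
          next
            fix k assume k: "r \<le> k" "k < b" "(Suc k, k) \<in> {x \<in> U. \<not> adj S (Suc i, Suc i) x}"
            then show "(Suc k, Suc k) \<in> {x \<in> U. \<not> adj S (Suc i, Suc i) x}"
              using left by force
          qed (use US rb gap in auto)
          ultimately show ?thesis by (rule peel)
        qed
      next
        case False
        with hd have "fst x = r" if "x \<in> U" for x using that by force
        with US show ?thesis by (rule firm_row)
      qed
    qed
  qed
qed

text \<open>Columns up to \<open>n - 1\<close> are cliques, and the entries of the spine outside these columns form
  one more clique; \<open>A\<close> is an additional clique in the head.\<close>

lemma firm_columns:
  assumes "r < n" and US: "U \<subseteq> S"
    and h: "(h, r) \<in> U - A" "h < r"
    and diag: "\<And>j. r < j \<Longrightarrow> j < n \<Longrightarrow> (j, j) \<in> U - A"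
    and last: "(r, n) \<in> U - A"
    and low: "\<And>i j. (i, j) \<in> U - A \<Longrightarrow> j < r \<or> n \<le> j \<Longrightarrow> i = r"
    and AU: "A \<subseteq> U" and A: "\<And>x y. x \<in> A \<Longrightarrow> y \<in> A \<Longrightarrow> adj S x y"
    and a: "A \<noteq> {} \<Longrightarrow> a \<in> A \<and> fst a < r \<and> \<not> adj S a (h, r) \<and> \<not> adj S a (r, n)"
  shows "firm S U"
proof -
  \<comment> \<open>One entry off the spine for every column from \<open>r\<close> to
    \<open>n - 1\<close>, the spine entry \<open>(r, n)\<close> for all other columns, and
    \<open>a\<close> for the extra clique.\<close>
  define E where "E = (if A = {} then {} else {a}) \<union> {(h, r), (r, n)} \<union> (\<lambda>j. (j, j)) ` {r<..<n}"
  define f where "f x = (if x \<in> A then a else if snd x = r then (h, r)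
    else if r < snd x \<and> snd x < n then (snd x, snd x) else (r, n))" for x
  have nadj: "\<not> adj S (j, j) a" "\<not> adj S a (j, j)" if "A \<noteq> {}" "r < j" for j
  proof -
    have "\<not> (fst a, j) \<in> S" using head[of "fst a" j] a[OF that(1)] that(2) by auto
    then show "\<not> adj S (j, j) a" "\<not> adj S a (j, j)" by (auto simp: adj_def)
  qed
  have hS: "(h, j) \<notin> S" if "r < j" for j using head[of h j] h that by auto
  show ?thesis
  proof (rule firmI[of E _ _ f])
    show "finite E" by (simp add: E_def)
    show "E \<subseteq> U" using h diag last a AU by (auto simp: E_def)
    show "f ` U \<subseteq> E" by (auto simp: E_def f_def)
    show "indep S E"
      unfolding indep_def
    proof (intro ballI impI)
      fix x y assume x: "x \<in> E" and y: "y \<in> E" and xy: "adj S x y"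
      have *: "\<not> adj S a (h, r)" "\<not> adj S (h, r) a" "\<not> adj S a (r, n)" "\<not> adj S (r, n) a"
        if "A \<noteq> {}" using a[OF that] adj_sym by blast+
      show "x = y"
        using x y xy * nadj hS \<open>r < n\<close> unfolding E_def
        by (auto simp: chain split: if_splits)
    qed
    show "adj S x y" if x: "x \<in> U" and y: "y \<in> U" and f: "f x = f y" for x y
    proof -
      have "a \<noteq> (h, r)" "a \<noteq> (r, n)" "a \<noteq> (j, j)" if "A \<noteq> {}" "r < j" for j
        using a[OF that(1)] US AU that h last by (auto simp: adj_refl)
      then have *: "x \<in> A \<longleftrightarrow> y \<in> A" using f by (auto simp: f_def split: if_splits)
      show ?thesis
      proof (cases "x \<in> A")
        case True
        then show ?thesis using * A by blast
      next
        case False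
        then have ny: "y \<notin> A" using * by blast
        obtain i j k l where xy: "x = (i, j)" "y = (k, l)" by force
        have "j = l \<or> i = r \<and> k = r"
          using f False ny low[of i j] low[of k l] x y h(2) \<open>r < n\<close>
          by (auto simp: f_def xy split: if_splits)
        then show ?thesis using x y US by (auto simp: xy)
      qed
    qed
  qed
qed

end

section \<open>The matrices M\<close>

text \<open>The parameter is the size of the cycle part, one less than the size of the matrix, so
  that the last added line is \<open>Suc N\<close>.\<close>

definition Mset :: "nat \<Rightarrow> (nat \<times> nat) set" where
  "Mset N = {(i, j). 1 \<le> i \<and> i < N \<and> (j = i \<or> j = Suc i) \<or> i = N \<and> (j = 1 \<or> j = N \<or> j = Suc N) \<or>
     i = Suc N \<and> (j = N \<or> j = Suc N)}"

lemma supp_Mmat: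
  assumes "4 \<le> n"
  shows "supp (Mmat n) = Mset (n - 1)" "nrows (Mmat n) = n" "ncols (Mmat n) = n"
proof -
  obtain N where N: "n = Suc N" "3 \<le> N" using assms by (cases n) auto
  have rc: "nrows (Cmat N) = N" "ncols (Cmat N) = N" by (simp_all add: Cmat_def nrows_def ncols_def)
  have M: "Mmat n = (Suc N, Suc N, supp (Cmat N) \<union> {(N, Suc N), (Suc N, N), (Suc N, Suc N)})"
    by (simp add: Mmat_def N stretch_def Let_def rc)
  show "nrows (Mmat n) = n" "ncols (Mmat n) = n" unfolding M by (simp_all add: N nrows_def ncols_def)
  show "supp (Mmat n) = Mset (n - 1)"
  proof -
    have "supp (Cmat N) \<union> {(N, Suc N), (Suc N, N), (Suc N, Suc N)} = Mset N"
      by (auto simp: supp_Cmat_iff[OF N(2)] Mset_def)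
    then have "supp (Mmat n) = Mset N \<inter> {1..Suc N} \<times> {1..Suc N}"
      unfolding M by (simp add: supp_def nrows_def ncols_def)
    also have "\<dots> = Mset N" using N by (auto simp: Mset_def)
    finally show ?thesis by (simp add: N)
  qed
qed

lemma M_rows:
  "1 \<le> i \<Longrightarrow> i < N \<Longrightarrow> (i, j) \<in> Mset N \<longleftrightarrow> j = i \<or> j = Suc i"
  "(N, j) \<in> Mset N \<longleftrightarrow> j = 1 \<or> j = N \<or> j = Suc N"
  "(Suc N, j) \<in> Mset N \<longleftrightarrow> j = N \<or> j = Suc N"
  by (auto simp: Mset_def)

lemma M_cols:
  assumes "3 \<le> N"
  shows "(i, 1) \<in> Mset N \<longleftrightarrow> i = 1 \<or> i = N"
    "2 \<le> j \<Longrightarrow> j < N \<Longrightarrow> (i, j) \<in> Mset N \<longleftrightarrow> i = j \<or> Suc i = j"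
    "(i, N) \<in> Mset N \<longleftrightarrow> Suc i = N \<or> i = N \<or> i = Suc N"
    "(i, Suc N) \<in> Mset N \<longleftrightarrow> i = N \<or> i = Suc N"
  using assms by (auto simp: Mset_def)

lemma M_chain_cases:
  assumes "(i, j) \<in> Mset N" "i < N"
  shows "1 \<le> i" "j = i \<or> j = Suc i"
  using assms by (auto simp: Mset_def)

lemma M_two_cols:
  assumes "3 \<le> N" "(k, i) \<in> Mset N" "(k, Suc i) \<in> Mset N" "i < N"
  shows "k = i"
  using assms by (auto simp: Mset_def)

text \<open>Along \<open>(1,1), (1,2), (2,2), ..., (N - 1, N)\<close> the sum \<open>i + j\<close>
  is the position, running from \<open>2\<close> to \<open>2 * N - 1\<close>; so \<open>m\<close>
  names a missing place on this path. The path is peeled away from the gap in both directions, after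
  which only rows \<open>N\<close> and \<open>Suc N\<close> are left.\<close>

lemma firm_M_broken:
  assumes N: "3 \<le> N" and "finite U" "U \<subseteq> Mset N" and gap: "2 \<le> m" "m < 2 * N"
    "\<And>i j. (i, j) \<in> U \<Longrightarrow> i < N \<Longrightarrow> i + j \<noteq> m"
  shows "firm (Mset N) U"
  using assms(2,3,6)
proof (induction U rule: finite_psubset_induct)
  case (psubset U)
  note US = psubset.prems(1) and gapU = psubset.prems(2)
  let ?S = "Mset N"
  have IH: "firm ?S {x \<in> U. \<not> adj ?S e x}" if "e \<in> U" for e
  proof (rule psubset.IH)
    have "e \<notin> {x \<in> U. \<not> adj ?S e x}" using that US by (auto simp: adj_refl)
    then show "{x \<in> U. \<not> adj ?S e x} \<subset> U" using that by blast
  qed (use US gapU in auto)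
  have rowI: "firm ?S U" if "e \<in> U" "\<And>k l. (k, l) \<in> U \<Longrightarrow> adj ?S e (k, l) \<Longrightarrow> (k, l) \<in> I \<times> J" "I \<times> J \<subseteq> ?S" for e I J
    using firm_peel_rectangle[OF that(1) US that(2,3) IH[OF that(1)]] .
  have colI: "firm ?S U" if "e \<in> U" "\<And>k l. (k, l) \<in> U \<Longrightarrow> adj ?S e (k, l) \<Longrightarrow> l = j" for e j
    using firm_peel_column[OF that(1) US that(2) IH[OF that(1)]] .
  show ?case
  proof (cases "\<exists>i j. (i, j) \<in> U \<and> i < N \<and> i + j < m")
    case True
    define A where "A = {q. q < m \<and> (\<exists>i j. (i, j) \<in> U \<and> i < N \<and> i + j = q)}"
    have "finite A" by (rule finite_subset[of _ "{..m}"]) (auto simp: A_def)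
    moreover have "A \<noteq> {}" using True by (auto simp: A_def)
    ultimately have A: "Max A \<in> A" "\<And>q. q \<in> A \<Longrightarrow> q \<le> Max A" by auto
    from A(1) obtain i j where e: "(i, j) \<in> U" "i < N" "i + j < m" and q: "i + j = Max A"
      unfolding A_def by auto
    have mx: "k + l \<le> i + j" if "(k, l) \<in> U" "k < N" "k + l < m" for k l
    proof -
      have "k + l \<in> A" using that unfolding A_def by blast
      then show ?thesis unfolding q by (rule A(2))
    qed
    have nxt: "(k, l) \<notin> U" if "k < N" "k + l = Suc (i + j)" for k l
      using mx[of k l] gapU[of k l] that e(3) by (cases "k + l = m") auto
    have ij: "1 \<le> i" "j = i \<or> j = Suc i" using M_chain_cases e US by blast+
    from ij(2) show ?thesis
    proof
      assume j: "j = i"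
      show ?thesis
      proof (rule colI[OF e(1)])
        fix k l assume kl: "(k, l) \<in> U" "adj ?S (i, j) (k, l)"
        then have "l = i \<or> l = Suc i" using M_rows(1)[of i N l] ij e by auto
        moreover have "l \<noteq> Suc i"
        proof
          assume l: "l = Suc i"
          then have "k = i" using M_two_cols[OF N, of k i] kl US j e by auto
          then show False using nxt[of i l] kl(1) l j e by simp
        qed
        ultimately show "l = i" by blast
      qed
    next
      assume j: "j = Suc i"
      \<comment> \<open>The last position \<open>2 * N - 1\<close> is never below the gap, so column
        \<open>Suc i\<close> is not column \<open>N\<close> and meets only rows \<open>i\<close> and
        \<open>Suc i\<close>.\<close>
      then have "Suc i < N" using e(3) gap(2) by linarith
      show ?thesis
      proof (rule rowI[OF e(1), of "{i}" "{i, Suc i}"])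
        fix k l assume kl: "(k, l) \<in> U" "adj ?S (i, j) (k, l)"
        then have l: "l = i \<or> l = Suc i" using M_rows(1)[of i N l] ij e by auto
        have "k = Suc i \<or> Suc k = Suc i" using kl M_cols(2)[OF N, of "Suc i" k] \<open>Suc i < N\<close> ij j by auto
        moreover have "k \<noteq> Suc i"
        proof
          assume k: "k = Suc i"
          then have "l = Suc i" using M_chain_cases[of k l N] kl US \<open>Suc i < N\<close> l by auto
          then show False using nxt[of k l] kl(1) k j \<open>Suc i < N\<close> by simp
        qed
        ultimately show "(k, l) \<in> {i} \<times> {i, Suc i}" using l by auto
      qed (use ij e M_rows(1)[of i N] in auto)
    qed
  next
    case left: False
    show ?thesis
    proof (cases "\<exists>i j. (i, j) \<in> U \<and> i < N")
      case True
      define q where "q = (LEAST q. \<exists>i j. (i, j) \<in> U \<and> i < N \<and> i + j = q)"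
      have "\<exists>i j. (i, j) \<in> U \<and> i < N \<and> i + j = q"
        unfolding q_def by (rule LeastI_ex) (use True in blast)
      then obtain i j where e: "(i, j) \<in> U" "i < N" and q: "i + j = q" by blast
      have mn: "i + j \<le> k + l" if "(k, l) \<in> U" "k < N" for k l
        unfolding q q_def by (rule Least_le) (use that in blast)
      have big: "m < i + j" using left gapU[OF e] e by (metis linorder_neqE_nat)
      have prv: "(k, l) \<notin> U" if "k < N" "Suc (k + l) = i + j" for k l
        using mn[of k l] that by auto
      have ij: "1 \<le> i" "j = i \<or> j = Suc i" using M_chain_cases e US by blast+
      from ij(2) show ?thesis
      proof
        assume j: "j = i"
        \<comment> \<open>Dually, position \<open>2\<close> is never beyond the gap, so column
          \<open>i\<close> is not column \<open>1\<close>, which also meets row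
          \<open>N\<close>.\<close>
        then have i2: "2 \<le> i" using big gap by linarith
        show ?thesis
        proof (rule rowI[OF e(1), of "{i}" "{i, Suc i}"])
          fix k l assume kl: "(k, l) \<in> U" "adj ?S (i, j) (k, l)"
          then have l: "l = i \<or> l = Suc i" using M_rows(1)[of i N l] ij e by auto
          have "k = i \<or> Suc k = i" using kl M_cols(2)[OF N, of i k] i2 j e by auto
          moreover have "Suc k \<noteq> i"
          proof
            assume k: "Suc k = i"
            then have "l = i" using M_chain_cases[of k l N] kl US e l by auto
            then show False using prv[of k l] kl(1) k j e by simp
          qed
          ultimately show "(k, l) \<in> {i} \<times> {i, Suc i}" using l by auto
        qed (use ij e M_rows(1)[of i N] in auto)
      next
        assume j: "j = Suc i"
        show ?thesis
        proof (rule colI[OF e(1)])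
          fix k l assume kl: "(k, l) \<in> U" "adj ?S (i, j) (k, l)"
          then have "l = i \<or> l = Suc i" using M_rows(1)[of i N l] ij e by auto
          moreover have "l \<noteq> i"
          proof
            assume l: "l = i"
            then have "k = i" using M_two_cols[OF N, of k i] kl US j e by auto
            then show False using prv[of i l] kl(1) l j e by simp
          qed
          ultimately show "l = Suc i" by blast
        qed
      qed
    next
      case False
      then have top: "k = N \<or> k = Suc N" if "(k, l) \<in> U" for k l
        using that US by (fastforce simp: Mset_def)
      have rect: "{N, Suc N} \<times> {N, Suc N} \<subseteq> ?S" by (auto simp: M_rows)
      consider (d) "(Suc N, Suc N) \<in> U" | (c) "(Suc N, N) \<in> U" | (r) "(Suc N, Suc N) \<notin> U" "(Suc N, N) \<notin> U"
        by blast
      then show ?thesis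
      proof cases
        case d
        show ?thesis
          by (rule rowI[OF d _ rect]) (use N in \<open>auto simp: M_rows M_cols simp del: One_nat_def\<close>)
      next
        case c
        have "(k, l) \<in> {N, Suc N} \<times> {N, Suc N}" if "(k, l) \<in> U" "adj ?S (Suc N, N) (k, l)" for k l
          using that top[of k l] by (auto simp: M_rows)
        from c this rect show ?thesis by (rule rowI)
      next
        case r
        then have "fst x = N" if "x \<in> U" for x
          using that top[of "fst x" "snd x"] US M_rows(3)[of N "snd x"] by (cases x) auto
        with US show ?thesis by (rule firm_row)
      qed
    qed
  qed
qed

text \<open>If the path is complete, all rows before \<open>N\<close> and all columns up to
  \<open>N\<close> are kept, and only the last lines and \<open>Q\<close> are in doubt. In each case
  peeling destroys an entry of the path, so that \<open>firm_M_broken\<close> applies, unless the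
  plain even cycle is left.\<close>

lemma firm_M_submatrix:
  assumes N: "3 \<le> N" and Q: "Q \<subseteq> {(Suc N, Suc N)}"
    and proper: "R \<noteq> {1..Suc N} \<or> C \<noteq> {1..Suc N} \<or> Q \<noteq> {(Suc N, Suc N)}"
    and R: "R \<subseteq> {1..Suc N}" and C: "C \<subseteq> {1..Suc N}"
  shows "firm (Mset N) (Mset N \<inter> R \<times> C - Q)"
proof -
  define U where "U = Mset N \<inter> R \<times> C - Q"
  let ?S = "Mset N"
  have U: "(i, j) \<in> U \<longleftrightarrow> (i, j) \<in> ?S \<and> i \<in> R \<and> j \<in> C \<and> (i, j) \<notin> Q" for i j
    by (auto simp: U_def)
  have US: "U \<subseteq> ?S" by (auto simp: U_def)
  have fin: "finite U" by (rule finite_subset[of _ "R \<times> C"])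
    (use R C in \<open>auto simp: U_def intro: finite_subset\<close>)
  have broken: "firm ?S V" if V: "V \<subseteq> U" and p: "(i, j) \<in> ?S" "i < N" "(i, j) \<notin> V" for V i j
  proof (rule firm_M_broken[OF N finite_subset[OF V fin], of "i + j"])
    have ij: "1 \<le> i" "j = i \<or> j = Suc i" using M_chain_cases p by blast+
    then show "2 \<le> i + j" "i + j < 2 * N" using p by auto
    fix k l assume kl: "(k, l) \<in> V" "k < N"
    then have "l = k \<or> l = Suc k" using M_chain_cases[of k l N] V US by blast
    show "k + l \<noteq> i + j"
    proof
      assume "k + l = i + j"
      then have "k = i \<and> l = j" using ij \<open>l = k \<or> l = Suc k\<close> by presburger
      then show False using kl p by blast
    qed
  qed (use V US in blast)
  \<comment> \<open>Without \<open>(N, 1)\<close> the path has a free end at \<open>(1, 1)\<close>,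
    and removing this end creates a gap.\<close>
  have first: "firm ?S V" if V: "V \<subseteq> U" "(1, 1) \<in> V" "(N, 1) \<notin> V" for V
  proof (rule firm_peel_rectangle[OF V(2), of _ "{1}" "{1, 2}"])
    show "(k, l) \<in> {1} \<times> {1, 2}" if "(k, l) \<in> V" "adj ?S (1, 1) (k, l)" for k l
      using that V US N M_rows(1)[of 1 N l] M_rows(2)[of N l] by (auto simp: M_cols(1)[OF N] simp del: One_nat_def)
    show "firm ?S {x \<in> V. \<not> adj ?S (1, 1) x}"
      by (rule broken[of _ 1 1]) (use V N M_rows(1)[of 1 N] in auto)
  qed (use V US N M_rows(1)[of 1 N] in auto)
  have "firm ?S U"
  proof (cases "\<exists>i j. (i, j) \<in> ?S \<and> i < N \<and> (i, j) \<notin> U")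
    case True
    then show ?thesis using broken by blast
  next
    case False
    then have chain: "(i, j) \<in> U" if "(i, j) \<in> ?S" "i < N" for i j using that by blast
    have c11: "(1, 1) \<in> U" using chain[of 1 1] M_rows(1)[of 1 N 1] N by auto
    have ii: "i \<in> R" "i \<in> C" "Suc i \<in> C" if "1 \<le> i" "i < N" for i
      using chain[of i i] chain[of i "Suc i"] M_rows(1)[of i N] that by (auto simp: U)
    have NC: "N \<in> C" using ii(3)[of "N - 1"] N by auto
    show ?thesis
    proof (cases "(Suc N, Suc N) \<in> U")
      case d: True
      let ?V = "{x \<in> U. \<not> adj ?S (Suc N, Suc N) x}"
      have nV: "(N, N) \<notin> ?V" "(N, Suc N) \<notin> ?V" by (auto simp: M_rows)
      have V11: "(1, 1) \<in> ?V" using c11 N by (auto simp: M_rows)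
      have "firm ?S ?V"
      proof (cases "(N, 1) \<in> ?V")
        case x: True
        show ?thesis
        proof (rule firm_peel_rectangle[OF x, of _ "{1, N}" "{1}"])
          show "(k, l) \<in> {1, N} \<times> {1}" if "(k, l) \<in> ?V" "adj ?S (N, 1) (k, l)" for k l
          proof -
            have "k = 1 \<or> k = N" "l = 1 \<or> l = N \<or> l = Suc N"
              using that by (auto simp: M_rows M_cols[OF N] simp del: One_nat_def)
            moreover have "\<not> (k = 1 \<and> (l = N \<or> l = Suc N))"
              using that US M_rows(1)[of 1 N l] N by auto
            ultimately show ?thesis using that nV by auto
          qed
          show "firm ?S {x \<in> ?V. \<not> adj ?S (N, 1) x}"
            by (rule broken[of _ 1 1]) (use c11 US N in \<open>auto simp: M_rows\<close>)
        qed (use US N in \<open>auto simp: M_cols simp del: One_nat_def\<close>)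
      next
        case False
        then show ?thesis using V11 by (intro first) auto
      qed
      then show ?thesis
        by (intro firm_peel_rectangle[OF d US, of "{N, Suc N}" "{N, Suc N}"])
          (use N in \<open>auto simp: M_rows M_cols simp del: One_nat_def\<close>)
    next
      case d: False
      show ?thesis
      proof (cases "N \<in> R")
        case False
        then show ?thesis using c11 by (intro first) (auto simp: U)
      next
        case NR: True
        consider (bc) "(N, Suc N) \<in> U" "(Suc N, N) \<in> U" | (b) "(N, Suc N) \<in> U" "(Suc N, N) \<notin> U"
          | (c) "(N, Suc N) \<notin> U" "(Suc N, N) \<in> U" | (none) "(N, Suc N) \<notin> U" "(Suc N, N) \<notin> U" by blast
        then show ?thesis
        proof cases
          case bc
          \<comment> \<open>Now every line is known to be kept, so \<open>(Suc N, Suc N)\<close> is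
            missing because of \<open>Q\<close>, and this is the excluded case.\<close>
          then have S: "Suc N \<in> C" "Suc N \<in> R" by (auto simp: U)
          have *: "i < N \<or> i = N \<or> i = Suc N" if "i \<le> Suc N" for i using that by linarith
          have "R = {1..Suc N}" using R ii(1) NR S * by fastforce
          moreover have "C = {1..Suc N}" using C ii(2) NC S * by fastforce
          moreover have "(Suc N, Suc N) \<in> Q" using d S unfolding U by (simp add: M_rows)
          ultimately show ?thesis using proper Q by blast
        next
          case b
          let ?V = "{x \<in> U. \<not> adj ?S (N, Suc N) x}"
          have "firm ?S ?V"
            by (rule first) (use c11 N in \<open>auto simp: M_rows M_cols simp del: One_nat_def\<close>)
          moreover have "(k, l) \<in> {N} \<times> {1, N, Suc N}" if "(k, l) \<in> U" "adj ?S (N, Suc N) (k, l)" for k l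
          proof -
            have "k = N \<or> k = Suc N" "l = 1 \<or> l = N \<or> l = Suc N"
              using that by (auto simp: M_rows M_cols[OF N] simp del: One_nat_def)
            moreover have "k \<noteq> Suc N" using that US b d M_rows(3)[of N l] by auto
            ultimately show ?thesis by auto
          qed
          ultimately show ?thesis
            using firm_peel_rectangle[OF b(1) US, of "{N}" "{1, N, Suc N}"] by (auto simp: M_rows)
        next
          case c
          \<comment> \<open>Here the neighbourhood is column \<open>N\<close>; it contains the path
            entry \<open>(N - 1, N)\<close>.\<close>
          let ?V = "{x \<in> U. \<not> adj ?S (Suc N, N) x}"
          have "firm ?S ?V"
            by (rule broken[of _ "N - 1" N]) (use N in \<open>auto simp: M_rows M_cols\<close>)
          moreover have "l = N" if "(k, l) \<in> U" "adj ?S (Suc N, N) (k, l)" for k l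
          proof -
            have "l = N \<or> l = Suc N" using that by (auto simp: M_rows)
            moreover have "l \<noteq> Suc N" using that US c d M_cols(4)[OF N, of k] by auto
            ultimately show ?thesis by blast
          qed
          ultimately show ?thesis using firm_peel_column[OF c(2) US] by blast
        next
          case none
          have rows: "1 \<le> fst x" "fst x \<le> N" if "x \<in> U" for x
          proof -
            obtain k l where x: "x = (k, l)" by force
            have "k \<noteq> Suc N" using that US none d M_rows(3)[of N l] by (auto simp: x)
            moreover have "1 \<le> k" "k \<le> Suc N" using that R by (auto simp: x U)
            ultimately show "1 \<le> fst x" "fst x \<le> N" by (auto simp: x)
          qed
          \<comment> \<open>Exactly the even cycle of \<open>Cmat N\<close> is left: its rows are
            cliques, and its diagonal is independent.\<close>
          show ?thesis
          proof (rule firmI[of "(\<lambda>i. (i, i)) ` {1..N}" _ _ "\<lambda>x. (fst x, fst x)"])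
            have "(i, i) \<in> U" if "1 \<le> i" "i \<le> N" for i
            proof (cases "i = N")
              case True
              then show ?thesis using NR NC Q by (auto simp: U M_rows)
            next
              case False
              then show ?thesis using chain[of i i] M_rows(1)[of i N i] that by auto
            qed
            then show "(\<lambda>i. (i, i)) ` {1..N} \<subseteq> U" by auto
            show "indep ?S ((\<lambda>i. (i, i)) ` {1..N})"
              unfolding indep_def using N by (auto simp: Mset_def)
            show "(\<lambda>x. (fst x, fst x)) ` U \<subseteq> (\<lambda>i. (i, i)) ` {1..N}" using rows by auto
            show "adj ?S x y" if "x \<in> U" "y \<in> U" "(fst x, fst x) = (fst y, fst y)" for x y
              using that US by (cases x; cases y) auto
          qed simp
        qed
      qed
    qed
  qed
  then show ?thesis by (simp add: U_def)
qed

text \<open>The hole runs along the chain \<open>(1,1), (1,2), (2,2), \<dots>, (p, p + 1)\<close> and closes up through the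
  entries \<open>(p + 2, p + 1)\<close>, \<open>(p + 1, p + 2)\<close> and \<open>(p + 1, 1)\<close>, avoiding \<open>(p + 1, p + 1)\<close>.\<close>

definition M_hole :: "nat \<Rightarrow> (nat \<times> nat) set" where
  "M_hole p = (\<lambda>i. (i, i)) ` {1..p} \<union> (\<lambda>i. (i, Suc i)) ` {1..p} \<union>
     {(Suc (Suc p), Suc p), (Suc p, Suc (Suc p)), (Suc p, 1)}"

definition M_next :: "nat \<Rightarrow> nat \<times> nat \<Rightarrow> nat \<times> nat" where
  "M_next p x = (if fst x = Suc (Suc p) then (Suc p, Suc (Suc p))
     else if fst x = Suc p then if snd x = 1 then (1, 1) else (Suc p, 1)
     else if snd x = fst x then (fst x, Suc (fst x))
     else if fst x = p then (Suc (Suc p), Suc p) else (snd x, snd x))"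

lemma M_next_simps:
  "M_next p (Suc (Suc p), Suc p) = (Suc p, Suc (Suc p))"
  "M_next p (Suc p, Suc (Suc p)) = (Suc p, 1)" "M_next p (Suc p, 1) = (1, 1)"
  "i \<le> p \<Longrightarrow> M_next p (i, i) = (i, Suc i)"
  "i < p \<Longrightarrow> M_next p (i, Suc i) = (Suc i, Suc i)"
  "M_next p (p, Suc p) = (Suc (Suc p), Suc p)"
  by (simp_all add: M_next_def)

lemma M_hole_cases:
  assumes "x \<in> M_hole p"
  obtains "x = (Suc (Suc p), Suc p)" | "x = (Suc p, Suc (Suc p))" | "x = (Suc p, 1)"
  | i where "x = (i, i)" "1 \<le> i" "i \<le> p" | i where "x = (i, Suc i)" "1 \<le> i" "i < p" | "x = (p, Suc p)"
proof -
  from assms consider "x \<in> {(Suc (Suc p), Suc p), (Suc p, Suc (Suc p)), (Suc p, 1)}"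
    | "x \<in> (\<lambda>i. (i, i)) ` {1..p}" | "x \<in> (\<lambda>i. (i, Suc i)) ` {1..p}"
    unfolding M_hole_def by blast
  then show thesis
  proof cases
    case 1
    then show ?thesis using that(1-3) by blast
  next
    case 2
    then show ?thesis using that(4) by auto
  next
    case 3
    then obtain i where "x = (i, Suc i)" "1 \<le> i" "i \<le> p" by auto
    then show ?thesis using that(5)[of i] that(6) by (cases "i = p") auto
  qed
qed

lemma M_hole_mem:
  "(Suc (Suc p), Suc p) \<in> M_hole p" "(Suc p, Suc (Suc p)) \<in> M_hole p" "(Suc p, 1) \<in> M_hole p"
  "1 \<le> i \<Longrightarrow> i \<le> p \<Longrightarrow> (i, i) \<in> M_hole p" "1 \<le> i \<Longrightarrow> i \<le> p \<Longrightarrow> (i, Suc i) \<in> M_hole p"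
  by (auto simp: M_hole_def)

lemma M_hole_adj:
  assumes "2 \<le> p" "1 \<le> i" "i \<le> p"
  shows "1 \<le> j \<Longrightarrow> j \<le> p \<Longrightarrow> adj (Mset (Suc p)) (i, i) (j, j) \<longleftrightarrow> j = i"
    "1 \<le> j \<Longrightarrow> j \<le> p \<Longrightarrow> adj (Mset (Suc p)) (i, Suc i) (j, Suc j) \<longleftrightarrow> j = i"
    "1 \<le> j \<Longrightarrow> j \<le> p \<Longrightarrow> adj (Mset (Suc p)) (i, i) (j, Suc j) \<longleftrightarrow> i = j \<or> i = Suc j"
    "\<not> adj (Mset (Suc p)) (Suc (Suc p), Suc p) (i, i)"
    "adj (Mset (Suc p)) (Suc (Suc p), Suc p) (i, Suc i) \<longleftrightarrow> i = p"
    "\<not> adj (Mset (Suc p)) (Suc p, Suc (Suc p)) (i, i)"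
    "\<not> adj (Mset (Suc p)) (Suc p, Suc (Suc p)) (i, Suc i)"
    "adj (Mset (Suc p)) (Suc p, 1) (i, i) \<longleftrightarrow> i = 1"
    "\<not> adj (Mset (Suc p)) (Suc p, 1) (i, Suc i)"
  using assms M_rows(1)[of i "Suc p"] M_rows(1)[of j "Suc p"] by (auto simp: M_rows)

lemma not_firm_M_hole:
  assumes p: "2 \<le> p"
  shows "\<not> firm (Mset (Suc p)) (M_hole p)"
proof (rule not_firm_odd_hole[where g = "M_next p"])
  let ?A = "{(Suc (Suc p), Suc p), (Suc p, Suc (Suc p)), (Suc p, 1)} :: (nat \<times> nat) set"
  let ?B = "(\<lambda>i. (i, i)) ` {1..p}" and ?C = "(\<lambda>i. (i, Suc i)) ` {1..p}"
  \<comment> \<open>The hole has \<open>2 * p + 3\<close> entries.\<close>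
  have "card (?B \<union> ?C \<union> ?A) = card (?B \<union> ?C) + card ?A"
    by (rule card_Un_disjoint) (use p in auto)
  also have "card (?B \<union> ?C) = card ?B + card ?C"
    by (rule card_Un_disjoint) (use p in auto)
  also have "card ?A = 3" using p by auto
  also have "card ?B = p" by (subst card_image) (auto simp: inj_on_def)
  also have "card ?C = p" by (subst card_image) (auto simp: inj_on_def)
  finally show "odd (card (M_hole p))" by (simp add: M_hole_def)
  show "M_hole p \<subseteq> Mset (Suc p)" using p by (auto simp: M_hole_def Mset_def)
  show "inj_on (M_next p) (M_hole p)"
  proof (rule inj_onI)
    fix x y assume xy: "x \<in> M_hole p" "y \<in> M_hole p" "M_next p x = M_next p y"
    from xy(1) show "x = y"
      by (cases rule: M_hole_cases; use xy(2) in \<open>cases rule: M_hole_cases\<close>;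
          use xy(3) p in \<open>simp add: M_next_simps del: One_nat_def\<close>)
  qed
  fix x assume x: "x \<in> M_hole p"
  from x show "M_next p x \<in> M_hole p \<and> M_next p x \<noteq> x \<and> adj (Mset (Suc p)) x (M_next p x) \<and>
      M_next p (M_next p (M_next p x)) \<noteq> x"
    by (cases rule: M_hole_cases; use p in
      \<open>auto simp: M_next_simps M_hole_mem M_rows simp del: One_nat_def\<close>)
      (auto simp: M_next_def split: if_splits)
  fix y assume y: "y \<in> M_hole p" "adj (Mset (Suc p)) x y"
  from x show "x = y \<or> y = M_next p x \<or> x = M_next p y"
    by (cases rule: M_hole_cases; use y(1) in \<open>cases rule: M_hole_cases\<close>;
        use y(2) adj_sym[OF y(2)] p in \<open>auto simp: M_next_simps M_hole_adj simp del: One_nat_def adj_Pair\<close>)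
      (auto simp: M_rows)
qed

text \<open>The last column meets only the last two rows, and both of these meet column
  \<open>Suc p\<close>. Hence \<open>(Suc p, Suc p)\<close> dominates
  \<open>(Suc p, Suc (Suc p))\<close>, and dropping it leaves the hole. The hole's edge from
  \<open>(Suc (Suc p), Suc p)\<close> to \<open>(Suc p, Suc (Suc p))\<close> has the removed entry
  of \<open>Q\<close> as a corner.\<close>

lemma not_firm_M:
  assumes p: "2 \<le> p"
  shows "\<not> firm (Mset (Suc p)) (Mset (Suc p) - {(Suc (Suc p), Suc (Suc p))})"
proof
  let ?U = "Mset (Suc p) - {(Suc (Suc p), Suc (Suc p))}"
  have eq: "?U - {(Suc p, Suc p)} = M_hole p"
  proof -
    have "(i, j) \<in> ?U - {(Suc p, Suc p)} \<longleftrightarrow> (i, j) \<in> M_hole p" for i j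
    proof -
      consider "i = 0" | "1 \<le> i" "i \<le> p" | "i = Suc p" | "i = Suc (Suc p)" | "Suc (Suc p) < i" by linarith
      then show ?thesis by cases (use p in \<open>auto simp: Mset_def M_hole_def\<close>)
    qed
    then show ?thesis by (intro set_eqI) (metis surj_pair)
  qed
  assume "firm (Mset (Suc p)) ?U"
  then have "firm (Mset (Suc p)) (?U - {(Suc p, Suc p)})"
  proof (rule firm_remove_dominated[where h = "\<lambda>_. (Suc p, Suc (Suc p))"])
    fix v x assume v: "v \<in> {(Suc p, Suc p)}" and x: "x \<in> ?U" "adj (Mset (Suc p)) (Suc p, Suc (Suc p)) x"
    obtain k l where kl: "x = (k, l)" by force
    have "k = Suc p \<or> k = Suc (Suc p)" using x M_cols(4)[of "Suc p" k] p by (auto simp: kl)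
    then show "adj (Mset (Suc p)) v x" using v x by (auto simp: kl M_rows)
  qed (auto simp: Mset_def)
  then show False using not_firm_M_hole[OF p] unfolding eq by blast
qed

lemma minimally_non_firm_M:
  assumes n: "4 \<le> n"
  shows "minimally_non_firm (stretch {(n, n)} (Mmat n))"
proof -
  obtain p where p: "n = Suc (Suc p)" "2 \<le> p" using n by (cases n; cases "n - 1") auto
  have M: "supp (Mmat n) = Mset (Suc p)" "nrows (Mmat n) = n" "ncols (Mmat n) = n"
    using supp_Mmat[OF n] p(1) by simp_all
  show ?thesis
  proof (rule minimally_non_firm_stretchI; unfold M)
    show "{(n, n)} \<subseteq> Mset (Suc p)" by (simp add: p M_rows)
    show "\<not> firm (Mset (Suc p)) (Mset (Suc p) - {(n, n)})" using not_firm_M[OF p(2)] by (simp add: p)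
    show "firm (Mset (Suc p)) (Mset (Suc p) \<inter> R \<times> C - Q')"
      if "R \<subseteq> {1..n}" "C \<subseteq> {1..n}" "Q' \<subseteq> {(n, n)}" "R \<noteq> {1..n} \<or> C \<noteq> {1..n} \<or> Q' \<noteq> {(n, n)}" for R C Q'
      by (rule firm_M_submatrix) (use that p in simp_all)
  qed
qed

section \<open>The matrices H\<close>

definition Hset :: "nat \<Rightarrow> (nat \<times> nat) set" where
  "Hset t = {(i, j). 1 \<le> i \<and> i < t \<and> (j = 1 \<or> j = Suc i \<or> j = Suc (Suc i)) \<or>
     i = t \<and> (j = 1 \<or> j = 2 \<or> j = Suc t)}"

lemma supp_Hmat:
  assumes "3 \<le> t"
  shows "supp (Hmat t) = Hset t" "nrows (Hmat t) = t" "ncols (Hmat t) = Suc t"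
proof -
  show "nrows (Hmat t) = t" "ncols (Hmat t) = Suc t" by (simp_all add: Hmat_def nrows_def ncols_def)
  have "{(i, 1) | i. 1 \<le> i \<and> i \<le> t} \<union> {(i, j + 1) | i j. (i, j) \<in> supp (Cmat t)} = Hset t"
    using assms unfolding supp_Cmat_iff[OF assms] by (auto simp: Hset_def)
  then have "supp (Hmat t) = Hset t \<inter> {1..t} \<times> {1..Suc t}"
    by (simp add: supp_def[of "Hmat t"]) (simp add: Hmat_def nrows_def ncols_def)
  also have "\<dots> = Hset t" using assms by (auto simp: Hset_def)
  finally show "supp (Hmat t) = Hset t" .
qed

lemma H_rows:
  "1 \<le> i \<Longrightarrow> i < t \<Longrightarrow> (i, j) \<in> Hset t \<longleftrightarrow> j = 1 \<or> j = Suc i \<or> j = Suc (Suc i)"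
  "(t, j) \<in> Hset t \<longleftrightarrow> j = 1 \<or> j = 2 \<or> j = Suc t"
  by (auto simp: Hset_def)

lemma H_cols:
  assumes "3 \<le> t"
  shows "(k, 2) \<in> Hset t \<longleftrightarrow> k = 1 \<or> k = t"
    "2 \<le> i \<Longrightarrow> i \<le> t \<Longrightarrow> (k, Suc i) \<in> Hset t \<longleftrightarrow> k = i \<or> Suc k = i"
  using assms by (auto simp: Hset_def)

lemma H_entry:
  assumes "3 \<le> t" "(k, l) \<in> Hset t"
  shows "1 \<le> k" "k \<le> t" "1 \<le> l" "l \<le> Suc t" "l = 1 \<or> k < t \<and> (l = Suc k \<or> l = Suc (Suc k)) \<or> k = t \<and> (l = 2 \<or> l = Suc t)"
  using assms by (auto simp: Hset_def)

text \<open>Cyclic predecessor among the rows: \<open>H_prev t b\<close> and \<open>b\<close> are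
  the two rows that meet column \<open>Suc b\<close>.\<close>

definition H_prev :: "nat \<Rightarrow> nat \<Rightarrow> nat" where
  "H_prev t b = (if b = 1 then t else b - 1)"

text \<open>The rows are cyclically ordered, and \<open>b\<close> is a place where the cycle is interrupted. Rows \<open>b, \<dots>, t - 1\<close>
  are peeled upwards and rows \<open>b - 1, \<dots>, 1\<close> downwards, so that both parts end at row \<open>t\<close>, the only one
  from which entries other than whole lines may be missing.\<close>

definition H_cut :: "nat \<Rightarrow> nat \<Rightarrow> (nat \<times> nat) set \<Rightarrow> bool" where
  "H_cut t b U \<longleftrightarrow> U \<subseteq> Hset t \<and> 1 \<le> b \<and> b \<le> t \<and>
     \<not> ((H_prev t b, Suc b) \<in> U \<and> (b, Suc b) \<in> U) \<and>
     ((b, 1) \<in> U \<longrightarrow> (H_prev t b, Suc b) \<notin> U) \<and>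
     ((H_prev t b, 1) \<in> U \<longrightarrow> (b, Suc b) \<notin> U) \<and>
     (\<forall>i\<ge>b. i < t \<longrightarrow> (i, 1) \<in> U \<longrightarrow> (Suc i, Suc (Suc i)) \<in> U \<longrightarrow> (i, Suc (Suc i)) \<in> U) \<and>
     (\<forall>i\<ge>1. Suc i < b \<longrightarrow> (Suc i, 1) \<in> U \<longrightarrow> (i, Suc (Suc i)) \<in> U \<longrightarrow> (Suc i, Suc (Suc i)) \<in> U) \<and>
     (1 < b \<longrightarrow> (1, 1) \<in> U \<longrightarrow> (t, 2) \<in> U \<longrightarrow> (1, 2) \<in> U)"

text \<open>The full first column is the difficulty: \<open>(k, 1)\<close> is adjacent to every
  entry in a column that meets row \<open>k\<close>. To confine the neighbours of
  \<open>(i, Suc i)\<close> to row \<open>i\<close>, the entry \<open>(i - 1, 1)\<close> must be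
  excluded as well. The implications in \<open>H_cut\<close> do this once row \<open>i - 1\<close>
  has lost its other entries, and symmetrically in the other direction.\<close>

lemma firm_H_cut:
  assumes t: "3 \<le> t" and "finite U" "H_cut t b U"
  shows "firm (Hset t) U"
  using assms(2,3)
proof (induction U rule: finite_psubset_induct)
  case (psubset U)
  let ?S = "Hset t"
  have US: "U \<subseteq> ?S" and b: "1 \<le> b" "b \<le> t"
    and g1: "(H_prev t b, Suc b) \<in> U \<Longrightarrow> (b, Suc b) \<notin> U"
    and g2: "(b, 1) \<in> U \<Longrightarrow> (H_prev t b, Suc b) \<notin> U"
    and g3: "(H_prev t b, 1) \<in> U \<Longrightarrow> (b, Suc b) \<notin> U"
    and up: "\<And>i. b \<le> i \<Longrightarrow> i < t \<Longrightarrow> (i, 1) \<in> U \<Longrightarrow> (Suc i, Suc (Suc i)) \<in> U \<Longrightarrow> (i, Suc (Suc i)) \<in> U"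
    and down: "\<And>i. 1 \<le> i \<Longrightarrow> Suc i < b \<Longrightarrow> (Suc i, 1) \<in> U \<Longrightarrow> (i, Suc (Suc i)) \<in> U \<Longrightarrow> (Suc i, Suc (Suc i)) \<in> U"
    and down0: "1 < b \<Longrightarrow> (1, 1) \<in> U \<Longrightarrow> (t, 2) \<in> U \<Longrightarrow> (1, 2) \<in> U"
    using psubset.prems unfolding H_cut_def by blast+
  \<comment> \<open>The last three premises say: if the block of \<open>I\<close> and
    \<open>J\<close> takes away the conclusion of an implication in \<open>H_cut\<close>, it also
    takes away one of its premises.\<close>
  have peel: "firm ?S U" if e: "e \<in> U"
    and N: "\<And>k l. (k, l) \<in> U \<Longrightarrow> adj ?S e (k, l) \<Longrightarrow> (k, l) \<in> I \<times> J" and IJ: "I \<times> J \<subseteq> ?S"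
    and eIJ: "e \<in> I \<times> J"
    and up': "\<And>i. b \<le> i \<Longrightarrow> i < t \<Longrightarrow> i \<in> I \<Longrightarrow> Suc (Suc i) \<in> J \<Longrightarrow> 1 \<in> J \<or> Suc i \<in> I"
    and down': "\<And>i. 1 \<le> i \<Longrightarrow> Suc i < b \<Longrightarrow> Suc i \<in> I \<Longrightarrow> Suc (Suc i) \<in> J \<Longrightarrow> 1 \<in> J \<or> i \<in> I"
    and down0': "1 < b \<Longrightarrow> 1 \<in> I \<Longrightarrow> 2 \<in> J \<Longrightarrow> 1 \<in> J \<or> t \<in> I" for e I J
  proof (rule firm_peel_rectangle[OF e US N IJ])
    let ?V = "{x \<in> U. \<not> adj ?S e x}"
    have V: "(k, l) \<in> ?V \<longleftrightarrow> (k, l) \<in> U \<and> (k, l) \<notin> I \<times> J" for k l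
      using N IJ eIJ by (cases e) auto
    have "e \<notin> ?V" using e US by (auto simp: adj_refl)
    then have "?V \<subset> U" using e by blast
    moreover have "H_cut t b ?V"
    proof -
      have "(i, Suc (Suc i)) \<in> ?V"
        if "b \<le> i" "i < t" "(i, 1) \<in> ?V" "(Suc i, Suc (Suc i)) \<in> ?V" for i
        using up[of i] up'[of i] that unfolding V by blast
      moreover have "(Suc i, Suc (Suc i)) \<in> ?V"
        if "1 \<le> i" "Suc i < b" "(Suc i, 1) \<in> ?V" "(i, Suc (Suc i)) \<in> ?V" for i
        using down[of i] down'[of i] that unfolding V by blast
      moreover have "(1, 2) \<in> ?V" if "1 < b" "(1, 1) \<in> ?V" "(t, 2) \<in> ?V"
        using down0 down0' that unfolding V by blast
      moreover have "?V \<subseteq> U" by blast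
      ultimately show ?thesis
        unfolding H_cut_def using US b g1 g2 g3 by (meson subsetD subset_trans)
    qed
    ultimately show "firm ?S ?V" by (rule psubset.IH)
  qed
  have tI: "{1, t} \<times> {1, 2} \<subseteq> ?S" using t by (auto simp: Hset_def)
  show ?case
  proof (cases "\<exists>i l. (i, l) \<in> U \<and> b \<le> i \<and> i < t \<and> l \<noteq> 1")
    case True
    define i where "i = (LEAST i. \<exists>l. (i, l) \<in> U \<and> b \<le> i \<and> i < t \<and> l \<noteq> 1)"
    have "\<exists>l. (i, l) \<in> U \<and> b \<le> i \<and> i < t \<and> l \<noteq> 1"
      unfolding i_def by (rule LeastI_ex) (use True in blast)
    then obtain l0 where i: "b \<le> i" "i < t" and l0: "(i, l0) \<in> U" "l0 \<noteq> 1" by blast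
    have least: "(k, l) \<notin> U" if "b \<le> k" "k < i" "l \<noteq> 1" for k l
      using not_less_Least[of k "\<lambda>i. \<exists>l. (i, l) \<in> U \<and> b \<le> i \<and> i < t \<and> l \<noteq> 1"] that i
      unfolding i_def[symmetric] by auto
    have i1: "1 \<le> i" using i b by simp
    have rowi: "(i, l) \<in> ?S \<longleftrightarrow> l = 1 \<or> l = Suc i \<or> l = Suc (Suc i)" for l using H_rows(1)[of i t l] i i1 by blast
    show ?thesis
    proof (cases "(i, Suc i) \<in> U")
      case e: True
      show ?thesis
      proof (rule peel[OF e, of "{i}" "{1, Suc i, Suc (Suc i)}"])
        fix k l assume kl: "(k, l) \<in> U" "adj ?S (i, Suc i) (k, l)"
        have l: "l = 1 \<or> l = Suc i \<or> l = Suc (Suc i)" using kl rowi by auto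
        have "k = i"
        proof (rule ccontr)
          assume ki: "k \<noteq> i"
          have kS: "(k, Suc i) \<in> ?S" "(k, l) \<in> ?S" using kl US by auto
          have k: "k = H_prev t i"
          proof (cases "i = 1")
            case True
            then show ?thesis using kS(1) H_cols(1)[OF t, of k] ki by (auto simp: H_prev_def numeral_2_eq_2)
          next
            case False
            then have "2 \<le> i" using i1 by linarith
            then show ?thesis using kS(1) H_cols(2)[OF t, of i k] ki i by (auto simp: H_prev_def)
          qed
          have l': "l = 1 \<or> l = Suc i"
          proof (cases "i = 1")
            case True
            then show ?thesis using k l kS(2) t by (auto simp: H_prev_def H_rows(2))
          next
            case False
            then have "k = i - 1" "1 \<le> i - 1" "i - 1 < t" using k i i1 by (auto simp: H_prev_def)
            then show ?thesis using H_rows(1)[of "i - 1" t l] kS(2) l by auto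
          qed
          show False
          proof (cases "i = b")
            case True
            then show False using g1 g3 k l' kl(1) e by auto
          next
            case False
            then have k': "k = i - 1" "b \<le> k" "k < i" "k < t" "Suc k = i" using k i i1 b by (auto simp: H_prev_def)
            then have "(k, Suc i) \<notin> U" using least[of k "Suc i"] i1 by auto
            moreover have "(k, 1) \<notin> U" using up[of k] k' e \<open>(k, Suc i) \<notin> U\<close> by auto
            ultimately show False using l' kl(1) by auto
          qed
        qed
        then show "(k, l) \<in> {i} \<times> {1, Suc i, Suc (Suc i)}" using l by simp
      qed (use rowi i b in auto)
    next
      case n: False
      then have e: "(i, Suc (Suc i)) \<in> U" using l0 rowi US by blast
      have S2: "{i, Suc i} \<times> {1, Suc (Suc i)} \<subseteq> ?S" using i i1 by (auto simp: Hset_def)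
      show ?thesis
      proof (rule peel[OF e, of "{i, Suc i}" "{1, Suc (Suc i)}"])
        fix k l assume kl: "(k, l) \<in> U" "adj ?S (i, Suc (Suc i)) (k, l)"
        have l: "l = 1 \<or> l = Suc i \<or> l = Suc (Suc i)" using kl rowi by auto
        have k: "k = Suc i \<or> k = i" using kl H_cols(2)[OF t, of "Suc i" k] i i1 by auto
        have "l \<noteq> Suc i"
        proof
          assume l: "l = Suc i"
          then have "k = Suc i" using n kl k by auto
          then show False using l kl US H_entry(5)[OF t, of k l] i i1 t by auto
        qed
        then show "(k, l) \<in> {i, Suc i} \<times> {1, Suc (Suc i)}" using k l by auto
      qed (use S2 i i1 b in auto)
    qed
  next
    case right: False
    show ?thesis
    proof (cases "\<exists>i l. (i, l) \<in> U \<and> i < b \<and> l \<noteq> 1")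
      case True
      define A where "A = {i. i < b \<and> (\<exists>l. (i, l) \<in> U \<and> l \<noteq> 1)}"
      have "finite A" by (rule finite_subset[of _ "{..b}"]) (auto simp: A_def)
      moreover have "A \<noteq> {}" using True by (auto simp: A_def)
      ultimately have A: "Max A \<in> A" "\<And>q. q \<in> A \<Longrightarrow> q \<le> Max A" by auto
      define i where "i = Max A"
      from A(1) obtain l0 where i: "i < b" and l0: "(i, l0) \<in> U" "l0 \<noteq> 1" unfolding A_def i_def[symmetric] i_def by auto
      have mx: "(k, l) \<notin> U" if "i < k" "k < b" "l \<noteq> 1" for k l
        using A(2)[of k] that unfolding i_def[symmetric] by (auto simp: A_def)
      have i1: "1 \<le> i" using l0 US H_entry(1)[OF t] by blast
      have it: "i < t" using i b by simp
      have rowi: "(i, l) \<in> ?S \<longleftrightarrow> l = 1 \<or> l = Suc i \<or> l = Suc (Suc i)" for l using H_rows(1)[of i t l] it i1 by blast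
      show ?thesis
      proof (cases "(i, Suc (Suc i)) \<in> U")
        case e: True
        show ?thesis
        proof (rule peel[OF e, of "{i}" "{1, Suc i, Suc (Suc i)}"])
          fix k l assume kl: "(k, l) \<in> U" "adj ?S (i, Suc (Suc i)) (k, l)"
          have l: "l = 1 \<or> l = Suc i \<or> l = Suc (Suc i)" using kl rowi by auto
          have k: "k = Suc i \<or> k = i" using kl H_cols(2)[OF t, of "Suc i" k] it i1 by auto
          have "k \<noteq> Suc i"
          proof
            assume k: "k = Suc i"
            have l': "l = 1 \<or> l = Suc (Suc i)"
              using k l kl US H_entry(5)[OF t, of k l] i1 t it by auto
            show False
            proof (cases "Suc i = b")
              case True
              then have "H_prev t b = i" using i1 by (auto simp: H_prev_def)
              then show False using g1 g2 True e k l' kl(1) by auto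
            next
              case False
              then have "(Suc i, Suc (Suc i)) \<notin> U" using mx[of "Suc i" "Suc (Suc i)"] i by auto
              moreover have "(Suc i, 1) \<notin> U" using down[of i] False i i1 e calculation by auto
              ultimately show False using k l' kl(1) by auto
            qed
          qed
          then show "(k, l) \<in> {i} \<times> {1, Suc i, Suc (Suc i)}" using k l by simp
        qed (use rowi i b in auto)
      next
        case n: False
        then have e: "(i, Suc i) \<in> U" using l0 rowi US by blast
        \<comment> \<open>Row \<open>1\<close> is preceded by row \<open>t\<close>, which shares
          column \<open>2\<close> with it and is removed only at the end.\<close>
        show ?thesis
        proof (cases "i = 1")
          case True
          show ?thesis
          proof (rule peel[OF e, of "{1, t}" "{1, 2}"])
            fix k l assume kl: "(k, l) \<in> U" "adj ?S (i, Suc i) (k, l)"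
            have "(1, l) \<in> ?S" "(k, 2) \<in> ?S" using kl(2) unfolding True by (simp_all add: numeral_2_eq_2)
            then have l: "l = 1 \<or> l = 2 \<or> l = 3" and k: "k = 1 \<or> k = t"
              using H_rows(1)[of 1 t l] H_cols(1)[OF t, of k] t by auto
            have n': "(1, 3) \<notin> U" using n unfolding True by (simp add: numeral_3_eq_3)
            have "(t, 3) \<notin> U" using US H_rows(2)[of t 3] t by auto
            then have "l \<noteq> 3" using n' kl(1) k by auto
            then show "(k, l) \<in> {1, t} \<times> {1, 2}" using k l by auto
          qed (use tI True in auto)
        next
          case False
          then obtain j where j: "i = Suc j" "1 \<le> j" using i1 by (cases i) auto
          have S2: "{j, i} \<times> {1, Suc i} \<subseteq> ?S" using j it by (auto simp: Hset_def)
          show ?thesis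
          proof (rule peel[OF e, of "{j, i}" "{1, Suc i}"])
            fix k l assume kl: "(k, l) \<in> U" "adj ?S (i, Suc i) (k, l)"
            have l: "l = 1 \<or> l = Suc i \<or> l = Suc (Suc i)" using kl rowi by auto
            have k: "k = i \<or> k = j" using kl H_cols(2)[OF t, of i k] it j by auto
            have "l \<noteq> Suc (Suc i)"
              using n kl k US j it H_rows(1)[of j t l] by auto
            then show "(k, l) \<in> {j, i} \<times> {1, Suc i}" using k l by auto
          qed (use S2 j i b in auto)
        qed
      qed
    next
      case left: False
      have bot: "k = t \<or> l = 1" if "(k, l) \<in> U" for k l
      proof (rule ccontr)
        assume "\<not> ?thesis"
        moreover have "k \<le> t" using that US H_entry(2)[OF t] by blast
        ultimately have "k < t" "l \<noteq> 1" by auto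
        then show False using left right that by (metis not_less)
      qed
      show ?thesis
      proof (cases "(t, 2) \<in> U")
        case e: True
        \<comment> \<open>\<open>(1, 1)\<close> is the only entry outside row \<open>t\<close> that
          could still be a neighbour of \<open>(t, 2)\<close>. It is excluded by
          \<open>down0\<close> for \<open>1 < b\<close> and by the break itself for
          \<open>b = 1\<close>.\<close>
        have n11: "(1, 1) \<notin> U"
        proof
          assume a: "(1, 1) \<in> U"
          have "(1, 2) \<notin> U" using bot[of 1 2] t by auto
          then have "b = 1" using down0 a e b by linarith
          then show False using g2 a e by (auto simp: H_prev_def numeral_2_eq_2)
        qed
        show ?thesis
        proof (rule peel[OF e, of "{t}" "{1, 2, Suc t}"])
          fix k l assume kl: "(k, l) \<in> U" "adj ?S (t, 2) (k, l)"
          have "l = 1 \<or> l = 2 \<or> l = Suc t" "k = 1 \<or> k = t"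
            using kl H_cols(1)[OF t, of k] by (auto simp: H_rows(2))
          moreover have "k \<noteq> 1"
          proof
            assume "k = 1"
            then have "l = 1" using bot[of k l] kl t by auto
            then show False using kl \<open>k = 1\<close> n11 by simp
          qed
          ultimately show "(k, l) \<in> {t} \<times> {1, 2, Suc t}" by auto
        qed (use H_rows(2)[of t] b in auto)
      next
        case n: False
        show ?thesis
        proof (cases "(t, Suc t) \<in> U")
          case e: True
          obtain s where s: "t = Suc s" "2 \<le> s" using t by (cases t) auto
          have S2: "{s, t} \<times> {1, Suc t} \<subseteq> ?S" using s by (auto simp: Hset_def)
          show ?thesis
          proof (rule peel[OF e, of "{s, t}" "{1, Suc t}"])
            fix k l assume kl: "(k, l) \<in> U" "adj ?S (t, Suc t) (k, l)"
            have k: "k = t \<or> k = s" using kl H_cols(2)[OF t, of t k] s by auto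
            have "l = 1 \<or> l = 2 \<or> l = Suc t" using kl by (auto simp: H_rows(2))
            moreover have "l \<noteq> 2" using n kl k bot[of k l] by auto
            ultimately show "(k, l) \<in> {s, t} \<times> {1, Suc t}" using k by auto
          qed (use S2 s b in auto)
        next
          case False
          have col: "snd x = 1" if "x \<in> U" for x
            using that n False bot[of "fst x" "snd x"] US H_rows(2)[of t "snd x"] by (cases x) auto
          show ?thesis
          proof (rule firm_clique)
            fix x y assume xy: "x \<in> U" "y \<in> U"
            then have "(fst x, 1) \<in> ?S" "(fst y, 1) \<in> ?S"
              using US col[of x] col[of y] by (metis prod.collapse subsetD)+
            then show "adj ?S x y" using col xy by (simp add: adj_def)
          qed
        qed
      qed
    qed
  qed
qed

text \<open>A missing row, or a missing column other than the first, is itself a break. Otherwise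
  the entries of \<open>Gset t\<close> decide: if both survive, rows form an optimal clique
  partition; if one survives, peeling it opens a break next to row \<open>t\<close>; if none does,
  properness forces the first column to be missing.\<close>

lemma firm_H_submatrix:
  assumes t: "3 \<le> t" and Q: "Q \<subseteq> Gset t"
    and proper: "R \<noteq> {1..t} \<or> C \<noteq> {1..Suc t} \<or> Q \<noteq> Gset t"
    and R: "R \<subseteq> {1..t}" and C: "C \<subseteq> {1..Suc t}"
  shows "firm (Hset t) (Hset t \<inter> R \<times> C - Q)"
proof -
  define U where "U = Hset t \<inter> R \<times> C - Q"
  let ?S = "Hset t"
  have U: "(i, j) \<in> U \<longleftrightarrow> (i, j) \<in> ?S \<and> i \<in> R \<and> j \<in> C \<and> (i, j) \<notin> Q" for i j
    by (auto simp: U_def)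
  have Qt: "i = t" "j = 2 \<or> j = Suc t" if "(i, j) \<in> Q" for i j using that Q by (auto simp: Gset_def)
  have US: "U \<subseteq> ?S" by (auto simp: U_def)
  have fin: "finite U" by (rule finite_subset[of _ "R \<times> C"])
    (use R C in \<open>auto simp: U_def intro: finite_subset\<close>)
  \<comment> \<open>The row and the column of the conclusion occur in the premises, so it could fail
    only through \<open>Q\<close>, which lives in row \<open>t\<close>.\<close>
  have up: "(i, Suc (Suc i)) \<in> U" if "1 \<le> i" "i < t" "(i, 1) \<in> U" "(Suc i, Suc (Suc i)) \<in> U" for i
    using that Qt[of i "Suc (Suc i)"] H_rows(1)[of i t] by (auto simp: U)
  have down: "(Suc i, Suc (Suc i)) \<in> U" if "1 \<le> i" "Suc i < t" "(Suc i, 1) \<in> U" "(i, Suc (Suc i)) \<in> U" for i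
    using that Qt[of "Suc i" "Suc (Suc i)"] H_rows(1)[of "Suc i" t] by (auto simp: U)
  have down0: "(1, 2) \<in> U" if "(1, 1) \<in> U" "(t, 2) \<in> U"
    using that Qt[of 1 2] H_rows(1)[of 1 t 2] t by (auto simp: U)
  have cut: "firm ?S V" if b: "1 \<le> b" "b \<le> t" and V: "V \<subseteq> U"
    and g: "(H_prev t b, Suc b) \<notin> V \<or> (b, Suc b) \<notin> V \<and> (b, 1) \<notin> V"
      "(b, Suc b) \<notin> V \<or> (H_prev t b, Suc b) \<notin> V \<and> (H_prev t b, 1) \<notin> V"
    and upV: "\<And>i. b \<le> i \<Longrightarrow> i < t \<Longrightarrow> (i, 1) \<in> V \<Longrightarrow> (Suc i, Suc (Suc i)) \<in> V \<Longrightarrow> (i, Suc (Suc i)) \<in> V"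
    and downV: "\<And>i. 1 \<le> i \<Longrightarrow> Suc i < b \<Longrightarrow> (Suc i, 1) \<in> V \<Longrightarrow> (i, Suc (Suc i)) \<in> V \<Longrightarrow> (Suc i, Suc (Suc i)) \<in> V"
    and down0V: "1 < b \<Longrightarrow> (1, 1) \<in> V \<Longrightarrow> (t, 2) \<in> V \<Longrightarrow> (1, 2) \<in> V" for b V
  proof (rule firm_H_cut[OF t finite_subset[OF V fin], of b])
    show "H_cut t b V"
      unfolding H_cut_def using V US b g upV downV down0V by blast
  qed
  have cutU: "firm ?S U" if "1 \<le> b" "b \<le> t"
    "(H_prev t b, Suc b) \<notin> U \<or> (b, Suc b) \<notin> U \<and> (b, 1) \<notin> U"
    "(b, Suc b) \<notin> U \<or> (H_prev t b, Suc b) \<notin> U \<and> (H_prev t b, 1) \<notin> U" for b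
    by (rule cut[OF that(1,2) order.refl that(3,4)]) (use up down down0 that(1,2) in auto)
  consider (row) i where "1 \<le> i" "i \<le> t" "i \<notin> R" | (col) j where "1 \<le> j" "j \<le> t" "Suc j \<notin> C"
    | (full) "\<And>i. 1 \<le> i \<Longrightarrow> i \<le> t \<Longrightarrow> i \<in> R" "\<And>j. 1 \<le> j \<Longrightarrow> j \<le> t \<Longrightarrow> Suc j \<in> C" by blast
  then have "firm ?S U"
  proof cases
    case row
    then show ?thesis by (intro cutU[of i]) (auto simp: U)
  next
    case col
    then show ?thesis by (intro cutU[of j]) (auto simp: U)
  next
    case full
    have RE: "R = {1..t}" using R full(1) by auto
    have s2: "2 \<in> C" "Suc t \<in> C" using full(2)[of 1] full(2)[of t] t by (auto simp: numeral_2_eq_2)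
    have tR: "t \<in> R" using full(1)[of t] t by simp
    consider (none) "(t, 2) \<in> U" "(t, Suc t) \<in> U" | (u) "(t, 2) \<in> U" "(t, Suc t) \<notin> U"
      | (v) "(t, 2) \<notin> U" "(t, Suc t) \<in> U" | (both) "(t, 2) \<notin> U" "(t, Suc t) \<notin> U" by blast
    then show ?thesis
    proof cases
      case none
      show ?thesis
      proof (rule firmI[of "(\<lambda>i. (i, Suc i)) ` {1..t}" _ _ "\<lambda>x. (fst x, Suc (fst x))"])
        have "(i, Suc i) \<in> U" if "1 \<le> i" "i \<le> t" for i
        proof (cases "i = t")
          case True
          then show ?thesis using none by simp
        next
          case False
          then show ?thesis using full(1)[of i] full(2)[of i] that Qt[of i "Suc i"] H_rows(1)[of i t]
            by (auto simp: U)
        qed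
        then show "(\<lambda>i. (i, Suc i)) ` {1..t} \<subseteq> U" by auto
        show "indep ?S ((\<lambda>i. (i, Suc i)) ` {1..t})"
          unfolding indep_def using t by (auto simp: Hset_def)
        show "(\<lambda>x. (fst x, Suc (fst x))) ` U \<subseteq> (\<lambda>i. (i, Suc i)) ` {1..t}"
          using R by (auto simp: U_def)
        show "adj ?S x y" if "x \<in> U" "y \<in> U" "(fst x, Suc (fst x)) = (fst y, Suc (fst y))" for x y
          using that US by (cases x; cases y) auto
      qed simp
    next
      case u
      let ?V = "{x \<in> U. \<not> adj ?S (t, 2) x}"
      have V: "(1, 1) \<notin> ?V" "(1, 2) \<notin> ?V" "(t, 1) \<notin> ?V" "(t, 2) \<notin> ?V"
        using t H_rows(1)[of 1 t] by (auto simp: H_rows(2) H_cols)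
      have keep: "(k, l) \<in> ?V" if "(k, l) \<in> U" "k \<noteq> 1" "k \<noteq> t" for k l
        using that H_cols(1)[OF t, of k] by auto
      have "firm ?S ?V"
      proof (rule cut[of 1])
        show "(i, Suc (Suc i)) \<in> ?V"
          if "1 \<le> i" "i < t" "(i, 1) \<in> ?V" "(Suc i, Suc (Suc i)) \<in> ?V" for i
          using keep[of i "Suc (Suc i)"] up[of i] that V by (cases "i = 1") auto
      qed (use V t in \<open>auto simp: H_prev_def numeral_2_eq_2\<close>)
      moreover have "(k, l) \<in> {1, t} \<times> {1, 2}" if kl: "(k, l) \<in> U" "adj ?S (t, 2) (k, l)" for k l
      proof -
        have "l = 1 \<or> l = 2 \<or> l = Suc t" "k = 1 \<or> k = t"
          using kl H_cols(1)[OF t, of k] by (auto simp: H_rows(2))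
        moreover have "(1, Suc t) \<notin> U" using US H_rows(1)[of 1 t "Suc t"] t by auto
        ultimately show ?thesis using kl u by auto
      qed
      moreover have "{1, t} \<times> {1, 2} \<subseteq> ?S" using t by (auto simp: Hset_def)
      ultimately show ?thesis using firm_peel_rectangle[OF u(1) US] by blast
    next
      case v
      obtain s where s: "t = Suc s" "2 \<le> s" using t by (cases t) auto
      let ?V = "{x \<in> U. \<not> adj ?S (t, Suc t) x}"
      have V: "(s, 1) \<notin> ?V" "(s, Suc t) \<notin> ?V" "(t, 1) \<notin> ?V" "(t, Suc t) \<notin> ?V" "(t, 2) \<notin> ?V"
        using v s H_rows(1)[of s t] by (auto simp: H_rows(2) H_cols(2)[OF t, of t])
      have keep: "(k, l) \<in> ?V" if "(k, l) \<in> U" "k \<noteq> s" "k \<noteq> t" for k l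
        using that H_cols(2)[OF t, of t k] s by auto
      have "firm ?S ?V"
      proof (rule cut[of t])
        show "(Suc i, Suc (Suc i)) \<in> ?V"
          if "1 \<le> i" "Suc i < t" "(Suc i, 1) \<in> ?V" "(i, Suc (Suc i)) \<in> ?V" for i
          using keep[of "Suc i" "Suc (Suc i)"] down[of i] that V s by (cases "Suc i = s") auto
      qed (use V s in \<open>auto simp: H_prev_def\<close>)
      moreover have "(k, l) \<in> {s, t} \<times> {1, Suc t}" if kl: "(k, l) \<in> U" "adj ?S (t, Suc t) (k, l)" for k l
      proof -
        have "l = 1 \<or> l = 2 \<or> l = Suc t" "k = s \<or> k = t"
          using kl H_cols(2)[OF t, of t k] s by (auto simp: H_rows(2))
        moreover have "(s, 2) \<notin> U" using US H_rows(1)[of s t 2] s by auto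
        ultimately show ?thesis using kl v by auto
      qed
      moreover have "{s, t} \<times> {1, Suc t} \<subseteq> ?S" using s by (auto simp: Hset_def)
      ultimately show ?thesis using firm_peel_rectangle[OF v(2) US] by blast
    next
      case both
      then have "(t, 2) \<in> Q" "(t, Suc t) \<in> Q" using s2 tR by (auto simp: U H_rows(2))
      then have "Q = Gset t" using Q by (auto simp: Gset_def)
      moreover have "C = {1..Suc t}" if "1 \<in> C"
      proof (rule antisym[OF C], rule)
        fix j assume "j \<in> {1..Suc t}"
        then show "j \<in> C" using full(2)[of "j - 1"] that by (cases "j = 1") auto
      qed
      ultimately have "1 \<notin> C" using proper RE by blast
      \<comment> \<open>Row \<open>t\<close> has no entry left, which is a break before row
        \<open>1\<close>.\<close>
      then show ?thesis using both t by (intro cutU[of 1]) (auto simp: U H_prev_def numeral_2_eq_2)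
    qed
  qed
  then show ?thesis by (simp add: U_def)
qed

text \<open>The hole runs along the rows \<open>1, \<dots>, t - 1\<close> of the cycle matrix and closes up through \<open>(t, 1)\<close>;
  here \<open>t = p + 1\<close>.\<close>

definition H_hole :: "nat \<Rightarrow> (nat \<times> nat) set" where
  "H_hole p = (\<lambda>i. (i, Suc i)) ` {1..p} \<union> (\<lambda>i. (i, Suc (Suc i))) ` {1..p} \<union> {(Suc p, 1)}"

definition H_next :: "nat \<Rightarrow> nat \<times> nat \<Rightarrow> nat \<times> nat" where
  "H_next p x = (if fst x = Suc p then (1, 2) else if snd x = Suc (fst x) then (fst x, Suc (Suc (fst x)))
     else if fst x = p then (Suc p, 1) else (Suc (fst x), Suc (Suc (fst x))))"

lemma H_next_simps:
  "H_next p (Suc p, 1) = (1, 2)"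
  "i \<le> p \<Longrightarrow> H_next p (i, Suc i) = (i, Suc (Suc i))"
  "i < p \<Longrightarrow> H_next p (i, Suc (Suc i)) = (Suc i, Suc (Suc i))"
  "H_next p (p, Suc (Suc p)) = (Suc p, 1)"
  by (simp_all add: H_next_def)

lemma H_hole_cases:
  assumes "x \<in> H_hole p"
  obtains "x = (Suc p, 1)" | i where "x = (i, Suc i)" "1 \<le> i" "i \<le> p"
  | i where "x = (i, Suc (Suc i))" "1 \<le> i" "i < p" | "x = (p, Suc (Suc p))"
proof -
  from assms consider "x = (Suc p, 1)"
    | "x \<in> (\<lambda>i. (i, Suc i)) ` {1..p}" | "x \<in> (\<lambda>i. (i, Suc (Suc i))) ` {1..p}"
    unfolding H_hole_def by blast
  then show thesis
  proof cases
    case 1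
    then show ?thesis using that(1) by blast
  next
    case 2
    then show ?thesis using that(2) by auto
  next
    case 3
    then obtain i where "x = (i, Suc (Suc i))" "1 \<le> i" "i \<le> p" by auto
    then show ?thesis using that(3)[of i] that(4) by (cases "i = p") auto
  qed
qed

lemma H_hole_mem:
  "(Suc p, 1) \<in> H_hole p" "1 \<le> i \<Longrightarrow> i \<le> p \<Longrightarrow> (i, Suc i) \<in> H_hole p"
  "1 \<le> i \<Longrightarrow> i \<le> p \<Longrightarrow> (i, Suc (Suc i)) \<in> H_hole p"
  by (auto simp: H_hole_def)

lemma H_hole_adj:
  assumes "2 \<le> p" "1 \<le> i" "i \<le> p"
  shows "1 \<le> j \<Longrightarrow> j \<le> p \<Longrightarrow> adj (Hset (Suc p)) (i, Suc i) (j, Suc j) \<longleftrightarrow> j = i"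
    "1 \<le> j \<Longrightarrow> j \<le> p \<Longrightarrow> adj (Hset (Suc p)) (i, Suc (Suc i)) (j, Suc (Suc j)) \<longleftrightarrow> j = i"
    "1 \<le> j \<Longrightarrow> j \<le> p \<Longrightarrow> adj (Hset (Suc p)) (i, Suc i) (j, Suc (Suc j)) \<longleftrightarrow> i = j \<or> i = Suc j"
    "adj (Hset (Suc p)) (Suc p, 1) (i, Suc i) \<longleftrightarrow> i = 1"
    "adj (Hset (Suc p)) (Suc p, 1) (i, Suc (Suc i)) \<longleftrightarrow> i = p"
proof -
  have i: "(i, l) \<in> Hset (Suc p) \<longleftrightarrow> l = 1 \<or> l = Suc i \<or> l = Suc (Suc i)" for l
    using H_rows(1)[of i "Suc p" l] assms by simp
  have j: "(j, l) \<in> Hset (Suc p) \<longleftrightarrow> l = 1 \<or> l = Suc j \<or> l = Suc (Suc j)" if "1 \<le> j" "j \<le> p" for l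
    using H_rows(1)[of j "Suc p" l] that by simp
  show "adj (Hset (Suc p)) (i, Suc i) (j, Suc j) \<longleftrightarrow> j = i"
    "adj (Hset (Suc p)) (i, Suc (Suc i)) (j, Suc (Suc j)) \<longleftrightarrow> j = i"
    "adj (Hset (Suc p)) (i, Suc i) (j, Suc (Suc j)) \<longleftrightarrow> i = j \<or> i = Suc j" if "1 \<le> j" "j \<le> p"
    unfolding adj_Pair i j[OF that] using assms that by presburger+
  show "adj (Hset (Suc p)) (Suc p, 1) (i, Suc i) \<longleftrightarrow> i = 1"
    "adj (Hset (Suc p)) (Suc p, 1) (i, Suc (Suc i)) \<longleftrightarrow> i = p"
    unfolding adj_Pair i H_rows(2) using assms by presburger+
qed

lemma not_firm_H_hole:
  assumes p: "2 \<le> p"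
  shows "\<not> firm (Hset (Suc p)) (H_hole p)"
proof (rule not_firm_odd_hole[where g = "H_next p"])
  let ?B = "(\<lambda>i. (i, Suc i)) ` {1..p}" and ?C = "(\<lambda>i. (i, Suc (Suc i))) ` {1..p}"
  \<comment> \<open>The hole has \<open>2 * p + 1\<close> entries. The two edges at
    \<open>(Suc p, 1)\<close> have the entries of \<open>Gset (Suc p)\<close> as corners.\<close>
  have "card (?B \<union> ?C \<union> {(Suc p, 1)}) = card (?B \<union> ?C) + card {(Suc p, 1 :: nat)}"
    by (rule card_Un_disjoint) (use p in auto)
  also have "card (?B \<union> ?C) = card ?B + card ?C"
    by (rule card_Un_disjoint) (use p in auto)
  also have "card ?B = p" by (subst card_image) (auto simp: inj_on_def)
  also have "card ?C = p" by (subst card_image) (auto simp: inj_on_def)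
  finally show "odd (card (H_hole p))" by (simp add: H_hole_def)
  show "H_hole p \<subseteq> Hset (Suc p)" using p by (auto simp: H_hole_def Hset_def)
  show "inj_on (H_next p) (H_hole p)"
  proof (rule inj_onI)
    fix x y assume xy: "x \<in> H_hole p" "y \<in> H_hole p" "H_next p x = H_next p y"
    from xy(1) show "x = y"
      by (cases rule: H_hole_cases; use xy(2) in \<open>cases rule: H_hole_cases\<close>;
          use xy(3) p in \<open>auto simp: H_next_def split: if_splits\<close>)
  qed
  fix x assume x: "x \<in> H_hole p"
  from x show "H_next p x \<in> H_hole p \<and> H_next p x \<noteq> x \<and> adj (Hset (Suc p)) x (H_next p x) \<and>
      H_next p (H_next p (H_next p x)) \<noteq> x"
  proof (cases rule: H_hole_cases)
    case 1
    then show ?thesis using p H_hole_mem(2)[of 1 p] H_rows(1)[of 1 "Suc p"]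
      by (auto simp: H_next_def H_rows(2) numeral_2_eq_2)
  qed (use p H_hole_mem(1)[of p] in \<open>auto simp: H_next_def H_hole_mem Hset_def split: if_splits\<close>)
  fix y assume y: "y \<in> H_hole p" "adj (Hset (Suc p)) x y"
  from x show "x = y \<or> y = H_next p x \<or> x = H_next p y"
    by (cases rule: H_hole_cases; use y(1) in \<open>cases rule: H_hole_cases\<close>;
        use y(2) adj_sym[OF y(2)] p in \<open>auto simp: H_next_simps H_hole_adj numeral_2_eq_2
          simp del: One_nat_def adj_Pair\<close>)
qed

text \<open>Every row meets column \<open>1\<close>, so \<open>(i, 1)\<close> is adjacent to all
  neighbours of \<open>(i, Suc i)\<close>. Dropping these dominating entries of the rows up to
  \<open>p\<close> leaves the hole.\<close>

lemma not_firm_H: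
  assumes p: "2 \<le> p"
  shows "\<not> firm (Hset (Suc p)) (Hset (Suc p) - Gset (Suc p))"
proof
  let ?U = "Hset (Suc p) - Gset (Suc p)" and ?V = "(\<lambda>i. (i, 1 :: nat)) ` {1..p}"
  have eq: "?U - ?V = H_hole p"
  proof -
    have "(i, j) \<in> ?U - ?V \<longleftrightarrow> (i, j) \<in> H_hole p" for i j
    proof -
      consider "i = 0" | "1 \<le> i" "i \<le> p" | "i = Suc p" | "Suc p < i" by linarith
      then show ?thesis by cases (use p in \<open>auto simp: Hset_def H_hole_def Gset_def\<close>)
    qed
    then show ?thesis by (intro set_eqI) (metis surj_pair)
  qed
  assume "firm (Hset (Suc p)) ?U"
  then have "firm (Hset (Suc p)) (?U - ?V)"
  proof (rule firm_remove_dominated[where h = "\<lambda>v. (fst v, Suc (fst v))"])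
    show "?V \<subseteq> ?U" using p by (auto simp: Hset_def Gset_def)
    fix v assume v: "v \<in> ?V"
    then obtain i where i: "v = (i, 1)" "1 \<le> i" "i \<le> p" by auto
    show "(fst v, Suc (fst v)) \<in> ?U - ?V" unfolding eq using i by (simp add: H_hole_mem)
    fix x assume x: "x \<in> ?U" "adj (Hset (Suc p)) (fst v, Suc (fst v)) x"
    obtain k l where kl: "x = (k, l)" by force
    have "(k, 1) \<in> Hset (Suc p)" using x(1) H_entry[of "Suc p" k l] p by (auto simp: kl Hset_def)
    then show "adj (Hset (Suc p)) v x" using x(2) i by (auto simp: kl)
  qed (auto simp: Hset_def)
  then show False using not_firm_H_hole[OF p] unfolding eq by blast
qed

lemma minimally_non_firm_H:
  assumes t: "3 \<le> t"
  shows "minimally_non_firm (stretch (Gset t) (Hmat t))"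
proof (rule minimally_non_firm_stretchI; unfold supp_Hmat[OF t])
  obtain p where p: "t = Suc p" "2 \<le> p" using t by (cases t) auto
  show "Gset t \<subseteq> Hset t" by (auto simp: Gset_def H_rows)
  show "\<not> firm (Hset t) (Hset t - Gset t)" using not_firm_H[OF p(2)] by (simp add: p)
  show "firm (Hset t) (Hset t \<inter> R \<times> C - Q')"
    if "R \<subseteq> {1..t}" "C \<subseteq> {1..Suc t}" "Q' \<subseteq> Gset t" "R \<noteq> {1..t} \<or> C \<noteq> {1..Suc t} \<or> Q' \<noteq> Gset t" for R C Q'
    by (rule firm_H_submatrix[OF t that(3,4,1,2)])
qed

section \<open>The matrices D\<close>

text \<open>\<open>Dmat n\<close> is the leading \<open>n \<times> n\<close> block of this infinite matrix, so adjacency does not depend on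
  \<open>n\<close>.\<close>

definition Dinf :: "(nat \<times> nat) set" where
  "Dinf = {(i, j). i = 1 \<and> (j = 2 \<or> j = 3) \<or> i = 2 \<and> (j = 1 \<or> j = 2 \<or> j = 3) \<or> i = 3 \<and> 1 \<le> j \<or>
     4 \<le> i \<and> (i = j \<or> i = Suc j)}"

lemma Dinf_iff: "(i, j) \<in> Dinf \<longleftrightarrow> i = 1 \<and> (j = 2 \<or> j = 3) \<or> i = 2 \<and> (j = 1 \<or> j = 2 \<or> j = 3) \<or>
    i = 3 \<and> 1 \<le> j \<or> 4 \<le> i \<and> (i = j \<or> i = Suc j)"
  by (simp add: Dinf_def)

lemma supp_Dmat:
  assumes "4 \<le> n"
  shows "supp (Dmat n) = Dinf \<inter> {1..n} \<times> {1..n}"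
  using assms by (auto simp: supp_def Dmat_def nrows_def ncols_def Dinf_def)

interpretation D: fan Dinf 3
  by unfold_locales (auto simp: Dinf_def)

text \<open>Only column \<open>3\<close> ties the head to the chain, through \<open>(4, 3)\<close>;
  by the last assumption this entry is absent whenever it could interfere. Then
  \<open>(1, 2)\<close>, \<open>(1, 3)\<close> and the entries of row \<open>2\<close> become
  simplicial in this order.\<close>

lemma D_head_reduction:
  assumes "U \<subseteq> Dinf" "\<exists>x\<in>U. fst x < 3" "(Suc 3, 3) \<notin> U \<or> (\<forall>i<3. (i, 3) \<notin> U)"
  shows "\<exists>V\<subset>U. (\<forall>x\<in>U - V. fst x \<le> 3) \<and> (firm Dinf V \<longrightarrow> firm Dinf U)"
proof -
  have gap: "(4, 3) \<notin> U" if "(1, 3) \<in> U \<or> (2, 3) \<in> U" using assms(3) that by (auto simp: numeral_eq_Suc)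
  note rect = D.reduction_rectangle[OF _ assms(1)]
  show ?thesis
  proof (cases "(1, 2) \<in> U")
    case True
    show ?thesis
      by (rule rect[OF True, of "{1, 2, 3}" "{2, 3}"]) (auto simp: Dinf_iff)
  next
    case a: False
    show ?thesis
    proof (cases "(1, 3) \<in> U")
      case True
      have "(k, l) \<in> {1, 2, 3} \<times> {2, 3}" if "(k, l) \<in> U" "adj Dinf (1, 3) (k, l)" for k l
        using that gap True assms(1) by (auto simp: Dinf_iff)
      from True this show ?thesis by (rule rect) (auto simp: Dinf_iff)
    next
      case b: False
      then obtain j where j: "(2, j) \<in> U"
        using a assms(1,2) by (force simp: Dinf_iff numeral_eq_Suc less_Suc_eq)
      have "(k, l) \<in> {2, 3} \<times> {1, 2, 3}" if kl: "(k, l) \<in> U" "adj Dinf (2, j) (k, l)" for k l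
      proof -
        have "(2, j) \<in> Dinf" "(k, l) \<in> Dinf" "(2, l) \<in> Dinf" "(k, j) \<in> Dinf" using kl j assms(1) by auto
        then have "l = 1 \<or> l = 2 \<or> l = 3" "k = 2 \<or> k = 3 \<or> k = 1 \<and> (l = 2 \<or> l = 3) \<or> k = 4 \<and> l = 3 \<and> j = 3"
          by (auto simp: Dinf_iff)
        then show ?thesis using kl(1) a b gap j by auto
      qed
      from j this show ?thesis by (rule rect) (auto simp: Dinf_iff)
    qed
  qed
qed

lemma firm_D_cut: "finite U \<Longrightarrow> D.cut b U \<Longrightarrow> firm Dinf U"
  by (rule D.firm_cut) (use D_head_reduction in blast)+

text \<open>A missing \<open>(Suc b, b)\<close> is a break in the chain, and so is its end unless
  \<open>(n, n)\<close> alone was taken out there. What remains is a complete chain without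
  \<open>(n, n)\<close>; then the head must be incomplete, and clearing its part of column
  \<open>3\<close> yields a cut at \<open>3\<close>.\<close>

lemma firm_D_submatrix:
  assumes n: "4 \<le> n" and R: "R \<subseteq> {1..n}" and C: "C \<subseteq> {1..n}" and Q: "Q \<subseteq> Qset n"
    and proper: "R \<noteq> {1..n} \<or> C \<noteq> {1..n} \<or> Q \<noteq> Qset n"
  shows "firm Dinf (Dinf \<inter> R \<times> C - Q)"
proof -
  define U where "U = Dinf \<inter> R \<times> C - Q"
  have U: "(i, j) \<in> U \<longleftrightarrow> (i, j) \<in> Dinf \<and> i \<in> R \<and> j \<in> C \<and> (i, j) \<notin> Q" for i j
    by (auto simp: U_def)
  have Qn: "(i, j) \<in> Q \<Longrightarrow> i = 1 \<and> j = 2 \<or> i = 2 \<and> j = 1 \<or> i = n \<and> j = n" for i j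
    using Q by (auto simp: Qset_def)
  have le: "i \<le> n \<and> j \<le> n" if "(i, j) \<in> U" for i j using that R C by (auto simp: U)
  have US: "U \<subseteq> Dinf" by (auto simp: U_def)
  have fin: "finite U" by (rule finite_subset[of _ "{1..n} \<times> {1..n}"]) (use R C in \<open>auto simp: U_def\<close>)
  have up: "(Suc i, i) \<in> U" if "3 \<le> i" "(Suc i, Suc i) \<in> U" "(3, i) \<in> U" for i
    using that Qn[of "Suc i" i] by (auto simp: U Dinf_iff)
  have down: "(Suc i, Suc i) \<in> U" if "3 \<le> i" "(Suc i, i) \<in> U" "(3, Suc i) \<in> U" "Suc i \<noteq> n \<or> (n, n) \<notin> Q" for i
  proof -
    have "Suc i \<in> R" "Suc i \<in> C" using that(2,3) by (auto simp: U)
    moreover have "(Suc i, Suc i) \<notin> Q"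
    proof
      assume "(Suc i, Suc i) \<in> Q"
      moreover from Qn[OF this] have "Suc i = n" using that(1) by linarith
      ultimately show False using that(4) by simp
    qed
    moreover have "(Suc i, Suc i) \<in> Dinf" using that(1) by (simp add: Dinf_iff)
    ultimately show ?thesis by (simp add: U)
  qed
  consider (tail) "(n, n) \<in> U \<or> n \<notin> R \<or> n \<notin> C \<or> 3 \<notin> R"
    | (mid) b where "3 \<le> b" "b < n" "(Suc b, b) \<notin> U"
    | (full) "(n, n) \<notin> U" "n \<in> R" "n \<in> C" "3 \<in> R" "\<And>b. 3 \<le> b \<Longrightarrow> b < n \<Longrightarrow> (Suc b, b) \<in> U"
    by blast
  then have "firm Dinf U"
  proof cases
    case tail
    \<comment> \<open>Row \<open>Suc n\<close> is empty, so the break is at the end of the chain. In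
      the implication for row \<open>n\<close>, either \<open>(n, n)\<close> is present or a line
      needed by its premises is missing.\<close>
    have "D.cut n U"
      unfolding D.cut_def
    proof (intro conjI allI impI)
      show "(Suc i, Suc i) \<in> U" if "3 \<le> i" "(Suc i, i) \<in> U" "(3, Suc i) \<in> U" for i
      proof (cases "Suc i = n")
        case True
        then have "n \<in> R" "n \<in> C" "3 \<in> R" using that by (auto simp: U)
        then show ?thesis using tail True by auto
      next
        case False then show ?thesis using down[OF that] by blast
      qed
    qed (use n US le up in force)+
    then show ?thesis by (rule firm_D_cut[OF fin])
  next
    case mid
    have "D.cut b U"
      unfolding D.cut_def using mid US up down by auto
    then show ?thesis by (rule firm_D_cut[OF fin])
  next
    case full
    have rows: "i \<in> R" if "4 \<le> i" "i \<le> n" for i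
      using full(5)[of "i - 1"] that by (auto simp: U)
    have cols: "i \<in> C" if "3 \<le> i" "i \<le> n" for i
      using full(5)[of i] full(3) that by (cases "i = n") (auto simp: U)
    have cut3: "D.cut 3 V" if "V \<subseteq> U" "(1, 3) \<notin> V" "(2, 3) \<notin> V"
      "\<And>i. 3 \<le> i \<Longrightarrow> (Suc i, Suc i) \<in> V \<Longrightarrow> (3, i) \<in> V \<Longrightarrow> (Suc i, i) \<in> V" for V
    proof -
      have "(i, 3) \<notin> V" if "i < 3" for i
      proof
        assume i: "(i, 3) \<in> V"
        then have "(i, 3) \<in> Dinf" using \<open>V \<subseteq> U\<close> US by blast
        then have "i = 1 \<or> i = 2" using that by (simp add: Dinf_iff)
        then show False using i \<open>(1, 3) \<notin> V\<close> \<open>(2, 3) \<notin> V\<close> by blast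
      qed
      then show ?thesis unfolding D.cut_def using that US by auto
    qed
    have firm3: "firm Dinf V" if "V \<subseteq> U" "(1, 3) \<notin> V" "(2, 3) \<notin> V"
      "\<And>i. 3 \<le> i \<Longrightarrow> (Suc i, Suc i) \<in> V \<Longrightarrow> (3, i) \<in> V \<Longrightarrow> (Suc i, i) \<in> V" for V
      by (rule firm_D_cut[OF finite_subset[OF that(1) fin] cut3[OF that]])
    show ?thesis
    proof (cases "(1, 2) \<in> U")
      case True
      show ?thesis
      proof (rule firm_peel_rectangle[OF True US, of "{1, 2, 3}" "{2, 3}"])
        show "firm Dinf {x \<in> U. \<not> adj Dinf (1, 2) x}"
          by (rule firm3) (auto simp: Dinf_iff intro: up)
      qed (auto simp: Dinf_iff)
    next
      case a: False
      show ?thesis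
      proof (cases "(2, 1) \<in> U")
        case c: True
        let ?V = "{x \<in> U. \<not> adj Dinf (2, 1) x}"
        have "firm Dinf ?V"
        proof (cases "(1, 3) \<in> ?V")
          case True
          \<comment> \<open>Peeling \<open>(2, 1)\<close> took rows \<open>2\<close> and
            \<open>3\<close> out of columns \<open>1\<close> to \<open>3\<close>, so only column
            \<open>3\<close> can hold neighbours of \<open>(1, 3)\<close>.\<close>
          have N: "(k, l) \<in> {1, 4} \<times> {3}" if "(k, l) \<in> ?V" "adj Dinf (1, 3) (k, l)" for k l
            using that US a by (auto simp: Dinf_iff)
          show ?thesis
          proof (rule firm_peel_rectangle[OF True _ N])
            show "firm Dinf {x \<in> ?V. \<not> adj Dinf (1, 3) x}"
              by (rule firm3) (auto simp: Dinf_iff intro: up)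
          qed (use US in \<open>auto simp: Dinf_iff\<close>)
        next
          case False
          show ?thesis
            by (rule firm3) (use False in \<open>auto simp: Dinf_iff intro: up\<close>)
        qed
        then show ?thesis
          by (intro firm_peel_rectangle[OF c US, of "{2, 3}" "{1, 2, 3}"]) (auto simp: Dinf_iff)
      next
        case c: False
        show ?thesis
        proof (cases "(2, 2) \<in> U")
          case True
          then have "2 \<in> R" "2 \<in> C" by (auto simp: U)
          have V: "firm Dinf {x \<in> U. \<not> adj Dinf (2, 2) x}"
            by (rule firm3) (auto simp: Dinf_iff intro: up)
          \<comment> \<open>All other lines are known to be kept. With row and column
            \<open>1\<close> as well, all three entries of \<open>Qset n\<close> would have been
            removed, against \<open>proper\<close>.\<close>
          have "1 \<notin> R \<or> 1 \<notin> C"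
          proof (rule ccontr)
            assume "\<not> ?thesis"
            then have RC1: "1 \<in> R" "1 \<in> C" by auto
            have *: "i = 1 \<or> i = 2 \<or> i = 3 \<or> 4 \<le> i" if "1 \<le> i" for i :: nat using that by linarith
            have "i \<in> R" if "1 \<le> i" "i \<le> n" for i
              using *[OF that(1)] rows[of i] RC1 \<open>2 \<in> R\<close> full(4) that(2) by (elim disjE) simp_all
            then have "R = {1..n}" using R by auto
            moreover have "i \<in> C" if "1 \<le> i" "i \<le> n" for i
              using *[OF that(1)] cols[of i] RC1 \<open>2 \<in> C\<close> that(2) by (elim disjE) simp_all
            then have "C = {1..n}" using C by auto
            moreover have "Q = Qset n"
              using Q a c full(1) RC1 \<open>2 \<in> R\<close> \<open>2 \<in> C\<close> full(2,3) n by (auto simp: Qset_def U Dinf_iff)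
            ultimately show False using proper by blast
          qed
          then consider (row) "1 \<notin> R" | (col) "1 \<notin> C" by blast
          then show ?thesis
          proof cases
            case row
            have N: "(k, l) \<in> {2, 3} \<times> {1, 2, 3}" if "(k, l) \<in> U" "adj Dinf (2, 2) (k, l)" for k l
              using that row by (auto simp: Dinf_iff U)
            show ?thesis using V by (intro firm_peel_rectangle[OF True US N]) (auto simp: Dinf_iff)
          next
            case col
            have N: "(k, l) \<in> {1, 2, 3} \<times> {2, 3}" if "(k, l) \<in> U" "adj Dinf (2, 2) (k, l)" for k l
              using that col by (auto simp: Dinf_iff U)
            show ?thesis using V by (intro firm_peel_rectangle[OF True US N]) (auto simp: Dinf_iff)
          qed
        next
          case d: False
          show ?thesis
          proof (cases "(1, 3) \<in> U \<or> (2, 3) \<in> U")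
            case True
            then obtain h where h: "(h, 3) \<in> U" "h < 3" by force
            \<comment> \<open>\<open>(h, 3)\<close> represents column \<open>3\<close>; outside
              columns \<open>3\<close> to \<open>n - 1\<close> only row \<open>3\<close> still has
              entries.\<close>
            show ?thesis
            proof (rule D.firm_columns[of n U h "{}"])
              show "(j, j) \<in> U - {}" if "3 < j" "j < n" for j
                using that rows[of j] cols[of j] Qn[of j j] by (auto simp: U Dinf_iff)
              show "(3, n) \<in> U - {}"
                using full n Qn[of 3 n] by (auto simp: U Dinf_iff)
              show "i = 3" if "(i, j) \<in> U - {}" "j < 3 \<or> n \<le> j" for i j
              proof -
                have "(i, j) \<in> U" "(i, j) \<in> Dinf" "i \<le> n" "j \<le> n" using that(1) US le by auto
                then have "i = 3 \<or> (i, j) = (1, 2) \<or> (i, j) = (2, 1) \<or> (i, j) = (2, 2) \<or> (i, j) = (n, n)"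
                  using that(2) n unfolding Dinf_iff prod.inject by linarith
                then show ?thesis using \<open>(i, j) \<in> U\<close> a c d full(1) by auto
              qed
            qed (use h n US in auto)
          next
            case False
            show ?thesis
              by (rule firm3) (use False in \<open>auto intro: up\<close>)
          qed
        qed
      qed
    qed
  qed
  then show ?thesis by (simp add: U_def)
qed

text \<open>In cyclic order: \<open>(3,1), (2,2), (1,3), (4,3), (4,4), (5,4), ..., (n, n - 1),
  (3,n)\<close>. The edges from \<open>(3,1)\<close> to \<open>(2,2)\<close>, from
  \<open>(2,2)\<close> to \<open>(1,3)\<close> and from \<open>(n, n - 1)\<close> to
  \<open>(3,n)\<close> have the corners \<open>(2,1)\<close>, \<open>(1,2)\<close> and
  \<open>(n,n)\<close>, which are the entries of \<open>Qset n\<close>.\<close>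

definition D_hole :: "nat \<Rightarrow> (nat \<times> nat) set" where
  "D_hole n = {(3, 1), (2, 2), (1, 3), (3, n)} \<union> (\<lambda>i. (Suc i, i)) ` {3..<n} \<union> (\<lambda>i. (i, i)) ` {4..<n}"

lemma D_rows:
  "(1, l) \<in> Dinf \<longleftrightarrow> l = 2 \<or> l = 3" "(2, l) \<in> Dinf \<longleftrightarrow> l = 1 \<or> l = 2 \<or> l = 3"
  "(3, l) \<in> Dinf \<longleftrightarrow> 1 \<le> l" "4 \<le> i \<Longrightarrow> (i, l) \<in> Dinf \<longleftrightarrow> l = i \<or> Suc l = i"
  by (auto simp: Dinf_iff)

lemma D_hole_iff: "(i, j) \<in> D_hole n \<longleftrightarrow> i = 3 \<and> (j = 1 \<or> j = n) \<or> i = 2 \<and> j = 2 \<or> i = 1 \<and> j = 3 \<or>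
    i = Suc j \<and> 3 \<le> j \<and> j < n \<or> i = j \<and> 4 \<le> j \<and> j < n"
  by (auto simp: D_hole_def)

definition D_next :: "nat \<Rightarrow> nat \<times> nat \<Rightarrow> nat \<times> nat" where
  "D_next n x = (if fst x = 3 then if snd x = 1 then (2, 2) else (3, 1) else if fst x = 2 then (1, 3)
    else if fst x = 1 then (4, 3) else if fst x = snd x then (Suc (snd x), snd x)
    else if fst x = n then (3, n) else (fst x, fst x))"

lemma D_next_simps:
  "D_next n (3, 1) = (2, 2)" "D_next n (2, 2) = (1, 3)" "D_next n (1, 3) = (4, 3)"
  "3 \<le> m \<Longrightarrow> D_next (Suc m) (3, Suc m) = (3, 1)"
  "3 \<le> j \<Longrightarrow> j < m \<Longrightarrow> D_next (Suc m) (Suc j, j) = (Suc j, Suc j)"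
  "3 \<le> m \<Longrightarrow> D_next (Suc m) (Suc m, m) = (3, Suc m)"
  "4 \<le> j \<Longrightarrow> D_next n (j, j) = (Suc j, j)"
  by (simp_all add: D_next_def)

lemma D_hole_cases:
  assumes "x \<in> D_hole (Suc m)"
  obtains "x = (3, 1)" | "x = (2, 2)" | "x = (1, 3)" | "x = (3, Suc m)"
  | j where "x = (Suc j, j)" "3 \<le> j" "j < m" | "x = (Suc m, m)"
  | j where "x = (j, j)" "4 \<le> j" "j \<le> m"
  using assms unfolding D_hole_def by force

lemma not_firm_D_hole:
  assumes m: "3 \<le> m"
  shows "\<not> firm Dinf (D_hole (Suc m))"
proof (rule not_firm_odd_hole[where g = "D_next (Suc m)"])
  let ?A = "{(3, 1), (2, 2), (1, 3), (3, Suc m)} :: (nat \<times> nat) set"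
  let ?B = "(\<lambda>i. (Suc i, i)) ` {3..<Suc m}" and ?C = "(\<lambda>i. (i, i)) ` {4..<Suc m}"
  have "card (?A \<union> ?B \<union> ?C) = card (?A \<union> ?B) + card ?C"
    by (rule card_Un_disjoint) (use m in auto)
  also have "card (?A \<union> ?B) = card ?A + card ?B"
    by (rule card_Un_disjoint) (use m in auto)
  also have "card ?A = 4" using m by auto
  also have "card ?B = m - 2" by (subst card_image) (auto simp: inj_on_def)
  also have "card ?C = m - 3" by (subst card_image) (auto simp: inj_on_def)
  finally have "card (D_hole (Suc m)) = 4 + (m - 2) + (m - 3)" by (simp add: D_hole_def)
  then have "card (D_hole (Suc m)) = 2 * (m - 3) + 5" using m by simp
  then show "odd (card (D_hole (Suc m)))" by simp
  show "D_hole (Suc m) \<subseteq> Dinf" using m by (auto simp: D_hole_def Dinf_iff)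
  show "inj_on (D_next (Suc m)) (D_hole (Suc m))"
  proof (rule inj_onI)
    fix x y assume xy: "x \<in> D_hole (Suc m)" "y \<in> D_hole (Suc m)" "D_next (Suc m) x = D_next (Suc m) y"
    from xy(1) show "x = y"
      by (cases rule: D_hole_cases; use xy(2) in \<open>cases rule: D_hole_cases\<close>;
          use xy(3) m in \<open>simp add: D_next_simps del: One_nat_def\<close>)
  qed
  fix x assume x: "x \<in> D_hole (Suc m)"
  from x show "D_next (Suc m) x \<in> D_hole (Suc m) \<and> D_next (Suc m) x \<noteq> x \<and> adj Dinf x (D_next (Suc m) x) \<and>
      D_next (Suc m) (D_next (Suc m) (D_next (Suc m) x)) \<noteq> x"
    by (cases rule: D_hole_cases; use m in
      \<open>auto simp: D_next_simps D_hole_iff D_rows simp del: One_nat_def\<close>)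
      (auto simp: D_next_def split: if_splits)
  fix y assume y: "y \<in> D_hole (Suc m)" "adj Dinf x y"
  from x show "x = y \<or> y = D_next (Suc m) x \<or> x = D_next (Suc m) y"
    by (cases rule: D_hole_cases; use y(1) in \<open>cases rule: D_hole_cases\<close>;
        use y(2) m in \<open>auto simp: D_next_simps D.chain_adj D.spine_adj D.head_adj D_rows
          simp del: One_nat_def adj_Pair\<close>)
      (auto simp: D_rows simp del: One_nat_def)
qed

lemma not_firm_D:
  assumes n: "4 \<le> n"
  shows "\<not> firm Dinf (Dinf \<inter> {1..n} \<times> {1..n} - Qset n)"
proof
  let ?U = "Dinf \<inter> {1..n} \<times> {1..n} - Qset n"
  \<comment> \<open>The entries off the hole are \<open>(2,3)\<close>, \<open>(3,3)\<close>,
    \<open>(3,2)\<close> and \<open>(3,j)\<close> with \<open>4 \<le> j < n\<close>; each is sent to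
    a hole entry that it dominates. For \<open>(3,j)\<close> this works because row \<open>3\<close>
    is full.\<close>
  define h where "h x = (if x = (2, 3) \<or> x = (3, 3) then (1, 3) else if x = (3, 2) then (3, 1)
    else (snd x, snd x))" for x :: "nat \<times> nat"
  assume "firm Dinf ?U"
  then have "firm Dinf (?U - (?U - D_hole n))"
  proof (rule firm_remove_dominated[where h = h])
    fix v assume v: "v \<in> ?U - D_hole n"
    obtain i j where ij: "v = (i, j)" by force
    have "(i, j) \<in> Dinf" "i \<le> n" "j \<le> n" "\<not> (i = 1 \<and> j = 2)" "\<not> (i = 2 \<and> j = 1)" "\<not> (i = n \<and> j = n)"
      "(i, j) \<notin> D_hole n" using v by (auto simp: ij Qset_def)
    then have *: "i = 2 \<and> j = 3 \<or> i = 3 \<and> j = 2 \<or> i = 3 \<and> j = 3 \<or> i = 3 \<and> 4 \<le> j \<and> j < n"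
      unfolding Dinf_iff D_hole_iff by presburger
    then show "h v \<in> ?U - (?U - D_hole n)"
      using n by (auto simp: h_def ij D_hole_iff Dinf_iff Qset_def)
    show "adj Dinf v x" if x: "x \<in> ?U" "adj Dinf (h v) x" for x
    proof -
      obtain k l where kl: "x = (k, l)" by force
      have U: "(k, l) \<in> Dinf" "\<not> (k = 1 \<and> l = 2)" "\<not> (k = 2 \<and> l = 1)" using x(1) by (auto simp: kl Qset_def)
      have "h v = (1, 3) \<and> (i = 2 \<or> i = 3) \<and> j = 3 \<or> h v = (3, 1) \<and> i = 3 \<and> j = 2 \<or>
          h v = (j, j) \<and> i = 3 \<and> 4 \<le> j"
        using * by (auto simp: h_def ij)
      then show ?thesis
      proof (elim disjE[where P = "_ \<and> _"] conjE)
        assume "h v = (1, 3)" "i = 2 \<or> i = 3" "j = 3"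
        then show ?thesis using x(2) by (auto simp: kl ij D_rows simp del: One_nat_def)
      next
        assume hv: "h v = (3, 1)" "i = 3" "j = 2"
        then have "k = 2 \<or> k = 3" using x(2) by (auto simp: kl Dinf_iff)
        then show ?thesis using hv x(2) by (auto simp: kl ij D_rows simp del: One_nat_def)
      next
        assume "h v = (j, j)" "i = 3" "4 \<le> j"
        then show ?thesis using x(2) by (auto simp: kl ij D_rows simp del: One_nat_def)
      qed
    qed
  qed auto
  moreover have "D_hole n \<subseteq> ?U"
    using n by (auto simp: D_hole_def Dinf_iff Qset_def)
  then have "?U - (?U - D_hole n) = D_hole n" by blast
  moreover obtain m where "n = Suc m" "3 \<le> m" using n by (cases n) auto
  ultimately show False using not_firm_D_hole[of m] by simp
qed

lemma nrows_Dmat: "nrows (Dmat n) = n" and ncols_Dmat: "ncols (Dmat n) = n"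
  by (simp_all add: Dmat_def nrows_def ncols_def)

lemma minimally_non_firm_D:
  assumes n: "4 \<le> n"
  shows "minimally_non_firm (stretch (Qset n) (Dmat n))"
proof (rule minimally_non_firm_stretchI; (unfold nrows_Dmat ncols_Dmat)?)
  note S = supp_Dmat[OF n]
  \<comment> \<open>Switches the ambient matrix between \<open>supp (Dmat n)\<close> and
    \<open>Dinf\<close>.\<close>
  note tr = firm_restrict[of _ Dinf "{1..n}" "{1..n}", folded S]
  show "Qset n \<subseteq> supp (Dmat n)" using n by (auto simp: S Qset_def Dinf_iff)
  show "\<not> firm (supp (Dmat n)) (supp (Dmat n) - Qset n)"
    using not_firm_D[OF n] tr[of "supp (Dmat n) - Qset n"] unfolding S by blast
  fix R C Q' assume *: "R \<subseteq> {1..n}" "C \<subseteq> {1..n}" "Q' \<subseteq> Qset n"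
    "R \<noteq> {1..n} \<or> C \<noteq> {1..n} \<or> Q' \<noteq> Qset n"
  have "supp (Dmat n) \<inter> R \<times> C - Q' = Dinf \<inter> R \<times> C - Q'" using * unfolding S by blast
  then show "firm (supp (Dmat n)) (supp (Dmat n) \<inter> R \<times> C - Q')"
    using firm_D_submatrix[OF n *] tr[of "supp (Dmat n) \<inter> R \<times> C - Q'"] by auto
qed

lemma totally_balanced_D:
  assumes n: "4 \<le> n"
  shows "totally_balanced (stretch (Qset n) (Dmat n))"
proof (rule totally_balanced_stretch)
  show "Qset n \<subseteq> supp (Dmat n)" using n by (auto simp: supp_Dmat Qset_def Dinf_iff)
  \<comment> \<open>Row \<open>3\<close> is full, so putting it last satisfies the exchange
    condition there. It gets the value \<open>2 * n + 1\<close>; the rows beyond \<open>n\<close>,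
    which carry no entries, are shifted past it to keep the map injective.\<close>
  show "totally_balanced (Dmat n)"
  proof (rule totally_balanced_exchangeI[of "\<lambda>i. if i = 3 then Suc n + n else if i \<le> n then i else i + n + 5" id])
    show "inj (\<lambda>i. if i = 3 then Suc n + n else if i \<le> n then i else i + n + 5)"
      by (rule injI) (auto split: if_splits)
    fix i k j l :: nat
    let ?\<rho> = "\<lambda>i. if i = 3 then Suc n + n else if i \<le> n then i else i + n + 5"
    assume a: "?\<rho> i < ?\<rho> k" "id j < id l" "(i, j) \<in> supp (Dmat n)" "(i, l) \<in> supp (Dmat n)" "(k, j) \<in> supp (Dmat n)"
    then have D: "(i, j) \<in> Dinf" "(i, l) \<in> Dinf" "(k, j) \<in> Dinf" "i \<le> n" "k \<le> n" "l \<le> n" "1 \<le> k" "1 \<le> l"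
      by (auto simp: supp_Dmat[OF n])
    have jl: "j < l" using a(2) by simp
    have "k = 3 \<or> i \<noteq> 3 \<and> i < k" using a(1) D(4,5) by (auto split: if_splits)
    then have "(k, l) \<in> Dinf"
    proof
      assume "k = 3"
      then show ?thesis using D(8) by (simp add: Dinf_iff)
    next
      assume ik: "i \<noteq> 3 \<and> i < k"
      have "i = 1 \<or> i = 2 \<or> 4 \<le> i" using D(1) ik unfolding Dinf_iff by linarith
      then show ?thesis
      proof (elim disjE)
        assume "i = 1"
        then have "j = 2" "l = 3" using D(1,2) jl by (auto simp: Dinf_iff)
        then show ?thesis using D(3) by (auto simp: Dinf_iff)
      next
        assume i: "i = 2"
        then have "j = 1 \<or> j = 2" "l = 1 \<or> l = 2 \<or> l = 3" using D(1,2) jl by (auto simp: Dinf_iff)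
        then show ?thesis using D(3) ik i by (auto simp: Dinf_iff)
      next
        assume "4 \<le> i"
        then have "i = Suc j" using D(1,2) jl by (auto simp: Dinf_iff)
        then show ?thesis using D(3) ik \<open>4 \<le> i\<close> by (auto simp: Dinf_iff)
      qed
    qed
    then show "(k, l) \<in> supp (Dmat n)" using D by (simp add: supp_Dmat[OF n])
  qed simp
qed

section \<open>The matrices T\<close>

definition Tinf :: "(nat \<times> nat) set" where
  "Tinf = {(i, j). i = 1 \<and> (j = 2 \<or> j = 4) \<or> i = 2 \<and> (j = 1 \<or> j = 3) \<or>
     i = 3 \<and> (j = 2 \<or> j = 3 \<or> j = 4) \<or> i = 4 \<and> (j = 1 \<or> 3 \<le> j) \<or> 5 \<le> i \<and> (i = j \<or> i = Suc j)}"

lemma Tinf_iff: "(i, j) \<in> Tinf \<longleftrightarrow> i = 1 \<and> (j = 2 \<or> j = 4) \<or> i = 2 \<and> (j = 1 \<or> j = 3) \<or>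
     i = 3 \<and> (j = 2 \<or> j = 3 \<or> j = 4) \<or> i = 4 \<and> (j = 1 \<or> 3 \<le> j) \<or> 5 \<le> i \<and> (i = j \<or> i = Suc j)"
  by (simp add: Tinf_def)

lemma supp_Tmat:
  assumes "5 \<le> n"
  shows "supp (Tmat n) = Tinf \<inter> {1..n} \<times> {1..n}"
proof -
  have *: "(i, j) \<in> supp (Tmat n) \<longleftrightarrow> (i, j) \<in> Tinf \<inter> {1..n} \<times> {1..n}" for i j
  proof -
    consider "i = 0" | "i = 1" | "i = 2" | "i = 3" | "i = 4" | "5 \<le> i" by linarith
    then show ?thesis
      by cases (use assms in \<open>auto simp: supp_def Tmat_def nrows_def ncols_def Tinf_iff\<close>)
  qed
  then show ?thesis by (intro set_eqI) (metis surj_pair)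
qed

lemma T_rows:
  "(1, l) \<in> Tinf \<longleftrightarrow> l = 2 \<or> l = 4" "(2, l) \<in> Tinf \<longleftrightarrow> l = 1 \<or> l = 3"
  "(3, l) \<in> Tinf \<longleftrightarrow> l = 2 \<or> l = 3 \<or> l = 4" "(4, l) \<in> Tinf \<longleftrightarrow> l = 1 \<or> 3 \<le> l"
  "5 \<le> i \<Longrightarrow> (i, l) \<in> Tinf \<longleftrightarrow> l = i \<or> Suc l = i"
  by (auto simp: Tinf_iff)

lemma T_cols:
  "(k, 1) \<in> Tinf \<longleftrightarrow> k = 2 \<or> k = 4" "(k, 2) \<in> Tinf \<longleftrightarrow> k = 1 \<or> k = 3"
  "(k, 3) \<in> Tinf \<longleftrightarrow> k = 2 \<or> k = 3 \<or> k = 4" "(k, 4) \<in> Tinf \<longleftrightarrow> k = 1 \<or> k = 3 \<or> k = 4 \<or> k = 5"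
  by (auto simp: Tinf_iff)

interpretation T: fan Tinf 4
  by unfold_locales (auto simp: Tinf_iff)

lemma T_head_cases:
  assumes "x \<in> Tinf" "fst x < 4"
  shows "x \<in> {(1, 2), (1, 4), (2, 1), (2, 3), (3, 2), (3, 3), (3, 4)}"
proof -
  obtain i j where x: "x = (i, j)" by force
  show ?thesis using assms unfolding x Tinf_iff by auto
qed

lemma T_low_cases:
  assumes "x \<in> Tinf" "fst x \<le> 4"
  shows "x \<in> {(1, 2), (1, 4), (2, 1), (2, 3), (3, 2), (3, 3), (3, 4)} \<or> fst x = 4"
  using T_head_cases[OF assms(1)] assms(2) by linarith

text \<open>The gap matters only for neighbours in column \<open>4\<close>. \<open>(2, 1)\<close>
  and \<open>(1, 2)\<close> are simplicial whenever present. Without them the cases depend on which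
  entries near \<open>(3, 3)\<close> are left, and three of them split off several cliques at
  once.\<close>

lemma T_head_reduction:
  assumes U: "U \<subseteq> Tinf" and hd: "\<exists>x\<in>U. fst x < 4" and "(Suc 4, 4) \<notin> U \<or> (\<forall>i<4. (i, 4) \<notin> U)"
  shows "\<exists>V\<subset>U. (\<forall>x\<in>U - V. fst x \<le> 4) \<and> (firm Tinf V \<longrightarrow> firm Tinf U)"
proof -
  have gap: "(1, 4) \<in> U \<Longrightarrow> (5, 4) \<notin> U" "(3, 4) \<in> U \<Longrightarrow> (5, 4) \<notin> U"
    using assms(3) by (auto simp: numeral_eq_Suc)
  note rect = T.reduction_rectangle[OF _ U]
  note T = T_rows T_cols
  have bot: "5 \<le> fst x" if "x \<in> U" "fst x \<noteq> 4"
    "x \<notin> {(1, 2), (1, 4), (2, 1), (2, 3), (3, 2), (3, 3), (3, 4)}" for x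
    using T_head_cases[of x] that U by (cases "fst x < 4") auto
  have chainN: "\<not> adj Tinf (h, c) x" if x: "x \<in> U" "5 \<le> fst x" and h: "(h, c) \<in> Tinf" "h < 4"
    "c = 4 \<longrightarrow> (5, 4) \<notin> U" for h c x
  proof -
    obtain i j where ij: "x = (i, j)" by force
    then have "j = i \<or> i = Suc j" "5 \<le> i" using x U T_rows(5)[of i j] by auto
    then show ?thesis
      using T.head_adj[of h c j] h x(1) by (auto simp: ij simp del: adj_Pair)
  qed
  have spineN: "\<not> adj Tinf (4, 1) x" if x: "x \<in> U" "5 \<le> fst x" for x
  proof -
    obtain i j where ij: "x = (i, j)" by force
    then have "j = i \<or> i = Suc j" "5 \<le> i" using x U T_rows(5)[of i j] by auto
    then show ?thesis using T.spine_adj[of j 1] by (auto simp: ij simp del: adj_Pair)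
  qed
  consider (c) "(2, 1) \<in> U" | (a) "(1, 2) \<in> U" | (none) "(2, 1) \<notin> U" "(1, 2) \<notin> U" by blast
  then show ?thesis
  proof cases
    case c
    show ?thesis by (rule rect[OF c, of "{2, 4}" "{1, 3}"]) (auto simp: T simp del: One_nat_def)
  next
    case a
    show ?thesis by (rule rect[OF a, of "{1, 3}" "{2, 4}"]) (auto simp: T simp del: One_nat_def)
  next
    case none
    consider (d1) "(2, 3) \<in> U" "(4, 1) \<notin> U" | (d2) "(2, 3) \<in> U" "(3, 3) \<notin> U"
      | (f) "(3, 3) \<in> U" "(2, 3) \<in> U \<Longrightarrow> (4, 1) \<in> U" | (nf) "(3, 3) \<notin> U" "(2, 3) \<notin> U" by blast
    then show ?thesis
    proof cases
      case d1
      have N: "(k, l) \<in> {2, 3, 4} \<times> {3}" if "(k, l) \<in> U" "adj Tinf (2, 3) (k, l)" for k l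
        using that none d1 U by (auto simp: T simp del: One_nat_def)
      show ?thesis by (rule rect[OF d1(1) N]) (auto simp: T simp del: One_nat_def)
    next
      case d2
      have N: "(k, l) \<in> {2, 4} \<times> {1, 3}" if "(k, l) \<in> U" "adj Tinf (2, 3) (k, l)" for k l
        using that none d2 U by (auto simp: T simp del: One_nat_def)
      show ?thesis by (rule rect[OF d2(1) N]) (auto simp: T simp del: One_nat_def)
    next
      case nf
      consider (e) "(3, 2) \<in> U" | (b) "(3, 2) \<notin> U" "(1, 4) \<in> U" | (g) "(3, 2) \<notin> U" "(1, 4) \<notin> U" "(3, 4) \<in> U"
        using hd none nf T_head_cases U by blast
      then show ?thesis
      proof cases
        case e
        have N: "(k, l) \<in> {1, 3} \<times> {2, 4}" if "(k, l) \<in> U" "adj Tinf (3, 2) (k, l)" for k l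
          using that none nf U by (auto simp: T simp del: One_nat_def)
        show ?thesis by (rule rect[OF e N]) (auto simp: T simp del: One_nat_def)
      next
        case b
        have N: "(k, l) \<in> {1, 3, 4} \<times> {4}" if "(k, l) \<in> U" "adj Tinf (1, 4) (k, l)" for k l
          using that none nf b gap U by (auto simp: T simp del: One_nat_def)
        show ?thesis by (rule rect[OF b(2) N]) (auto simp: T simp del: One_nat_def)
      next
        case g
        have N: "(k, l) \<in> {3, 4} \<times> {3, 4}" if "(k, l) \<in> U" "adj Tinf (3, 4) (k, l)" for k l
          using that none nf g gap U by (auto simp: T simp del: One_nat_def)
        show ?thesis by (rule rect[OF g(3) N]) (auto simp: T simp del: One_nat_def)
      qed
    next
      case f
      consider (bs) "(1, 4) \<in> U" "(4, 1) \<in> U" | (bn) "(1, 4) \<in> U" "(4, 1) \<notin> U" "(2, 3) \<notin> U"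
        | (e) "(1, 4) \<notin> U" "(3, 2) \<in> U" | (g) "(1, 4) \<notin> U" "(3, 2) \<notin> U" "(3, 4) \<in> U"
        | (fd) "(1, 4) \<notin> U" "(3, 2) \<notin> U" "(3, 4) \<notin> U" "(2, 3) \<in> U" "(4, 1) \<in> U"
        | (fn) "(1, 4) \<notin> U" "(3, 2) \<notin> U" "(3, 4) \<notin> U" "(2, 3) \<notin> U" using f by blast
      then show ?thesis
      proof cases
        case bs
        \<comment> \<open>Three cliques exhaust the rows up to \<open>4\<close>: row
          \<open>4\<close>, the head part of column \<open>3\<close>, and the block of rows
          \<open>1\<close>, \<open>3\<close> with columns \<open>2\<close>,
          \<open>4\<close>.\<close>
        let ?f = "\<lambda>x. if fst x = 4 then (4, 1) else if snd x = 3 then (3, 3) else (1, 4) :: nat \<times> nat"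
        let ?U1 = "{x \<in> U. fst x \<le> 4}"
        have low: "fst x = 4 \<or> x \<in> {(1, 4), (2, 3), (3, 2), (3, 3), (3, 4)}" if "x \<in> ?U1" for x
          using T_low_cases[of x] that U none by auto
        show ?thesis
        proof (rule T.reduction_join[of ?U1 U "{(4, 1), (3, 3), (1, 4)}" ?f])
          show "indep Tinf {(4, 1), (3, 3), (1, 4)}"
            unfolding indep_def by (auto simp: T simp del: One_nat_def)
          show "adj Tinf x y" if xy: "x \<in> ?U1" "y \<in> ?U1" "?f x = ?f y" for x y
          proof (cases "fst x = 4")
            case True
            then have "fst y = 4" using xy(3) by (auto split: if_splits)
            then show ?thesis using True xy(1,2) U by (cases x; cases y) auto
          next
            case False
            then have "fst y \<noteq> 4" using xy(3) by (auto split: if_splits)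
            then have "x \<in> {(1, 4), (2, 3), (3, 2), (3, 3), (3, 4)}"
              "y \<in> {(1, 4), (2, 3), (3, 2), (3, 3), (3, 4)}" using low xy(1,2) False by blast+
            then show ?thesis using xy(3) by (auto simp: T simp del: One_nat_def)
          qed
          show "\<not> adj Tinf e x" if "e \<in> {(4, 1), (3, 3), (1, 4)}" "x \<in> U - ?U1" for e x
          proof -
            have x: "x \<in> U" "5 \<le> fst x" using that(2) by auto
            show ?thesis
              using that(1) chainN[OF x, of 3 3] chainN[OF x, of 1 4] spineN[OF x] gap bs
              by (auto simp: T simp del: One_nat_def)
          qed
        qed (use bs f in auto)
      next
        case bn
        \<comment> \<open>Two blocks: rows \<open>1\<close>, \<open>3\<close> with columns
          \<open>2\<close>, \<open>4\<close>, and rows \<open>3\<close>, \<open>4\<close> with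
          columns \<open>3\<close>, \<open>4\<close>. The rest of row \<open>4\<close> stays in the
          remainder.\<close>
        let ?f = "\<lambda>x. if x \<in> {(1, 4), (3, 2), (3, 4)} then (1, 4) else (3, 3) :: nat \<times> nat"
        let ?U1 = "U \<inter> {(1, 4), (3, 2), (3, 4), (3, 3), (4, 3), (4, 4)}"
        show ?thesis
        proof (rule T.reduction_join[of ?U1 U "{(3, 3), (1, 4)}" ?f])
          show "indep Tinf {(3, 3), (1, 4)}"
            unfolding indep_def by (auto simp: T simp del: One_nat_def)
          show "adj Tinf x y" if xy: "x \<in> ?U1" "y \<in> ?U1" "?f x = ?f y" for x y
          proof (cases "x \<in> {(1, 4), (3, 2), (3, 4)}")
            case True
            then have "y \<in> {(1, 4), (3, 2), (3, 4)}" using xy(3) by (simp only: if_True split: if_splits) simp_all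
            then have "x \<in> {1, 3} \<times> {2, 4}" "y \<in> {1, 3} \<times> {2, 4}" using True by auto
            then show ?thesis by (rule adj_rectangle) (auto simp: T simp del: One_nat_def)
          next
            case False
            then have "y \<notin> {(1, 4), (3, 2), (3, 4)}" using xy(3) by (simp only: if_False split: if_splits) simp_all
            then have "x \<in> {3, 4} \<times> {3, 4}" "y \<in> {3, 4} \<times> {3, 4}" using False xy(1,2) by auto
            then show ?thesis by (rule adj_rectangle) (auto simp: T simp del: One_nat_def)
          qed
          show "\<not> adj Tinf e x" if "e \<in> {(3, 3), (1, 4)}" "x \<in> U - ?U1" for e x
          proof (cases "fst x \<le> 4")
            case True
            then have "fst x = 4" using T_low_cases[of x] that(2) U none bn f by auto
            then have "fst x = 4" "snd x \<noteq> 3" "snd x \<noteq> 4" using that(2) by (cases x; auto)+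
            moreover have "x \<in> Tinf" using that(2) U by blast
            ultimately show ?thesis using that(1) by (cases x) (auto simp: T simp del: One_nat_def)
          next
            case False
            then have x: "x \<in> U" "5 \<le> fst x" using that(2) by auto
            show ?thesis
              using that(1) chainN[OF x, of 3 3] chainN[OF x, of 1 4] gap bn
              by (auto simp: T simp del: One_nat_def)
          qed
        qed (use bn f in auto)
      next
        case e
        have N: "(k, l) \<in> {3} \<times> {2, 3, 4}" if "(k, l) \<in> U" "adj Tinf (3, 2) (k, l)" for k l
          using that none e U by (auto simp: T simp del: One_nat_def)
        show ?thesis by (rule rect[OF e(2) N]) (auto simp: T simp del: One_nat_def)
      next
        case g
        have N: "(k, l) \<in> {3, 4} \<times> {3, 4}" if "(k, l) \<in> U" "adj Tinf (3, 4) (k, l)" for k l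
          using that none g gap U by (auto simp: T simp del: One_nat_def)
        show ?thesis by (rule rect[OF g(3) N]) (auto simp: T simp del: One_nat_def)
      next
        case fd
        \<comment> \<open>Row \<open>4\<close> is one clique; all that is left of the head is in
          column \<open>3\<close> and forms another.\<close>
        let ?f = "\<lambda>x. if fst x = 4 then (4, 1) else (3, 3) :: nat \<times> nat"
        let ?U1 = "{x \<in> U. fst x \<le> 4}"
        have low: "fst x = 4 \<or> x \<in> {(2, 3), (3, 3)}" if "x \<in> ?U1" for x
          using T_low_cases[of x] that U none fd by auto
        show ?thesis
        proof (rule T.reduction_join[of ?U1 U "{(4, 1), (3, 3)}" ?f])
          show "indep Tinf {(4, 1), (3, 3)}"
            unfolding indep_def by (auto simp: T simp del: One_nat_def)
          show "adj Tinf x y" if xy: "x \<in> ?U1" "y \<in> ?U1" "?f x = ?f y" for x y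
          proof (cases "fst x = 4")
            case True
            then have "fst y = 4" using xy(3) by (auto split: if_splits)
            then show ?thesis using True xy(1,2) U by (cases x; cases y) auto
          next
            case False
            then have "fst y \<noteq> 4" using xy(3) by (auto split: if_splits)
            then have "x \<in> {(2, 3), (3, 3)}" "y \<in> {(2, 3), (3, 3)}" using low xy(1,2) False by blast+
            then show ?thesis using xy(3) by (auto simp: T simp del: One_nat_def)
          qed
          show "\<not> adj Tinf e x" if "e \<in> {(4, 1), (3, 3)}" "x \<in> U - ?U1" for e x
          proof -
            have x: "x \<in> U" "5 \<le> fst x" using that(2) by auto
            show ?thesis
              using that(1) chainN[OF x, of 3 3] spineN[OF x]
              by (auto simp: T simp del: One_nat_def)
          qed
        qed (use fd f in auto)
      next
        case fn
        have N: "(k, l) \<in> {3, 4} \<times> {3, 4}" if "(k, l) \<in> U" "adj Tinf (3, 3) (k, l)" for k l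
          using that none fn U by (auto simp: T simp del: One_nat_def)
        show ?thesis by (rule rect[OF f(1) N]) (auto simp: T simp del: One_nat_def)
      qed
    qed
  qed
qed

lemma firm_T_cut: "finite U \<Longrightarrow> T.cut b U \<Longrightarrow> firm Tinf U"
  by (rule T.firm_cut) (use T_head_reduction in blast)+

text \<open>With a complete chain that lacks \<open>(n, n)\<close>, the head is again the place to
  find a defect. There are two targets for peeling: \<open>firm4\<close>, once the head has left
  column \<open>4\<close>, and \<open>noc\<close>, once row \<open>2\<close> and
  \<open>(1, 2)\<close> are gone.\<close>

lemma firm_T_submatrix:
  assumes n: "5 \<le> n" and R: "R \<subseteq> {1..n}" and C: "C \<subseteq> {1..n}" and Q: "Q \<subseteq> Qset n"
    and proper: "R \<noteq> {1..n} \<or> C \<noteq> {1..n} \<or> Q \<noteq> Qset n"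
  shows "firm Tinf (Tinf \<inter> R \<times> C - Q)"
proof -
  define U where "U = Tinf \<inter> R \<times> C - Q"
  have U: "(i, j) \<in> U \<longleftrightarrow> (i, j) \<in> Tinf \<and> i \<in> R \<and> j \<in> C \<and> (i, j) \<notin> Q" for i j
    by (auto simp: U_def)
  have Qn: "(i, j) \<in> Q \<Longrightarrow> i = 1 \<and> j = 2 \<or> i = 2 \<and> j = 1 \<or> i = n \<and> j = n" for i j
    using Q by (auto simp: Qset_def)
  have le: "i \<le> n \<and> j \<le> n" if "(i, j) \<in> U" for i j using that R C by (auto simp: U)
  have US: "U \<subseteq> Tinf" by (auto simp: U_def)
  have fin: "finite U" by (rule finite_subset[of _ "{1..n} \<times> {1..n}"]) (use R C in \<open>auto simp: U_def\<close>)
  note T = T_rows T_cols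
  have up: "(Suc i, i) \<in> U" if "4 \<le> i" "(Suc i, Suc i) \<in> U" "(4, i) \<in> U" for i
    using that Qn[of "Suc i" i] by (auto simp: U T_rows)
  have down: "(Suc i, Suc i) \<in> U" if "4 \<le> i" "(Suc i, i) \<in> U" "(4, Suc i) \<in> U" "Suc i \<noteq> n \<or> (n, n) \<notin> Q" for i
  proof -
    have "Suc i \<in> R" "Suc i \<in> C" using that(2,3) by (auto simp: U)
    moreover have "(Suc i, Suc i) \<notin> Q"
    proof
      assume "(Suc i, Suc i) \<in> Q"
      moreover from Qn[OF this] have "Suc i = n" using that(1) by linarith
      ultimately show False using that(4) by simp
    qed
    moreover have "(Suc i, Suc i) \<in> Tinf" using that(1) by (simp add: T_rows)
    ultimately show ?thesis by (simp add: U)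
  qed
  consider (tail) "(n, n) \<in> U \<or> n \<notin> R \<or> n \<notin> C \<or> 4 \<notin> R"
    | (mid) b where "4 \<le> b" "b < n" "(Suc b, b) \<notin> U"
    | (full) "(n, n) \<notin> U" "n \<in> R" "n \<in> C" "4 \<in> R" "\<And>b. 4 \<le> b \<Longrightarrow> b < n \<Longrightarrow> (Suc b, b) \<in> U"
    by blast
  then have "firm Tinf U"
  proof cases
    case tail
    have "T.cut n U"
      unfolding T.cut_def
    proof (intro conjI allI impI)
      show "(Suc i, Suc i) \<in> U" if "4 \<le> i" "(Suc i, i) \<in> U" "(4, Suc i) \<in> U" for i
      proof (cases "Suc i = n")
        case True
        then have "n \<in> R" "n \<in> C" "4 \<in> R" using that by (auto simp: U)
        then show ?thesis using tail True by auto
      next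
        case False then show ?thesis using down[OF that] by blast
      qed
    qed (use n US le up in force)+
    then show ?thesis by (rule firm_T_cut[OF fin])
  next
    case mid
    have "T.cut b U"
      unfolding T.cut_def using mid US up down by auto
    then show ?thesis by (rule firm_T_cut[OF fin])
  next
    case full
    have rows: "i \<in> R" if "5 \<le> i" "i \<le> n" for i
      using full(5)[of "i - 1"] that by (auto simp: U)
    have cols: "i \<in> C" if "4 \<le> i" "i \<le> n" for i
      using full(5)[of i] full(3) that by (cases "i = n") (auto simp: U)
    have diag: "(j, j) \<in> U" if "4 < j" "j < n" for j
      using that rows[of j] cols[of j] Qn[of j j] by (auto simp: U T_rows)
    have last: "(4, n) \<in> U"
      using full n Qn[of 4 n] by (auto simp: U T_rows)
    have firm4: "firm Tinf V" if V: "V \<subseteq> U" "(1, 4) \<notin> V" "(3, 4) \<notin> V"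
      and upV: "\<And>i. 4 \<le> i \<Longrightarrow> (Suc i, Suc i) \<in> V \<Longrightarrow> (4, i) \<in> V \<Longrightarrow> (Suc i, i) \<in> V" for V
    proof (rule firm_T_cut[OF finite_subset[OF V(1) fin], of 4])
      have "(i, 4) \<notin> V" if "i < 4" for i
        using V US T_cols(4)[of i] that by auto
      then show "T.cut 4 V" unfolding T.cut_def using V upV US by auto
    qed
    have low: "i = 4 \<or> (i, j) \<in> {(1, 2), (2, 1), (2, 3), (3, 2), (3, 3)}"
      if ij: "(i, j) \<in> U" and "j < 4 \<or> n \<le> j" for i j
    proof (cases "i < 4")
      case True
      then show ?thesis using T_head_cases[of "(i, j)"] ij US that(2) n by auto
    next
      case False
      then have "i = 4 \<or> i = j \<or> i = Suc j" "i \<le> n" "j \<le> n"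
        using ij US le[OF ij] T_rows(5)[of i j] by auto
      then have "i = 4 \<or> i = n \<and> j = n" using that(2) False by linarith
      then show ?thesis using ij full(1) by blast
    qed
    have chainV: "(Suc i, i) \<in> {x \<in> V. \<not> adj Tinf (h, c) x}"
      if "(Suc i, i) \<in> V" "4 \<le> i" "(h, c) \<in> Tinf" "h < 4" "c \<noteq> 4" for i h c V
      using T.head_adj[of h c i] that by auto
    \<comment> \<open>\<open>upV\<close> records that rows and columns from \<open>4\<close> on have
      not been touched, so that chain and spine are still available for
      \<open>T.firm_columns\<close>.\<close>
    have noc: "firm Tinf V" if V: "V \<subseteq> U" "(1, 2) \<notin> V" "(2, 1) \<notin> V" "(2, 3) \<notin> V"
      and upV: "\<And>i j. 4 \<le> j \<Longrightarrow> 4 \<le> i \<Longrightarrow> (i, j) \<in> U \<Longrightarrow> (i, j) \<in> V" for V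
    proof -
      have VS: "V \<subseteq> Tinf" using V US by blast
      have up': "(Suc i, i) \<in> V" if "4 \<le> i" "(Suc i, Suc i) \<in> V" "(4, i) \<in> V" for i
        using upV[of i "Suc i"] up[of i] that V(1) by auto
      show ?thesis
      proof (cases "(3, 3) \<in> V")
        case f: True
        show ?thesis
        proof (cases "(1, 4) \<in> V")
          case b: True
          \<comment> \<open>The extra clique is row \<open>3\<close> without column
            \<open>4\<close>, and \<open>(1, 4)\<close> represents column \<open>4\<close>.\<close>
          show ?thesis
          proof (rule T.firm_columns[of n V 1 "V \<inter> {(3, 2), (3, 3)}" "(3, 3)"])
            show "i = 4" if "(i, j) \<in> V - V \<inter> {(3, 2), (3, 3)}" "j < 4 \<or> n \<le> j" for i j
              using low[of i j] that V by auto
          qed (use n b f VS diag last upV in \<open>auto simp: T simp del: One_nat_def\<close>)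
        next
          case b: False
          show ?thesis
          proof (cases "(3, 2) \<in> V")
            case e: True
            have N: "(k, l) \<in> {3} \<times> {2, 3, 4}" if "(k, l) \<in> V" "adj Tinf (3, 2) (k, l)" for k l
              using that b V VS by (auto simp: T simp del: One_nat_def)
            show ?thesis
            proof (rule firm_peel_rectangle[OF e VS N])
              show "firm Tinf {x \<in> V. \<not> adj Tinf (3, 2) x}"
                by (rule firm4) (use V b up' chainV[of _ V 3 2] in \<open>auto simp: T simp del: One_nat_def\<close>)
            qed (auto simp: T simp del: One_nat_def)
          next
            case e: False
            have N: "(k, l) \<in> {3, 4} \<times> {3, 4}" if "(k, l) \<in> V" "adj Tinf (3, 3) (k, l)" for k l
              using that b e V VS by (auto simp: T simp del: One_nat_def)
            show ?thesis
            proof (rule firm_peel_rectangle[OF f VS N])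
              show "firm Tinf {x \<in> V. \<not> adj Tinf (3, 3) x}"
                by (rule firm4) (use V b up' chainV[of _ V 3 3] in \<open>auto simp: T simp del: One_nat_def\<close>)
            qed (auto simp: T simp del: One_nat_def)
          qed
        qed
      next
        case f: False
        show ?thesis
        proof (cases "(3, 2) \<in> V")
          case e: True
          have N: "(k, l) \<in> {1, 3} \<times> {2, 4}" if "(k, l) \<in> V" "adj Tinf (3, 2) (k, l)" for k l
            using that f V VS by (auto simp: T simp del: One_nat_def)
          show ?thesis
          proof (rule firm_peel_rectangle[OF e VS N])
            show "firm Tinf {x \<in> V. \<not> adj Tinf (3, 2) x}"
              by (rule firm4) (use V up' chainV[of _ V 3 2] in \<open>auto simp: T simp del: One_nat_def\<close>)
          qed (auto simp: T simp del: One_nat_def)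
        next
          case e: False
          show ?thesis
          proof (cases "(1, 4) \<in> V \<or> (3, 4) \<in> V")
            case True
            then obtain h where h: "(h, 4) \<in> V" "h < 4" by force
            show ?thesis
            proof (rule T.firm_columns[of n V h "{}"])
              show "i = 4" if "(i, j) \<in> V - {}" "j < 4 \<or> n \<le> j" for i j
                using low[of i j] that V e f by auto
            qed (use n h VS diag last upV in auto)
          next
            case False
            show ?thesis by (rule firm4) (use V False up' in auto)
          qed
        qed
      qed
    qed
    consider (a) "(1, 2) \<in> U" | (c) "(1, 2) \<notin> U" "(2, 1) \<in> U" | (nd) "(1, 2) \<notin> U" "(2, 1) \<notin> U" "(2, 3) \<notin> U"
      | (e) "(1, 2) \<notin> U" "(2, 1) \<notin> U" "(2, 3) \<in> U" "(3, 2) \<in> U" "(1, 4) \<notin> U"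
      | (eb) "(1, 2) \<notin> U" "(2, 1) \<notin> U" "(2, 3) \<in> U" "(3, 2) \<in> U" "(1, 4) \<in> U"
      | (ne) "(1, 2) \<notin> U" "(2, 1) \<notin> U" "(2, 3) \<in> U" "(3, 2) \<notin> U" by blast
    then show ?thesis
    proof cases
      case a
      show ?thesis
      proof (rule firm_peel_rectangle[OF a US, of "{1, 3}" "{2, 4}"])
        show "firm Tinf {x \<in> U. \<not> adj Tinf (1, 2) x}"
          by (rule firm4) (use up chainV[of _ U 1 2] in \<open>auto simp: T simp del: One_nat_def\<close>)
      qed (auto simp: T simp del: One_nat_def)
    next
      case c
      show ?thesis
      proof (rule firm_peel_rectangle[OF c(2) US, of "{2, 4}" "{1, 3}"])
        show "firm Tinf {x \<in> U. \<not> adj Tinf (2, 1) x}"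
          by (rule noc) (use c in \<open>auto simp: T simp del: One_nat_def\<close>)
      qed (auto simp: T simp del: One_nat_def)
    next
      case nd
      then show ?thesis by (intro noc) auto
    next
      case e
      have N: "(k, l) \<in> {3} \<times> {2, 3, 4}" if "(k, l) \<in> U" "adj Tinf (3, 2) (k, l)" for k l
        using that e US by (auto simp: T simp del: One_nat_def)
      show ?thesis
      proof (rule firm_peel_rectangle[OF e(4) US N])
        show "firm Tinf {x \<in> U. \<not> adj Tinf (3, 2) x}"
          by (rule firm4) (use e up chainV[of _ U 3 2] in \<open>auto simp: T simp del: One_nat_def\<close>)
      qed (auto simp: T simp del: One_nat_def)
    next
      case eb
      \<comment> \<open>The entries present show that every other line is kept. With column
        \<open>1\<close> too, all of \<open>Qset n\<close> would have been removed, against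
        \<open>proper\<close>.\<close>
      have "1 \<notin> C"
      proof
        assume C1: "1 \<in> C"
        have RC: "1 \<in> R" "2 \<in> R" "3 \<in> R" "2 \<in> C" "3 \<in> C" using eb by (auto simp: U)
        have *: "i = 1 \<or> i = 2 \<or> i = 3 \<or> i = 4 \<or> 5 \<le> i" if "1 \<le> i" for i :: nat using that by linarith
        have "i \<in> R" if "1 \<le> i" "i \<le> n" for i
          using *[OF that(1)] rows[of i] RC full(4) that(2) by (elim disjE) simp_all
        then have "R = {1..n}" using R by auto
        moreover have "i \<in> C" if "1 \<le> i" "i \<le> n" for i
          using *[OF that(1)] cols[of i] RC C1 that(2) by (elim disjE) simp_all
        then have "C = {1..n}" using C by auto
        moreover have "(1, 2) \<in> Q" using eb(1) RC unfolding U T_rows by blast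
        moreover have "(2, 1) \<in> Q" using eb(2) RC C1 unfolding U T_rows by blast
        moreover have "(n, n) \<in> Q" using full(1,2,3) n unfolding U by (simp add: T_rows)
        ultimately have "R = {1..n}" "C = {1..n}" "Qset n \<subseteq> Q" by (simp_all add: Qset_def)
        then show False using proper Q by blast
      qed
      then have N: "(k, l) \<in> {2, 3, 4} \<times> {3}" if "(k, l) \<in> U" "adj Tinf (2, 3) (k, l)" for k l
        using that eb US U[of 4 1] by (auto simp: T simp del: One_nat_def)
      show ?thesis
      proof (rule firm_peel_rectangle[OF eb(3) US N])
        show "firm Tinf {x \<in> U. \<not> adj Tinf (2, 3) x}"
          by (rule noc) (use eb in \<open>auto simp: T simp del: One_nat_def\<close>)
      qed (auto simp: T simp del: One_nat_def)
    next
      case ne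
      show ?thesis
      proof (cases "(1, 4) \<in> U \<or> (3, 4) \<in> U")
        case True
        then obtain h where h: "(h, 4) \<in> U" "h < 4" by force
        have "(h, 4) \<in> Tinf" using h US by blast
        \<comment> \<open>Column \<open>3\<close> is the extra clique. Its representative
          \<open>(2, 3)\<close> lies in a row that avoids columns \<open>4\<close> and
          \<open>n\<close>, so it is far from \<open>(h, 4)\<close> and
          \<open>(4, n)\<close>.\<close>
        show ?thesis
        proof (rule T.firm_columns[of n U h "U \<inter> {(2, 3), (3, 3), (4, 3)}" "(2, 3)"])
          show "i = 4" if "(i, j) \<in> U - U \<inter> {(2, 3), (3, 3), (4, 3)}" "j < 4 \<or> n \<le> j" for i j
            using low[of i j] that ne by auto
        qed (use n h US diag last ne in \<open>auto simp: T simp del: One_nat_def\<close>)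
      next
        case False
        show ?thesis by (rule firm4) (use False up in auto)
      qed
    qed
  qed
  then show ?thesis by (simp add: U_def)
qed

text \<open>In cyclic order: \<open>(4,1), (2,3), (3,3), (3,2), (1,4), (5,4), (5,5), ..., (n, n -
  1), (4,n)\<close>. The edges from \<open>(4,1)\<close> to \<open>(2,3)\<close>, from
  \<open>(3,2)\<close> to \<open>(1,4)\<close> and from \<open>(n, n - 1)\<close> to
  \<open>(4,n)\<close> have the corners \<open>(2,1)\<close>, \<open>(1,2)\<close> and
  \<open>(n,n)\<close> in \<open>Qset n\<close>.\<close>

definition T_hole :: "nat \<Rightarrow> (nat \<times> nat) set" where
  "T_hole n = {(4, 1), (2, 3), (3, 3), (3, 2), (1, 4), (4, n)} \<union>
     (\<lambda>i. (Suc i, i)) ` {4..<n} \<union> (\<lambda>i. (i, i)) ` {5..<n}"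

definition T_next :: "nat \<Rightarrow> nat \<times> nat \<Rightarrow> nat \<times> nat" where
  "T_next n x = (if fst x = 4 then if snd x = 1 then (2, 3) else (4, 1) else if fst x = 2 then (3, 3)
    else if fst x = 3 then if snd x = 3 then (3, 2) else (1, 4)
    else if fst x = 1 then (5, 4) else if fst x = snd x then (Suc (snd x), snd x)
    else if fst x = n then (4, n) else (fst x, fst x))"

lemma T_next_simps:
  "T_next n (4, 1) = (2, 3)" "T_next n (2, 3) = (3, 3)" "T_next n (3, 3) = (3, 2)"
  "T_next n (3, 2) = (1, 4)" "T_next n (1, 4) = (5, 4)"
  "4 \<le> m \<Longrightarrow> T_next (Suc m) (4, Suc m) = (4, 1)"
  "4 \<le> j \<Longrightarrow> j < m \<Longrightarrow> T_next (Suc m) (Suc j, j) = (Suc j, Suc j)"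
  "4 \<le> m \<Longrightarrow> T_next (Suc m) (Suc m, m) = (4, Suc m)"
  "5 \<le> j \<Longrightarrow> T_next n (j, j) = (Suc j, j)"
  by (simp_all add: T_next_def)

lemma T_hole_cases:
  assumes "x \<in> T_hole (Suc m)"
  obtains "x = (4, 1)" | "x = (2, 3)" | "x = (3, 3)" | "x = (3, 2)" | "x = (1, 4)" | "x = (4, Suc m)"
  | j where "x = (Suc j, j)" "4 \<le> j" "j < m" | "x = (Suc m, m)"
  | j where "x = (j, j)" "5 \<le> j" "j \<le> m"
proof -
  from assms consider "x \<in> {(4, 1), (2, 3), (3, 3), (3, 2), (1, 4), (4, Suc m)}"
    | "x \<in> (\<lambda>i. (Suc i, i)) ` {4..<Suc m}" | "x \<in> (\<lambda>i. (i, i)) ` {5..<Suc m}"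
    unfolding T_hole_def by blast
  then show thesis
  proof cases
    case 1
    then show ?thesis using that(1-6) by blast
  next
    case 2
    then obtain j where "x = (Suc j, j)" "4 \<le> j" "j \<le> m" by auto
    then show ?thesis using that(7)[of j] that(8) by (cases "j = m") auto
  next
    case 3
    then show ?thesis using that(9) by auto
  qed
qed

lemma T_hole_mem:
  "(4, 1) \<in> T_hole n" "(2, 3) \<in> T_hole n" "(3, 3) \<in> T_hole n" "(3, 2) \<in> T_hole n"
  "(1, 4) \<in> T_hole n" "(4, n) \<in> T_hole n" "4 \<le> j \<Longrightarrow> j < n \<Longrightarrow> (Suc j, j) \<in> T_hole n"
  "5 \<le> j \<Longrightarrow> j < n \<Longrightarrow> (j, j) \<in> T_hole n"
  by (auto simp: T_hole_def)

lemma not_firm_T_hole: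
  assumes m: "4 \<le> m"
  shows "\<not> firm Tinf (T_hole (Suc m))"
proof (rule not_firm_odd_hole[where g = "T_next (Suc m)"])
  let ?A = "{(4, 1), (2, 3), (3, 3), (3, 2), (1, 4), (4, Suc m)} :: (nat \<times> nat) set"
  let ?B = "(\<lambda>i. (Suc i, i)) ` {4..<Suc m}" and ?C = "(\<lambda>i. (i, i)) ` {5..<Suc m}"
  have "card (?A \<union> ?B \<union> ?C) = card (?A \<union> ?B) + card ?C"
    by (rule card_Un_disjoint) (use m in auto)
  also have "card (?A \<union> ?B) = card ?A + card ?B"
  proof (rule card_Un_disjoint)
    have "?A \<inter> ?B \<subseteq> {x. fst x \<le> 4} \<inter> {x. 5 \<le> fst x}" by (rule Int_mono) auto
    also have "\<dots> = {}" by auto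
    finally show "?A \<inter> ?B = {}" by blast
  qed simp_all
  also have "card ?A = 6" using m by auto
  also have "card ?B = m - 3" by (subst card_image) (auto simp: inj_on_def)
  also have "card ?C = m - 4" by (subst card_image) (auto simp: inj_on_def)
  finally have "card (T_hole (Suc m)) = 6 + (m - 3) + (m - 4)" by (simp add: T_hole_def)
  then have "card (T_hole (Suc m)) = 2 * (m - 4) + 7" using m by simp
  then show "odd (card (T_hole (Suc m)))" by simp
  show "T_hole (Suc m) \<subseteq> Tinf" using m by (auto simp: T_hole_def T_rows simp del: One_nat_def)
  show "inj_on (T_next (Suc m)) (T_hole (Suc m))"
  proof (rule inj_onI)
    fix x y assume xy: "x \<in> T_hole (Suc m)" "y \<in> T_hole (Suc m)" "T_next (Suc m) x = T_next (Suc m) y"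
    from xy(1) show "x = y"
      by (cases rule: T_hole_cases; use xy(2) in \<open>cases rule: T_hole_cases\<close>;
          use xy(3) m in \<open>simp add: T_next_simps del: One_nat_def\<close>)
  qed
  fix x assume x: "x \<in> T_hole (Suc m)"
  from x show "T_next (Suc m) x \<in> T_hole (Suc m) \<and> T_next (Suc m) x \<noteq> x \<and> adj Tinf x (T_next (Suc m) x) \<and>
      T_next (Suc m) (T_next (Suc m) (T_next (Suc m) x)) \<noteq> x"
    by (cases rule: T_hole_cases; use m T_hole_mem(7)[of 4 "Suc m"] in
      \<open>auto simp: T_next_simps T_hole_mem T_rows simp del: One_nat_def\<close>)
      (auto simp: T_next_def split: if_splits)
  fix y assume y: "y \<in> T_hole (Suc m)" "adj Tinf x y"
  from x show "x = y \<or> y = T_next (Suc m) x \<or> x = T_next (Suc m) y"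
    by (cases rule: T_hole_cases; use y(1) in \<open>cases rule: T_hole_cases\<close>;
        use y(2) m in \<open>auto simp: T_next_simps T.chain_adj T.spine_adj T.head_adj T_rows
          simp del: One_nat_def adj_Pair\<close>)
      (auto simp: T_rows simp del: One_nat_def)
qed

lemma not_firm_T:
  assumes n: "5 \<le> n"
  shows "\<not> firm Tinf (Tinf \<inter> {1..n} \<times> {1..n} - Qset n)"
proof
  let ?U = "Tinf \<inter> {1..n} \<times> {1..n} - Qset n"
  \<comment> \<open>The entries off the hole are \<open>(3,4)\<close>, \<open>(4,3)\<close>,
    \<open>(4,4)\<close> and \<open>(4,j)\<close> with \<open>5 \<le> j < n\<close>. For instance,
    column \<open>2\<close> meets only rows \<open>1\<close> and \<open>3\<close>, and both meet
    column \<open>4\<close>, so \<open>(3,4)\<close> dominates \<open>(3,2)\<close>.\<close>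
  define h where "h x = (if x = (3, 4) then (3, 2) else if x = (4, 3) then (2, 3) else
    if x = (4, 4) then (5, 4) else (snd x, snd x))" for x :: "nat \<times> nat"
  have hole: "T_hole n \<subseteq> ?U"
    using n by (auto simp: T_hole_def T_rows Qset_def simp del: One_nat_def)
  assume "firm Tinf ?U"
  then have "firm Tinf (?U - (?U - T_hole n))"
  proof (rule firm_remove_dominated[where h = h])
    fix v assume v: "v \<in> ?U - T_hole n"
    obtain i j where ij: "v = (i, j)" by force
    have v': "(i, j) \<in> Tinf" "i \<le> n" "j \<le> n" "(i, j) \<notin> T_hole n" "(i, j) \<notin> {(1, 2), (2, 1), (n, n)}"
      using v by (auto simp: ij Qset_def)
    have *: "v = (3, 4) \<or> v = (4, 3) \<or> v = (4, 4) \<or> i = 4 \<and> 5 \<le> j \<and> j < n"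
    proof -
      consider "i < 4" | "i = 4" | "5 \<le> i" by linarith
      then show ?thesis
      proof cases
        case 1
        then show ?thesis using T_head_cases[OF v'(1)] v' T_hole_mem[of n] by (auto simp: ij simp del: One_nat_def)
      next
        case 2
        then have "j = 3 \<or> j = 4 \<or> 5 \<le> j \<and> j < n"
          using v' T_hole_mem(1,6)[of n] by (cases "j = n") (auto simp: T_rows simp del: One_nat_def)
        then show ?thesis using 2 by (auto simp: ij)
      next
        case 3
        then have "j = i \<and> i < n \<or> i = Suc j \<and> 4 \<le> j \<and> j < n" using v' by (auto simp: T_rows)
        then show ?thesis using v'(4) T_hole_mem(7,8)[of j n] 3 by auto
      qed
    qed
    have "(5, 4) \<in> T_hole n" using T_hole_mem(7)[of 4 n] n by simp
    then have "h v \<in> T_hole n"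
      using * T_hole_mem(2,4)[of n] T_hole_mem(8)[of j n] by (auto simp: h_def ij)
    then show "h v \<in> ?U - (?U - T_hole n)" using hole by blast
    show "adj Tinf v x" if x: "x \<in> ?U" "adj Tinf (h v) x" for x
    proof -
      obtain k l where kl: "x = (k, l)" by force
      have xT: "(k, l) \<in> Tinf" "\<not> (k = 1 \<and> l = 2)" "\<not> (k = 2 \<and> l = 1)" using x(1) by (auto simp: kl Qset_def)
      consider (a) "v = (3, 4)" | (b) "v = (4, 3)" | (c) "v = (4, 4)" | (d) "i = 4" "5 \<le> j" using * by blast
      then show ?thesis
      proof cases
        case a
        then have "h v = (3, 2)" by (simp add: h_def)
        then show ?thesis using a x(2) xT by (auto simp: kl T_rows T_cols simp del: One_nat_def)
      next
        case b
        then have "h v = (2, 3)" by (simp add: h_def)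
        then show ?thesis using b x(2) xT by (auto simp: kl T_rows T_cols simp del: One_nat_def)
      next
        case c
        then have "h v = (5, 4)" by (simp add: h_def)
        then show ?thesis using c x(2) xT by (auto simp: kl T_rows T_cols simp del: One_nat_def)
      next
        case d
        then have "h v = (j, j)" by (simp add: h_def ij)
        then show ?thesis using d x(2) by (auto simp: ij kl T_rows simp del: One_nat_def)
      qed
    qed
  qed auto
  moreover have "?U - (?U - T_hole n) = T_hole n" using hole by blast
  moreover obtain m where "n = Suc m" "4 \<le> m" using n by (cases n) auto
  ultimately show False using not_firm_T_hole[of m] by simp
qed

lemma nrows_Tmat: "nrows (Tmat n) = n" and ncols_Tmat: "ncols (Tmat n) = n"
  by (simp_all add: Tmat_def nrows_def ncols_def)

lemma minimally_non_firm_T: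
  assumes n: "5 \<le> n"
  shows "minimally_non_firm (stretch (Qset n) (Tmat n))"
proof (rule minimally_non_firm_stretchI; (unfold nrows_Tmat ncols_Tmat)?)
  note S = supp_Tmat[OF n]
  note tr = firm_restrict[of _ Tinf "{1..n}" "{1..n}", folded S]
  show "Qset n \<subseteq> supp (Tmat n)" using n by (auto simp: S Qset_def Tinf_iff)
  show "\<not> firm (supp (Tmat n)) (supp (Tmat n) - Qset n)"
    using not_firm_T[OF n] tr[of "supp (Tmat n) - Qset n"] unfolding S by blast
  fix R C Q' assume *: "R \<subseteq> {1..n}" "C \<subseteq> {1..n}" "Q' \<subseteq> Qset n"
    "R \<noteq> {1..n} \<or> C \<noteq> {1..n} \<or> Q' \<noteq> Qset n"
  have "supp (Tmat n) \<inter> R \<times> C - Q' = Tinf \<inter> R \<times> C - Q'" using * unfolding S by blast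
  then show "firm (supp (Tmat n)) (supp (Tmat n) \<inter> R \<times> C - Q')"
    using firm_T_submatrix[OF n *] tr[of "supp (Tmat n) \<inter> R \<times> C - Q'"] by auto
qed

lemma totally_balanced_T:
  assumes n: "5 \<le> n"
  shows "totally_balanced (stretch (Qset n) (Tmat n))"
proof (rule totally_balanced_stretch)
  show "Qset n \<subseteq> supp (Tmat n)" using n by (auto simp: supp_Tmat Qset_def Tinf_iff)
  \<comment> \<open>Row \<open>4\<close> is full except in column \<open>2\<close>. So row
    \<open>4\<close> goes last, and column \<open>2\<close> goes first, where it never is the later
    of two columns.\<close>
  show "totally_balanced (Tmat n)"
  proof (rule totally_balanced_exchangeI[of "\<lambda>i. if i = 4 then Suc n + n else if i \<le> n then i else i + n + 5"
        "\<lambda>j. if j = 2 then 0 else Suc j"])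
    show "inj (\<lambda>i. if i = 4 then Suc n + n else if i \<le> n then i else i + n + 5)"
      by (rule injI) (auto split: if_splits)
    show "inj (\<lambda>j. if j = 2 then 0 else Suc j)"
      by (rule injI) (auto split: if_splits)
    fix i k j l :: nat
    let ?\<rho> = "\<lambda>i. if i = 4 then Suc n + n else if i \<le> n then i else i + n + 5"
    assume a: "?\<rho> i < ?\<rho> k" "(if j = 2 then 0 else Suc j) < (if l = 2 then 0 else Suc l)"
      "(i, j) \<in> supp (Tmat n)" "(i, l) \<in> supp (Tmat n)" "(k, j) \<in> supp (Tmat n)"
    then have D: "(i, j) \<in> Tinf" "(i, l) \<in> Tinf" "(k, j) \<in> Tinf" "i \<le> n" "k \<le> n" "l \<le> n" "1 \<le> k" "1 \<le> l"
      by (auto simp: supp_Tmat[OF n])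
    have jl: "l \<noteq> 2" "j = 2 \<or> j < l" using a(2) by (auto split: if_splits)
    have "k = 4 \<or> i \<noteq> 4 \<and> i < k" using a(1) D(4,5) by (auto split: if_splits)
    then have "(k, l) \<in> Tinf"
    proof
      assume "k = 4"
      then show ?thesis using D(8) jl(1) by (auto simp: Tinf_iff)
    next
      assume ik: "i \<noteq> 4 \<and> i < k"
      have "i = 1 \<or> i = 2 \<or> i = 3 \<or> 5 \<le> i" using D(1) ik unfolding Tinf_iff by linarith
      then show ?thesis
      proof (elim disjE)
        assume "i = 1"
        then have "j = 2 \<or> j = 4" "l = 4" using D(1,2) jl by (auto simp: T_rows simp del: One_nat_def)
        then have "j = 2" using jl by auto
        then have "k = 1 \<or> k = 3" using D(3) by (auto simp: T_cols simp del: One_nat_def)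
        then show ?thesis using \<open>l = 4\<close> by (auto simp: T_cols)
      next
        assume "i = 2"
        then have "j = 1" "l = 3" using D(1,2) jl by (auto simp: T_rows simp del: One_nat_def)
        then have "k = 2 \<or> k = 4" using D(3) by (auto simp: T_cols simp del: One_nat_def)
        then show ?thesis using \<open>l = 3\<close> by (auto simp: T_cols)
      next
        assume i: "i = 3"
        then have "j = 2 \<or> j = 3" using D(1,2) jl by (auto simp: T_rows simp del: One_nat_def)
        then have "k = 1 \<or> k = 2 \<or> k = 3 \<or> k = 4" using D(3) by (auto simp: T_cols)
        then show ?thesis using ik i \<open>1 \<le> l\<close> jl(1) by (auto simp: T_rows)
      next
        assume i: "5 \<le> i"
        then have "l = i \<or> Suc l = i" "j = i \<or> Suc j = i" using D(1,2) by (simp_all add: T_rows)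
        then have "i = Suc j" using jl i by linarith
        moreover have "j = k \<or> Suc j = k" using D(3) ik i by (simp add: T_rows)
        ultimately show ?thesis using ik by linarith
      qed
    qed
    then show "(k, l) \<in> supp (Tmat n)" using D by (simp add: supp_Tmat[OF n])
  qed
qed

theorem theorem4:
  fixes n :: nat
  assumes "n \<ge> 4"
  shows "minimally_non_firm (stretch {(n, n)} (Mmat n)) \<and>
         minimally_non_firm (stretch (Gset (n - 1)) (Hmat (n - 1))) \<and>
         minimally_non_firm (stretch (Qset n) (Dmat n)) \<and>
         minimally_non_firm (stretch (Qset (n + 1)) (Tmat (n + 1))) \<and>
         totally_balanced (stretch (Qset n) (Dmat n)) \<and>
         totally_balanced (stretch (Qset (n + 1)) (Tmat (n + 1)))"
proof -
  have "3 \<le> n - 1" "5 \<le> n + 1" using assms by auto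
  then show ?thesis
    using assms minimally_non_firm_M minimally_non_firm_H minimally_non_firm_D minimally_non_firm_T
      totally_balanced_D totally_balanced_T by blast
qed

end
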